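(* For $z\in[0,1]$ the following are equivalent: (1) $z$ is density random; (2) $z$ is a dyadic Lebesgue point for each integral test; (3) $z$ is a Lebesgue point for each integral test.
   Context: $\mu$ is Lebesgue measure on $[0,1]$. $z$ is density random if $z$ is Martin-Löf random and $\varrho(\mathcal C\mid z)=1$ for every effectively closed ($\Pi^0_1$) class $\mathcal C\subseteq[0,1]$ containing $z$, where $\varrho(\mathcal C\mid z)=\liminf_{\gamma,\delta\to0^+}\mu([z-\gamma,z+\delta]\cap\mathcal C)/(\gamma+\delta)$. An integral test is an integrable lower semicomputable function $f:[0,1]\to[0,\infty]$. For $z$ with binary expansion $0.Z$ let $[Z\upharpoonright n]$ denote the dyadic interval $[0.(Z\upharpoonright n),0.(Z\upharpoonright n)+2^{-n}]$. $z$ is a dyadic Lebesgue point of $f$ if $f(z)<\infty$ and $\lim_n 2^n\int_{[Z\upharpoonright n]}f\,d\mu=f(z)$; $z$ is a Lebesgue point of $f$ if $f(z)<\infty$ and $\frac{1}{\mu(Q)}\int_Qf\,d\mu\to f(z)$ as $Q$ ranges over intervals containing $z$ with length tending to $0$. *)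

theory Defs
  imports "HOL-Analysis.Analysis" "HOL-Library.Nat_Bijection" "HOL-Library.Countable"
begin

text \<open>
  \<open>computable n f\<close>: on argument lists of length \<open>n\<close>, \<open>f\<close> is a total (general) recursive
  function. Values of \<open>f\<close> on lists of other lengths are irrelevant. Minimisation is restricted
  to the regular case, which suffices for generating all total recursive functions.
\<close>

inductive computable :: "nat \<Rightarrow> (nat list \<Rightarrow> nat) \<Rightarrow> bool" where
  zero: "computable n (\<lambda>xs. 0)"
| succ: "computable 1 (\<lambda>xs. Suc (hd xs))"
| proj: "i < n \<Longrightarrow> computable n (\<lambda>xs. xs ! i)"
| comp: "computable (length gs) f \<Longrightarrow> (\<forall>g \<in> set gs. computable n g)
    \<Longrightarrow> computable n (\<lambda>xs. f (map (\<lambda>g. g xs) gs))"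
| prim_rec: "computable n f \<Longrightarrow> computable (Suc (Suc n)) g
    \<Longrightarrow> computable (Suc n)
          (\<lambda>xs. rec_nat (f (tl xs)) (\<lambda>k r. g (k # r # tl xs)) (hd xs))"
| minimise: "computable (Suc n) f \<Longrightarrow> (\<forall>xs. length xs = n \<longrightarrow> (\<exists>k. f (k # xs) = 0))
    \<Longrightarrow> computable n (\<lambda>xs. LEAST k. f (k # xs) = 0)"

definition ce :: "nat set \<Rightarrow> bool" where
  "ce W \<longleftrightarrow> W = {} \<or> (\<exists>f. computable 1 f \<and> W = range (\<lambda>n. f [n]))"

text \<open>
  \<open>nat_to_rat_surj\<close> decodes numerator and denominator by \<open>prod_decode\<close> and \<open>int_decode\<close>,
  so it is an effective enumeration (with repetitions) of all rationals.
\<close>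

definition rat_code :: "nat \<Rightarrow> real" where
  "rat_code n = of_rat (nat_to_rat_surj n)"

definition rat_interval :: "nat \<Rightarrow> real set" where
  "rat_interval k = (case prod_decode k of (a, b) \<Rightarrow> {rat_code a <..< rat_code b})"

text \<open>Openness is relative to \<open>[0,1]\<close>, hence the intersection.\<close>

definition eff_open :: "real set \<Rightarrow> bool" where
  "eff_open U \<longleftrightarrow> (\<exists>W. ce W \<and> U = {0..1} \<inter> (\<Union>k\<in>W. rat_interval k))"

definition unif_eff_open :: "(nat \<Rightarrow> real set) \<Rightarrow> bool" where
  "unif_eff_open U \<longleftrightarrow> (\<exists>W. ce W \<and>
     (\<forall>m. U m = {0..1} \<inter> (\<Union>k\<in>{k. prod_encode (m, k) \<in> W}. rat_interval k)))"

definition eff_closed :: "real set \<Rightarrow> bool" where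
  "eff_closed C \<longleftrightarrow> C \<subseteq> {0..1} \<and> eff_open ({0..1} - C)"

definition ml_test :: "(nat \<Rightarrow> real set) \<Rightarrow> bool" where
  "ml_test U \<longleftrightarrow> unif_eff_open U \<and> (\<forall>m. measure lborel (U m) \<le> (1 / 2) ^ m)"

definition ml_random :: "real \<Rightarrow> bool" where
  "ml_random z \<longleftrightarrow> z \<in> {0..1} \<and> (\<forall>U. ml_test U \<longrightarrow> z \<notin> (\<Inter>m. U m))"

definition lower_density :: "real set \<Rightarrow> real \<Rightarrow> ereal" where
  "lower_density C z = Liminf (at_right 0 \<times>\<^sub>F at_right 0)
     (\<lambda>(\<gamma>, \<delta>). ereal (measure lborel ({z - \<gamma>..z + \<delta>} \<inter> C) / (\<gamma> + \<delta>)))"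

definition density_random :: "real \<Rightarrow> bool" where
  "density_random z \<longleftrightarrow> ml_random z \<and>
     (\<forall>C. eff_closed C \<and> z \<in> C \<longrightarrow> lower_density C z = 1)"

text \<open>
  A function \<open>[0,1] \<rightarrow> [0,\<infinity>]\<close> is represented by a function on all reals whose values outside
  \<open>[0,1]\<close> are never used. It is lower semicomputable if its strict superlevel sets at rational
  levels are uniformly effectively open; in particular it is then Borel on \<open>[0,1]\<close>, so that
  integrability amounts to finiteness of the integral.
\<close>

definition lower_semicomputable :: "(real \<Rightarrow> ennreal) \<Rightarrow> bool" where
  "lower_semicomputable f \<longleftrightarrow>
     unif_eff_open (\<lambda>m. {x \<in> {0..1}. ereal (rat_code m) < enn2ereal (f x)})"

definition integral_test :: "(real \<Rightarrow> ennreal) \<Rightarrow> bool" where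
  "integral_test f \<longleftrightarrow> lower_semicomputable f \<and> (\<integral>\<^sup>+x\<in>{0..1}. f x \<partial>lborel) < \<infinity>"

definition binary_expansion :: "real \<Rightarrow> (nat \<Rightarrow> bool) \<Rightarrow> bool" where
  "binary_expansion z Z \<longleftrightarrow> (\<lambda>i. of_bool (Z i) / 2 ^ Suc i) sums z"

definition dyadic_interval :: "(nat \<Rightarrow> bool) \<Rightarrow> nat \<Rightarrow> real set" where
  "dyadic_interval Z n =
     (let a = (\<Sum>i<n. of_bool (Z i) / 2 ^ Suc i) in {a .. a + 1 / 2 ^ n})"

text \<open>
  Dyadic rationals in \<open>(0,1)\<close> have two binary expansions; the limit is required along each.
\<close>

definition dyadic_lebesgue_point :: "(real \<Rightarrow> ennreal) \<Rightarrow> real \<Rightarrow> bool" where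
  "dyadic_lebesgue_point f z \<longleftrightarrow> f z < \<infinity> \<and>
     (\<forall>Z. binary_expansion z Z \<longrightarrow>
        (\<lambda>n. 2 ^ n * (\<integral>\<^sup>+x\<in>dyadic_interval Z n. f x \<partial>lborel)) \<longlonglongrightarrow> f z)"

text \<open>
  Nondegenerate intervals \<open>Q \<subseteq> [0,1]\<close> containing \<open>z\<close> (with or without their endpoints),
  as their length tends to \<open>0\<close>.
\<close>

definition shrinking_intervals :: "real \<Rightarrow> real set filter" where
  "shrinking_intervals z =
     inf (filtercomap (measure lborel) (at_right 0))
         (principal {Q. is_interval Q \<and> Q \<subseteq> {0..1} \<and> z \<in> Q})"

definition lebesgue_point :: "(real \<Rightarrow> ennreal) \<Rightarrow> real \<Rightarrow> bool" where
  "lebesgue_point f z \<longleftrightarrow> f z < \<infinity> \<and>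
     ((\<lambda>Q. (\<integral>\<^sup>+x\<in>Q. f x \<partial>lborel) / emeasure lborel Q) \<longlongrightarrow> f z) (shrinking_intervals z)"

end

theory Submission
  imports Defs
begin

text \<open>
  Density random points are Lebesgue points: let \<open>O\<close> consist of the intervals on which the average of
  the test \<open>f\<close> exceeds \<open>l\<close>. By the maximal inequality these sets form a Martin-Loef test as \<open>l\<close> grows,
  so a random \<open>z\<close> avoids one of them. Each component of \<open>O\<close>, cut by an interval \<open>Q\<close> around \<open>z\<close>, has
  an end point outside \<open>O\<close>, so \<open>f\<close> has average at most \<open>l\<close> on it. Adding \<open>{f > q}\<close> to \<open>O\<close>, where
  \<open>q > f z\<close>, the integral of \<open>f\<close> over \<open>Q\<close> is at most \<open>q |Q| + l |Q \<inter> O|\<close>, and \<open>O\<close> has density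
  \<open>0\<close> at \<open>z\<close>.

  From dyadic Lebesgue points to density randomness, only unbounded tests, for Martin-Loef randomness,
  and indicators of effectively open sets are used, so the issue is to pass from dyadic to full
  density. If an effectively open \<open>U\<close> has dyadic but not full density \<open>0\<close> at \<open>z\<close>, then infinitely
  many dyadic cells around \<open>z\<close> have a neighbour where \<open>U\<close> is dense. Mark the left half of every cell
  with such a neighbour. Either \<open>z\<close> avoids the marks within some cell \<open>J\<close>, and the marks within \<open>J\<close>
  form an effectively open set of positive upper dyadic density at \<open>z\<close>; or \<open>z\<close> is marked within
  every cell around it. Since \<open>U\<close> is sparse in these cells, the maximal inequality bounds the marked
  part of each by half of its measure, and iterating yields a Martin-Loef test that captures \<open>z\<close>.
\<close>

section \<open>A calculus of recursive functions\<close>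

text \<open>A test may be unbounded, so a small measure of \<open>{f > q}\<close> near
  \<open>z\<close> says nothing about the mass of \<open>f\<close> there; the heavy intervals are
  what turns measure into mass. To enumerate them, \<open>f\<close> is replaced by an increasing
  sequence of step functions with recursive values: at stage \<open>s\<close> everything is constant
  on dyadic cells of length \<open>1 / 2 ^ s\<close>, and averages become finite sums of naturals.
  Cells are half-open and rational intervals open; they differ by dyadic rationals, which form a
  null set without random points. In the converse direction, a Martin-Loef test has to be small
  everywhere and not only near \<open>z\<close>. So a cell may produce a mark at a stage only if
  \<open>U\<close> still looks sparse in it at that stage; around \<open>z\<close> this check
  succeeds at all stages from some level on. Cells marked for the first time are disjoint, which
  allows the halving to be iterated along chains of cells. The constants derive from the factor
  \<open>5\<close> of the Vitali covering lemma.\<close>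

definition computes :: "nat \<Rightarrow> (nat list \<Rightarrow> nat) \<Rightarrow> bool" where
  "computes n f \<longleftrightarrow> (\<exists>g. computable n g \<and> (\<forall>xs. length xs = n \<longrightarrow> g xs = f xs))"

lemma computesI: "computable n f \<Longrightarrow> computes n f"
  by (auto simp: computes_def)

text \<open>The rules of \<open>computable\<close> yield functions of a rigid shape with accidental
  values on lists of other lengths. Agreement on lists of length \<open>n\<close> is all that
  \<open>computes\<close> records, so terms can be rewritten freely.\<close>

lemma computes_cong:
  "computes n f \<Longrightarrow> (\<And>xs. length xs = n \<Longrightarrow> f xs = g xs) \<Longrightarrow> computes n g"
  unfolding computes_def by metis

lemma computes_nth: "i < n \<Longrightarrow> computes n (\<lambda>xs. xs ! i)"
  by (intro computesI computable.proj)

lemma computes_comp1: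
  assumes "computes 1 (\<lambda>xs. F (xs ! 0))" "computes n a"
  shows "computes n (\<lambda>xs. F (a xs))"
proof -
  obtain F' a' where *: "computable 1 F'" "\<And>xs. length xs = 1 \<Longrightarrow> F' xs = F (xs ! 0)"
    "computable n a'" "\<And>xs. length xs = n \<Longrightarrow> a' xs = a xs"
    using assms unfolding computes_def by metis
  have "computable n (\<lambda>xs. F' (map (\<lambda>g. g xs) [a']))"
    by (rule computable.comp) (use * in auto)
  then show ?thesis
    by (rule computes_cong[OF computesI]) (use * in auto)
qed

lemma computes_comp2:
  assumes "computes 2 (\<lambda>xs. F (xs ! 0) (xs ! 1))" "computes n a" "computes n b"
  shows "computes n (\<lambda>xs. F (a xs) (b xs))"
proof -
  obtain F' a' b' where *: "computable 2 F'" "\<And>xs. length xs = 2 \<Longrightarrow> F' xs = F (xs ! 0) (xs ! 1)"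
    "computable n a'" "\<And>xs. length xs = n \<Longrightarrow> a' xs = a xs"
    "computable n b'" "\<And>xs. length xs = n \<Longrightarrow> b' xs = b xs"
    using assms unfolding computes_def by metis
  have "computable n (\<lambda>xs. F' (map (\<lambda>g. g xs) [a', b']))"
    by (rule computable.comp) (use * in \<open>auto simp: numeral_2_eq_2\<close>)
  then show ?thesis
    by (rule computes_cong[OF computesI]) (use * in auto)
qed

lemma computes_Suc: "computes n a \<Longrightarrow> computes n (\<lambda>xs. Suc (a xs))"
  by (rule computes_comp1[where F = Suc])
    (rule computes_cong[OF computesI[OF computable.succ]], auto simp: length_Suc_conv)

lemma computes_const: "computes n (\<lambda>xs. c)"
proof (induction c)
  case 0
  show ?case by (intro computesI computable.zero)
qed (rule computes_Suc)

lemma computes_rec: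
  assumes "computes n f" "computes (Suc (Suc n)) g"
  shows "computes (Suc n) (\<lambda>xs. rec_nat (f (tl xs)) (\<lambda>k r. g (k # r # tl xs)) (hd xs))"
proof -
  obtain f' g' where *: "computable n f'" "\<And>xs. length xs = n \<Longrightarrow> f' xs = f xs"
    "computable (Suc (Suc n)) g'" "\<And>xs. length xs = Suc (Suc n) \<Longrightarrow> g' xs = g xs"
    using assms unfolding computes_def by metis
  show ?thesis
  proof (rule computes_cong[OF computesI[OF computable.prim_rec[OF *(1,3)]]])
    fix xs :: "nat list" assume "length xs = Suc n"
    then show "rec_nat (f' (tl xs)) (\<lambda>k r. g' (k # r # tl xs)) (hd xs)
        = rec_nat (f (tl xs)) (\<lambda>k r. g (k # r # tl xs)) (hd xs)"
      using * by simp
  qed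
qed

lemma length_eq_1_2_iff:
  "length xs = Suc 0 \<longleftrightarrow> (\<exists>a. xs = [a])" "length xs = 2 \<longleftrightarrow> (\<exists>a b. xs = [a, b])"
  by (auto simp: numeral_2_eq_2 length_Suc_conv)

lemma computes_plus: "computes n a \<Longrightarrow> computes n b \<Longrightarrow> computes n (\<lambda>xs. a xs + b xs)"
proof (rule computes_comp2[where F = "\<lambda>x y. x + y"])
  have rec: "rec_nat y (\<lambda>k r. Suc r) x = x + y" for x y :: nat
    by (induction x) auto
  have "computes 2 (\<lambda>xs. rec_nat (tl xs ! 0) (\<lambda>k r. Suc ((k # r # tl xs) ! 1)) (hd xs))"
    unfolding numeral_2_eq_2
    by (rule computes_rec) (auto intro: computes_nth computes_Suc)
  then show "computes 2 (\<lambda>xs. xs ! 0 + xs ! 1)"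
    by (rule computes_cong) (auto simp: length_eq_1_2_iff rec)
qed

lemma computes_times: "computes n a \<Longrightarrow> computes n b \<Longrightarrow> computes n (\<lambda>xs. a xs * b xs)"
proof (rule computes_comp2[where F = "\<lambda>x y. x * y"])
  have rec: "rec_nat 0 (\<lambda>k r. r + y) x = x * y" for x y :: nat
    by (induction x) auto
  have "computes 2 (\<lambda>xs. rec_nat 0 (\<lambda>k r. (k # r # tl xs) ! 1 + (k # r # tl xs) ! 2) (hd xs))"
    unfolding numeral_2_eq_2
    by (rule computes_rec) (auto intro!: computes_nth computes_const computes_plus)
  then show "computes 2 (\<lambda>xs. xs ! 0 * xs ! 1)"
    by (rule computes_cong) (auto simp: length_eq_1_2_iff rec)
qed

lemma computes_pred: "computes n a \<Longrightarrow> computes n (\<lambda>xs. a xs - Suc 0)"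
proof (rule computes_comp1[where F = "\<lambda>x. x - Suc 0"])
  have rec: "rec_nat 0 (\<lambda>k r. k) x = x - 1" for x :: nat
    by (induction x) auto
  have "computes 1 (\<lambda>xs. rec_nat 0 (\<lambda>k r. (k # r # tl xs) ! 0) (hd xs))"
    unfolding One_nat_def
    by (rule computes_rec) (auto intro!: computes_nth computes_const)
  then show "computes 1 (\<lambda>xs. xs ! 0 - Suc 0)"
    by (rule computes_cong) (auto simp: length_eq_1_2_iff rec)
qed

lemma computes_minus: "computes n a \<Longrightarrow> computes n b \<Longrightarrow> computes n (\<lambda>xs. a xs - b xs)"
proof (rule computes_comp2[where F = "\<lambda>y x. x - y"])
  have rec: "rec_nat y (\<lambda>k r. r - Suc 0) x = y - x" for x y :: nat
    by (induction x) auto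
  have "computes 2 (\<lambda>xs. rec_nat (tl xs ! 0) (\<lambda>k r. (k # r # tl xs) ! 1 - 1) (hd xs))"
    unfolding numeral_2_eq_2
    by (rule computes_rec) (auto intro!: computes_nth computes_pred)
  then show "computes 2 (\<lambda>xs. xs ! 1 - xs ! 0)"
    by (rule computes_cong) (auto simp: length_eq_1_2_iff rec)
qed

lemma computes_triangle: "computes n a \<Longrightarrow> computes n (\<lambda>xs. triangle (a xs))"
proof (rule computes_comp1[where F = triangle])
  have rec: "rec_nat 0 (\<lambda>k r. Suc (r + k)) x = triangle x" for x :: nat
    by (induction x) auto
  have "computes 1 (\<lambda>xs. rec_nat 0 (\<lambda>k r. (k # r # tl xs) ! 1 + Suc ((k # r # tl xs) ! 0)) (hd xs))"
    unfolding One_nat_def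
    by (rule computes_rec) (auto intro!: computes_nth computes_const computes_plus computes_Suc)
  then show "computes 1 (\<lambda>xs. triangle (xs ! 0))"
    by (rule computes_cong) (auto simp: length_eq_1_2_iff rec)
qed

lemma computes_prod_encode:
  "computes n a \<Longrightarrow> computes n b \<Longrightarrow> computes n (\<lambda>xs. prod_encode (a xs, b xs))"
  unfolding prod_encode_def by (auto intro!: computes_plus computes_triangle)

text \<open>Inverting the pairing function amounts to finding the diagonal \<open>a + b\<close> of the pair, which is
  the only use of minimisation below.\<close>

lemma Least_diagonal:
  "(LEAST d. 1 - (triangle (Suc d) - prod_encode (a, b)) = 0) = a + b"
proof (rule Least_equality)
  show "1 - (triangle (Suc (a + b)) - prod_encode (a, b)) = 0"
    by (simp add: prod_encode_def)
next
  fix d assume d: "1 - (triangle (Suc d) - prod_encode (a, b)) = 0"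
  show "a + b \<le> d"
  proof (rule ccontr)
    assume "\<not> a + b \<le> d"
    then have "Suc d \<le> a + b" by simp
    then have "triangle (Suc d) \<le> triangle (a + b)"
      by (rule lift_Suc_mono_le[rotated]) simp
    with d show False by (simp add: prod_encode_def)
  qed
qed

lemma computes_diagonal: "computes 1 (\<lambda>xs. fst (prod_decode (xs ! 0)) + snd (prod_decode (xs ! 0)))"
proof -
  \<comment> \<open>Minimisation searches for a zero; truncated subtraction makes this term vanish
    exactly if the code lies below the next triangular number.\<close>
  have "computes 2 (\<lambda>xs. 1 - (triangle (Suc (xs ! 0)) - xs ! 1))"
    by (auto intro!: computes_minus computes_const computes_triangle computes_plus computes_Suc computes_nth)
  then obtain g where g: "computable 2 g"
    "\<And>xs. length xs = 2 \<Longrightarrow> g xs = 1 - (triangle (Suc (xs ! 0)) - xs ! 1)"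
    unfolding computes_def by blast
  have val: "g [d, prod_encode (a, b)] = 1 - (triangle (Suc d) - prod_encode (a, b))" for d a b
    using g(2)[of "[d, prod_encode (a, b)]"] by simp
  have ex: "\<exists>k. g (k # xs) = 0" if "length xs = 1" for xs
  proof -
    from that obtain c where xs: "xs = [c]" by (auto simp: length_eq_1_2_iff)
    obtain a b where c: "c = prod_encode (a, b)" by (metis prod_decode_inverse surj_pair)
    have "g ((a + b) # xs) = 0" unfolding xs c val by (simp add: prod_encode_def)
    then show ?thesis by blast
  qed
  have "computable 1 (\<lambda>xs. LEAST k. g (k # xs) = 0)"
    by (rule computable.minimise) (use g ex in \<open>auto simp: numeral_2_eq_2\<close>)
  then show ?thesis
  proof (rule computes_cong[OF computesI])
    fix xs :: "nat list" assume "length xs = 1"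
    then obtain c where xs: "xs = [c]" by (auto simp: length_eq_1_2_iff)
    obtain a b where c: "c = prod_encode (a, b)" by (metis prod_decode_inverse surj_pair)
    show "(LEAST k. g (k # xs) = 0) = fst (prod_decode (xs ! 0)) + snd (prod_decode (xs ! 0))"
      unfolding xs c val Least_diagonal by simp
  qed
qed

lemma computes_fst: "computes n a \<Longrightarrow> computes n (\<lambda>xs. fst (prod_decode (a xs)))"
proof (rule computes_comp1[where F = "\<lambda>x. fst (prod_decode x)"])
  have "fst (prod_decode c) = c - triangle (fst (prod_decode c) + snd (prod_decode c))" for c
    by (cases "prod_decode c", use prod_decode_inverse[of c] in \<open>simp add: prod_encode_def\<close>)
  note * = this
  show "computes 1 (\<lambda>xs. fst (prod_decode (xs ! 0)))"
    by (rule computes_cong[OF computes_minus[OF computes_nth computes_triangle[OF computes_diagonal]]])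
      (rule zero_less_one, rule *[symmetric])
qed

lemma computes_snd: "computes n a \<Longrightarrow> computes n (\<lambda>xs. snd (prod_decode (a xs)))"
proof (rule computes_comp1[where F = "\<lambda>x. snd (prod_decode x)"])
  show "computes 1 (\<lambda>xs. snd (prod_decode (xs ! 0)))"
    by (rule computes_cong[OF computes_minus[OF computes_diagonal computes_fst[OF computes_nth]]])
      (rule zero_less_one, rule diff_add_inverse)
qed

section \<open>Recursive functions of one variable, with arguments coded as pairs\<close>

definition recursive :: "(nat \<Rightarrow> nat) \<Rightarrow> bool" where
  "recursive f \<longleftrightarrow> computes 1 (\<lambda>xs. f (xs ! 0))"

named_theorems rec_intros

lemma recursive_computes: "recursive f \<Longrightarrow> computes n a \<Longrightarrow> computes n (\<lambda>xs. f (a xs))"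
  unfolding recursive_def by (drule (1) computes_comp1) simp

lemma recursive_comp: "recursive f \<Longrightarrow> recursive a \<Longrightarrow> recursive (\<lambda>x. f (a x))"
  unfolding recursive_def[of a] recursive_def[of "\<lambda>x. f (a x)"] by (rule recursive_computes)

lemma recursive_const [rec_intros]: "recursive (\<lambda>x. c)"
  unfolding recursive_def by (rule computes_const)

lemma recursive_id [rec_intros]: "recursive (\<lambda>x. x)"
  unfolding recursive_def by (rule computes_nth) simp

lemma recursive_Suc [rec_intros]: "recursive a \<Longrightarrow> recursive (\<lambda>x. Suc (a x))"
  unfolding recursive_def by (rule computes_Suc)

lemma recursive_fst [rec_intros]: "recursive a \<Longrightarrow> recursive (\<lambda>x. fst (prod_decode (a x)))"
  unfolding recursive_def by (rule computes_fst)

lemma recursive_snd [rec_intros]: "recursive a \<Longrightarrow> recursive (\<lambda>x. snd (prod_decode (a x)))"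
  unfolding recursive_def by (rule computes_snd)

lemma recursive_plus [rec_intros]:
  "recursive a \<Longrightarrow> recursive b \<Longrightarrow> recursive (\<lambda>x. a x + b x)"
  unfolding recursive_def by (rule computes_plus)

lemma recursive_minus [rec_intros]:
  "recursive a \<Longrightarrow> recursive b \<Longrightarrow> recursive (\<lambda>x. a x - b x)"
  unfolding recursive_def by (rule computes_minus)

lemma recursive_times [rec_intros]:
  "recursive a \<Longrightarrow> recursive b \<Longrightarrow> recursive (\<lambda>x. a x * b x)"
  unfolding recursive_def by (rule computes_times)

lemma recursive_prod_encode [rec_intros]:
  "recursive a \<Longrightarrow> recursive b \<Longrightarrow> recursive (\<lambda>x. prod_encode (a x, b x))"
  unfolding recursive_def by (rule computes_prod_encode)

abbreviation recursive2 :: "(nat \<Rightarrow> nat \<Rightarrow> nat) \<Rightarrow> bool" where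
  "recursive2 f \<equiv> recursive (\<lambda>y. f (fst (prod_decode y)) (snd (prod_decode y)))"

lemma recursive2_comp:
  assumes "recursive2 f" "recursive a" "recursive b"
  shows "recursive (\<lambda>x. f (a x) (b x))"
  using recursive_comp[OF assms(1) recursive_prod_encode[OF assms(2,3)]] by simp

text \<open>The parameter \<open>x\<close> becomes a second argument of the recursion, so that the
  step function may depend on it; \<open>g\<close> is required to be recursive in the nested pair of
  counter, previous value and parameter.\<close>

lemma recursive_rec_nat:
  assumes "recursive b" "recursive c"
    and g: "recursive (\<lambda>y. g (fst (prod_decode y)) (fst (prod_decode (snd (prod_decode y))))
      (snd (prod_decode (snd (prod_decode y)))))"
  shows "recursive (\<lambda>x. rec_nat (b x) (\<lambda>k r. g k r x) (c x))"
proof (rule recursive2_comp[OF _ assms(2) recursive_id])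
  have "computes 2 (\<lambda>xs. rec_nat (b (tl xs ! 0)) (\<lambda>k r. g ((k # r # tl xs) ! 0)
      ((k # r # tl xs) ! 1) ((k # r # tl xs) ! 2)) (hd xs))"
    unfolding numeral_2_eq_2
  proof (rule computes_rec)
    show "computes (Suc 0) (\<lambda>xs. b (xs ! 0))" using assms(1) by (simp add: recursive_def)
    have "computes 3 (\<lambda>xs. (\<lambda>y. g (fst (prod_decode y)) (fst (prod_decode (snd (prod_decode y))))
      (snd (prod_decode (snd (prod_decode y))))) (prod_encode (xs ! 0, prod_encode (xs ! 1, xs ! 2))))"
      by (intro recursive_computes[OF g] computes_prod_encode computes_nth) auto
    then show "computes (Suc (Suc (Suc 0))) (\<lambda>xs. g (xs ! 0) (xs ! 1) (xs ! Suc (Suc 0)))"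
      by (simp add: numeral_2_eq_2 numeral_3_eq_3)
  qed
  then have "computes 2 (\<lambda>xs. rec_nat (b (xs ! 1)) (\<lambda>k r. g k r (xs ! 1)) (xs ! 0))"
    by (rule computes_cong) (auto simp: length_eq_1_2_iff)
  from computes_comp2[OF this computes_fst[OF computes_nth] computes_snd[OF computes_nth], of 0 1 0]
  show "recursive2 (\<lambda>c x. rec_nat (b x) (\<lambda>k r. g k r x) c)"
    unfolding recursive_def by simp
qed

lemma recursive_sum [rec_intros]:
  assumes "recursive c" "recursive2 f"
  shows "recursive (\<lambda>x. \<Sum>i<c x. f i x)"
proof -
  have *: "(\<Sum>i<n. f i x) = rec_nat 0 (\<lambda>k r. r + f k x) n" for n x
    by (induction n) auto
  show ?thesis unfolding *
    by (intro recursive_rec_nat recursive_const assms(1) recursive_plus recursive2_comp[OF assms(2)]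
        rec_intros)
qed

lemma recursive_power2 [rec_intros]: "recursive a \<Longrightarrow> recursive (\<lambda>x. 2 ^ a x)"
proof -
  have *: "2 ^ n = rec_nat 1 (\<lambda>k r. 2 * r) n" for n :: nat
    by (induction n) auto
  show "recursive a \<Longrightarrow> ?thesis" unfolding *
    by (intro recursive_rec_nat rec_intros)
qed

abbreviation decidable :: "(nat \<Rightarrow> bool) \<Rightarrow> bool" where
  "decidable P \<equiv> recursive (\<lambda>x. of_bool (P x))"

abbreviation decidable2 :: "(nat \<Rightarrow> nat \<Rightarrow> bool) \<Rightarrow> bool" where
  "decidable2 P \<equiv> decidable (\<lambda>y. P (fst (prod_decode y)) (snd (prod_decode y)))"

lemma decidable_comp: "decidable P \<Longrightarrow> recursive a \<Longrightarrow> decidable (\<lambda>x. P (a x))"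
  by (rule recursive_comp)

lemma decidable_not [rec_intros]: "decidable P \<Longrightarrow> decidable (\<lambda>x. \<not> P x)"
proof -
  have *: "of_bool (\<not> p) = 1 - (of_bool p :: nat)" for p by simp
  show "decidable P \<Longrightarrow> ?thesis" unfolding * by (intro rec_intros)
qed

lemma decidable_conj [rec_intros]: "decidable P \<Longrightarrow> decidable Q \<Longrightarrow> decidable (\<lambda>x. P x \<and> Q x)"
  unfolding of_bool_conj by (intro rec_intros)

lemma decidable_less [rec_intros]: "recursive a \<Longrightarrow> recursive b \<Longrightarrow> decidable (\<lambda>x. a x < b x)"
proof -
  have *: "of_bool (m < n) = 1 - (1 - (n - m))" for m n :: nat by auto
  show "recursive a \<Longrightarrow> recursive b \<Longrightarrow> ?thesis" unfolding * by (intro rec_intros)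
qed

lemma decidable_cong: "decidable P \<Longrightarrow> (\<And>x. P x \<longleftrightarrow> Q x) \<Longrightarrow> decidable Q"
  by simp

lemma decidable_le [rec_intros]: "recursive a \<Longrightarrow> recursive b \<Longrightarrow> decidable (\<lambda>x. a x \<le> b x)"
  unfolding linorder_not_less[symmetric] by (intro rec_intros)

lemma decidable_disj [rec_intros]: "decidable P \<Longrightarrow> decidable Q \<Longrightarrow> decidable (\<lambda>x. P x \<or> Q x)"
  by (rule decidable_cong[of "\<lambda>x. \<not> (\<not> P x \<and> \<not> Q x)"]) (intro rec_intros | simp)+

lemma decidable_eq [rec_intros]: "recursive a \<Longrightarrow> recursive b \<Longrightarrow> decidable (\<lambda>x. a x = b x)"
  unfolding order_eq_iff[where 'a = nat] by (intro rec_intros)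

lemma decidable_ex [rec_intros]:
  assumes "recursive c" "decidable2 P"
  shows "decidable (\<lambda>x. \<exists>i<c x. P i x)"
proof (rule decidable_cong)
  show "decidable (\<lambda>x. 0 < (\<Sum>i<c x. of_bool (P i x) :: nat))"
    by (intro rec_intros assms)
qed (auto simp: sum_nonneg_eq_0_iff simp flip: neq0_conv)

lemma recursive_if [rec_intros]:
  assumes "decidable P" "recursive a" "recursive b"
  shows "recursive (\<lambda>x. if P x then a x else b x)"
proof -
  have "recursive (\<lambda>x. of_bool (P x) * a x + (1 - of_bool (P x)) * b x)"
    by (intro rec_intros assms)
  then show ?thesis by (rule back_subst[of recursive]) auto
qed

lemma recursive_div [rec_intros]:
  assumes "recursive a" "recursive b"
  shows "recursive (\<lambda>x. a x div b x)"
proof -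
  \<comment> \<open>The quotient is the number of positive multiples of \<open>n\<close> up to
    \<open>m\<close>, and it is at most \<open>m\<close>, which bounds the search. Division by
    \<open>0\<close> is separate because the count would then be \<open>m\<close>.\<close>
  have *: "m div n = (if n = 0 then 0 else \<Sum>q<m. of_bool (Suc q * n \<le> m))" for m n :: nat
  proof (cases "n = 0")
    case False
    have "{q. q < m \<and> Suc q * n \<le> m} = {..<m div n}"
      using False div_le_dividend[of m n]
      by (auto simp: less_eq_div_iff_mult_less_eq[symmetric] Suc_le_eq simp del: mult_Suc div_le_dividend)
    then have "card {q. q < m \<and> Suc q * n \<le> m} = m div n" by simp
    moreover have "(\<Sum>q<m. of_bool (Suc q * n \<le> m)) = card {q. q < m \<and> Suc q * n \<le> m}"
      by (simp add: sum.If_cases of_bool_def Collect_conj_eq lessThan_def del: mult_Suc)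
    ultimately show ?thesis using False by simp
  qed simp
  show ?thesis unfolding *
    by (intro rec_intros assms recursive_comp[OF assms(1)] recursive_comp[OF assms(2)])
qed

lemma decidable_even [rec_intros]: "recursive a \<Longrightarrow> decidable (\<lambda>x. even (a x))"
proof -
  have *: "even n \<longleftrightarrow> 2 * (n div 2) = n" for n :: nat by presburger
  show "recursive a \<Longrightarrow> ?thesis" unfolding * by (intro rec_intros)
qed


section \<open>Rational codes and dyadic numbers\<close>

lemma int_decode_eq:
  "int_decode n = (if even n then int (n div 2) else - int (Suc (n div 2)))"
  by (simp add: int_decode_def sum_decode_def)

lemma rat_code_eq:
  "rat_code k = of_int (int_decode (fst (prod_decode k))) / of_int (int_decode (snd (prod_decode k)))"
proof (cases "int_decode (snd (prod_decode k)) = 0")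
  case True
  then show ?thesis
    by (simp add: rat_code_def nat_to_rat_surj_def case_prod_beta rat_number_collapse)
qed (simp add: rat_code_def nat_to_rat_surj_def of_rat_rat case_prod_beta)

text \<open>Positive and negative part of \<open>int_decode n\<close>. Subtraction of naturals
  truncates, so signed numbers are carried as differences of naturals.\<close>

definition pos_code :: "nat \<Rightarrow> nat" where
  "pos_code n = (if even n then n div 2 else 0)"

definition neg_code :: "nat \<Rightarrow> nat" where
  "neg_code n = (if even n then 0 else Suc (n div 2))"

lemma int_decode_diff: "int_decode n = int (pos_code n) - int (neg_code n)"
  by (simp add: int_decode_eq pos_code_def neg_code_def)

lemma recursive_pos_code [rec_intros]: "recursive a \<Longrightarrow> recursive (\<lambda>x. pos_code (a x))"
  unfolding pos_code_def by (intro rec_intros)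

lemma recursive_neg_code [rec_intros]: "recursive a \<Longrightarrow> recursive (\<lambda>x. neg_code (a x))"
  unfolding neg_code_def by (intro rec_intros)

definition rat_num_pos :: "nat \<Rightarrow> nat" where
  "rat_num_pos k = (let a = fst (prod_decode k); b = snd (prod_decode k)
     in pos_code a * pos_code b + neg_code a * neg_code b)"

definition rat_num_neg :: "nat \<Rightarrow> nat" where
  "rat_num_neg k = (let a = fst (prod_decode k); b = snd (prod_decode k)
     in pos_code a * neg_code b + neg_code a * pos_code b)"

text \<open>One of the two parts is zero, so their sum is the absolute value of the
  denominator.\<close>

definition rat_den :: "nat \<Rightarrow> nat" where
  "rat_den k = (let b = snd (prod_decode k) in if b = 0 then 1 else (pos_code b + neg_code b) ^ 2)"

lemma recursive_rat_num_pos [rec_intros]: "recursive a \<Longrightarrow> recursive (\<lambda>x. rat_num_pos (a x))"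
  unfolding rat_num_pos_def Let_def by (intro rec_intros)

lemma recursive_rat_num_neg [rec_intros]: "recursive a \<Longrightarrow> recursive (\<lambda>x. rat_num_neg (a x))"
  unfolding rat_num_neg_def Let_def by (intro rec_intros)

lemma recursive_rat_den [rec_intros]: "recursive a \<Longrightarrow> recursive (\<lambda>x. rat_den (a x))"
  unfolding rat_den_def Let_def power2_eq_square by (intro rec_intros)

text \<open>The fraction is expanded by its denominator, which makes the new denominator positive. A zero
  denominator stands for the rational \<open>0\<close>.\<close>

lemma rat_code_quotient:
  "rat_code k = (real (rat_num_pos k) - real (rat_num_neg k)) / real (rat_den k)" "0 < rat_den k"
proof -
  obtain a b where k: "prod_decode k = (a, b)" by fastforce
  have b0: "int_decode b = 0 \<longleftrightarrow> b = 0"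
    by (auto simp: int_decode_eq elim!: evenE intro!: Nat.gr0I)
  have pn: "pos_code b * neg_code b = 0"
    by (simp add: pos_code_def neg_code_def)
  show "0 < rat_den k"
    using b0 by (auto simp: rat_den_def k int_decode_diff Let_def)
  show "rat_code k = (real (rat_num_pos k) - real (rat_num_neg k)) / real (rat_den k)"
  proof (cases "b = 0")
    case True
    then show ?thesis
      using b0 by (simp add: rat_code_eq k rat_num_pos_def rat_num_neg_def pos_code_def neg_code_def)
  next
    case False
    define B where "B = real_of_int (int_decode b)"
    have "B \<noteq> 0" using False b0 by (simp add: B_def)
    have B: "B = real (pos_code b) - real (neg_code b)"
      by (simp add: B_def int_decode_diff)
    have "real (pos_code b) * real (neg_code b) = 0"
      using pn by (metis of_nat_0 of_nat_mult)
    then have "real (rat_den k) = B * B"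
      using False unfolding rat_den_def k Let_def B
      by (simp add: power2_eq_square algebra_simps)
    moreover have "real (rat_num_pos k) - real (rat_num_neg k) = real_of_int (int_decode a) * B"
      by (simp add: rat_num_pos_def rat_num_neg_def k B int_decode_diff Let_def algebra_simps)
    ultimately show ?thesis
      using \<open>B \<noteq> 0\<close> by (simp add: rat_code_eq k B_def)
  qed
qed

text \<open>Cross-multiplication, with the negative part of the numerator moved to the other side,
  leaves a comparison of naturals.\<close>

lemma decidable_rat_code_less [rec_intros]:
  assumes "recursive k" "recursive i" "recursive s"
  shows "decidable (\<lambda>x. rat_code (k x) < real (i x) / 2 ^ s x)"
proof (rule decidable_cong)
  show "decidable (\<lambda>x. rat_num_pos (k x) * 2 ^ s x < i x * rat_den (k x) + rat_num_neg (k x) * 2 ^ s x)"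
    by (intro rec_intros assms)
  fix x
  have "rat_code (k x) < real (i x) / 2 ^ s x \<longleftrightarrow>
      real (rat_num_pos (k x) * 2 ^ s x) < real (i x * rat_den (k x) + rat_num_neg (k x) * 2 ^ s x)"
    using rat_code_quotient(2)[of "k x"] unfolding rat_code_quotient(1)
    by (simp add: field_simps)
  then show "rat_num_pos (k x) * 2 ^ s x < i x * rat_den (k x) + rat_num_neg (k x) * 2 ^ s x \<longleftrightarrow>
      rat_code (k x) < real (i x) / 2 ^ s x"
    unfolding of_nat_less_iff by simp
qed

lemma decidable_less_rat_code [rec_intros]:
  assumes "recursive k" "recursive i" "recursive s"
  shows "decidable (\<lambda>x. real (i x) / 2 ^ s x < rat_code (k x))"
proof (rule decidable_cong)
  show "decidable (\<lambda>x. i x * rat_den (k x) + rat_num_neg (k x) * 2 ^ s x < rat_num_pos (k x) * 2 ^ s x)"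
    by (intro rec_intros assms)
  fix x
  have "real (i x) / 2 ^ s x < rat_code (k x) \<longleftrightarrow>
      real (i x * rat_den (k x) + rat_num_neg (k x) * 2 ^ s x) < real (rat_num_pos (k x) * 2 ^ s x)"
    using rat_code_quotient(2)[of "k x"] unfolding rat_code_quotient(1)
    by (simp add: field_simps)
  then show "i x * rat_den (k x) + rat_num_neg (k x) * 2 ^ s x < rat_num_pos (k x) * 2 ^ s x \<longleftrightarrow>
      real (i x) / 2 ^ s x < rat_code (k x)"
    unfolding of_nat_less_iff by simp
qed

text \<open>Doubling is the code of a nonnegative integer under \<open>int_decode\<close>.\<close>

definition dyadic_code :: "nat \<Rightarrow> nat \<Rightarrow> nat" where
  "dyadic_code i s = prod_encode (2 * i, 2 * 2 ^ s)"

lemma recursive_dyadic_code [rec_intros]: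
  "recursive i \<Longrightarrow> recursive s \<Longrightarrow> recursive (\<lambda>x. dyadic_code (i x) (s x))"
  unfolding dyadic_code_def by (intro rec_intros)

lemma rat_code_dyadic_code [simp]: "rat_code (dyadic_code i s) = real i / 2 ^ s"
  by (simp add: rat_code_eq dyadic_code_def int_decode_eq)

lemma rat_code_surj: "r \<in> \<rat> \<Longrightarrow> \<exists>k. rat_code k = r"
  using surj_of_rat_nat_to_rat_surj[of r] by (auto simp: rat_code_def)

lemma rat_interval_prod_encode [simp]:
  "rat_interval (prod_encode (a, b)) = {rat_code a<..<rat_code b}"
  by (simp add: rat_interval_def)

lemma mem_rat_interval_iff:
  "x \<in> rat_interval k \<longleftrightarrow> rat_code (fst (prod_decode k)) < x \<and> x < rat_code (snd (prod_decode k))"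
  by (simp add: rat_interval_def split: prod.split)

section \<open>Effectively open sets\<close>

lemma computable_recursive: "computable 1 F \<Longrightarrow> recursive (\<lambda>n. F [n])"
  unfolding recursive_def
  by (rule computes_cong[OF computesI], assumption) (auto simp: length_eq_1_2_iff)

text \<open>Where \<open>P\<close> fails, the enumeration repeats a fixed value and so stays total.
  Describing c.e. sets as such images also covers the empty set uniformly.\<close>

lemma ce_image_decidable:
  assumes "decidable P" "recursive f"
  shows "ce (f ` {x. P x})"
proof (cases "\<exists>x. P x")
  case True
  then obtain a where "P a" by blast
  then have *: "f ` {x. P x} = range (\<lambda>x. if P x then f x else f a)" by auto
  have "recursive (\<lambda>x. if P x then f x else f a)"
    by (intro rec_intros assms)
  then obtain g where "computable 1 g" "\<And>xs. length xs = 1 \<Longrightarrow> g xs = (if P (xs ! 0) then f (xs ! 0) else f a)"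
    unfolding recursive_def computes_def by metis
  then show ?thesis
    unfolding ce_def * by (intro disjI2 exI[of _ g]) auto
qed (simp add: ce_def)

lemma ce_recursiveE:
  assumes "ce W"
  obtains P f where "decidable P" "recursive f" "W = f ` {x. P x}"
proof (cases "W = {}")
  case True
  with recursive_const[of 0] recursive_id show ?thesis
    by (intro that[of "\<lambda>x. False" "\<lambda>x. x"]) auto
next
  case False
  with assms obtain F where "computable 1 F" "W = range (\<lambda>n. F [n])"
    unfolding ce_def by blast
  then show ?thesis
    using recursive_const[of 1] computable_recursive
    by (intro that[of "\<lambda>x. True" "\<lambda>n. F [n]"]) auto
qed

text \<open>The working format for uniform families: an admissible index \<open>x\<close>
  contributes the interval coded by \<open>f x\<close> to the member number
  \<open>g x\<close>.\<close>

lemma unif_eff_openI: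
  assumes "decidable P" "recursive g" "recursive f"
    and "\<And>m. U m = {0..1} \<inter> (\<Union>x\<in>{x. P x \<and> g x = m}. rat_interval (f x))"
  shows "unif_eff_open U"
  unfolding unif_eff_open_def
proof (intro exI conjI allI)
  show "ce ((\<lambda>x. prod_encode (g x, f x)) ` {x. P x})"
    by (intro ce_image_decidable rec_intros assms)
qed (auto simp: assms(4))

lemma unif_eff_openE:
  assumes "unif_eff_open U"
  obtains P g f where "decidable P" "recursive g" "recursive f"
    "\<forall>m. U m = {0..1} \<inter> (\<Union>x\<in>{x. P x \<and> g x = m}. rat_interval (f x))"
proof -
  obtain W where W: "ce W"
    "\<And>m. U m = {0..1} \<inter> (\<Union>k\<in>{k. prod_encode (m, k) \<in> W}. rat_interval k)"
    using assms unfolding unif_eff_open_def by blast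
  obtain P w where P: "decidable P" "recursive w" "W = w ` {x. P x}"
    using ce_recursiveE[OF W(1)] .
  show ?thesis
  proof (rule that[OF P(1), of "\<lambda>x. fst (prod_decode (w x))" "\<lambda>x. snd (prod_decode (w x))"])
    show "recursive (\<lambda>x. fst (prod_decode (w x)))" "recursive (\<lambda>x. snd (prod_decode (w x)))"
      by (intro rec_intros P)+
    show "\<forall>m. U m = {0..1} \<inter> (\<Union>x\<in>{x. P x \<and> fst (prod_decode (w x)) = m}.
        rat_interval (snd (prod_decode (w x))))"
    proof
      fix m
      have "prod_encode (m, k) = n \<longleftrightarrow> m = fst (prod_decode n) \<and> k = snd (prod_decode n)" for k n
        by (metis fst_conv prod.collapse prod_decode_inverse prod_encode_inverse snd_conv)
      then have "{k. prod_encode (m, k) \<in> W} =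
          (\<lambda>x. snd (prod_decode (w x))) ` {x. P x \<and> fst (prod_decode (w x)) = m}"
        unfolding P(3) by (auto simp: image_iff)
      then show "U m = {0..1} \<inter> (\<Union>x\<in>{x. P x \<and> fst (prod_decode (w x)) = m}.
          rat_interval (snd (prod_decode (w x))))"
        unfolding W(2) by simp
    qed
  qed
qed

lemma eff_openI:
  assumes "decidable P" "recursive f" "U = {0..1} \<inter> (\<Union>x\<in>{x. P x}. rat_interval (f x))"
  shows "eff_open U"
  unfolding eff_open_def assms(3)
  by (intro exI[of _ "f ` {x. P x}"] conjI ce_image_decidable assms) auto

lemma eff_openE:
  assumes "eff_open U"
  obtains P f where "decidable P" "recursive f"
    "U = {0..1} \<inter> (\<Union>x\<in>{x. P x}. rat_interval (f x))"
proof -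
  obtain W where W: "ce W" "U = {0..1} \<inter> (\<Union>k\<in>W. rat_interval k)"
    using assms unfolding eff_open_def by blast
  obtain P f where "decidable P" "recursive f" "W = f ` {x. P x}"
    using W(1) by (rule ce_recursiveE)
  with W(2) show ?thesis by (intro that[of P f]) auto
qed

text \<open>Embeds a single set as one member of a family, so that constructions on families apply
  to it.\<close>

lemma eff_open_unif:
  assumes "eff_open U"
  shows "unif_eff_open (\<lambda>m. if m = n then U else {})"
proof -
  obtain P f where "decidable P" "recursive f"
    "U = {0..1} \<inter> (\<Union>x\<in>{x. P x}. rat_interval (f x))"
    using assms by (rule eff_openE)
  then show ?thesis
    by (intro unif_eff_openI[of P "\<lambda>x. n" f] rec_intros) auto
qed

lemma unif_eff_open_eff_open:
  assumes "unif_eff_open U"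
  shows "eff_open (U m)"
proof -
  obtain P g f where P: "decidable P" "recursive g" "recursive f"
    "\<forall>m. U m = {0..1} \<inter> (\<Union>x\<in>{x. P x \<and> g x = m}. rat_interval (f x))"
    using assms by (rule unif_eff_openE)
  show ?thesis
    by (rule eff_openI[of "\<lambda>x. P x \<and> g x = m" f]) (intro rec_intros P | simp add: P(4))+
qed

lemma eff_open_Un:
  assumes "eff_open U" "eff_open V"
  shows "eff_open (U \<union> V)"
proof -
  obtain P f where P: "decidable P" "recursive f"
    "U = {0..1} \<inter> (\<Union>x\<in>{x. P x}. rat_interval (f x))"
    using assms(1) by (rule eff_openE)
  obtain Q g where Q: "decidable Q" "recursive g"
    "V = {0..1} \<inter> (\<Union>x\<in>{x. Q x}. rat_interval (g x))"
    using assms(2) by (rule eff_openE)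
  note PQ = recursive_comp[OF P(1)] recursive_comp[OF Q(1)] recursive_comp[OF P(2)] recursive_comp[OF Q(2)]
  show ?thesis
  proof (rule eff_openI)
    \<comment> \<open>The two enumerations are interleaved: even indices serve \<open>U\<close>, odd
      ones \<open>V\<close>.\<close>
    show "decidable (\<lambda>x. if even x then P (x div 2) else Q (x div 2))"
      unfolding if_bool_eq_disj by (intro rec_intros PQ)
    show "recursive (\<lambda>x. if even x then f (x div 2) else g (x div 2))"
      by (intro rec_intros PQ)
    have *: "(\<exists>x. (if even x then A (x div 2) else B (x div 2))) \<longleftrightarrow> (\<exists>x. A x) \<or> (\<exists>x. B x)"
      for A B :: "nat \<Rightarrow> bool"
    proof
      assume "(\<exists>x. A x) \<or> (\<exists>x. B x)"
      then show "\<exists>x. (if even x then A (x div 2) else B (x div 2))"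
      proof (elim disjE exE)
        fix x assume "A x"
        then show ?thesis by (intro exI[of _ "2 * x"]) simp
      next
        fix x assume "B x"
        then show ?thesis by (intro exI[of _ "Suc (2 * x)"]) simp
      qed
    qed (auto split: if_splits)
    show "U \<union> V = {0..1} \<inter> (\<Union>x\<in>{x. if even x then P (x div 2) else Q (x div 2)}.
        rat_interval (if even x then f (x div 2) else g (x div 2)))"
    proof (intro set_eqI)
      fix y
      show "y \<in> U \<union> V \<longleftrightarrow> y \<in> {0..1} \<inter> (\<Union>x\<in>{x. if even x then P (x div 2) else Q (x div 2)}.
          rat_interval (if even x then f (x div 2) else g (x div 2)))"
        using *[of "\<lambda>x. P x \<and> y \<in> rat_interval (f x)" "\<lambda>x. Q x \<and> y \<in> rat_interval (g x)"]
        unfolding P(3) Q(3) by (auto split: if_splits)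
    qed
  qed
qed

lemma open_rat_interval: "open (rat_interval k)"
  by (simp add: rat_interval_def split: prod.split)

lemma eff_open_openE:
  assumes "eff_open U"
  obtains V where "open V" "U = {0..1} \<inter> V"
  using assms open_rat_interval unfolding eff_open_def by (metis open_UN)

lemma eff_open_borel: "eff_open U \<Longrightarrow> U \<in> sets borel"
  by (metis eff_open_openE borel_closed borel_open closed_atLeastAtMost sets.Int)

section \<open>The maximal inequality\<close>

text \<open>Countable subadditivity for an index set without a chosen enumeration, as the covering
  lemma delivers it, by integrating a pointwise bound of indicators.\<close>

lemma emeasure_UN_countable_le:
  assumes [simp]: "countable I" and [measurable]: "\<And>i. i \<in> I \<Longrightarrow> X i \<in> sets M"
  shows "emeasure M (\<Union>i\<in>I. X i) \<le> (\<integral>\<^sup>+i. emeasure M (X i) \<partial>count_space I)"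
proof -
  note sets.countable_UN'[unfolded subset_eq, measurable]
  have le: "indicator (\<Union>i\<in>I. X i) x \<le> (\<integral>\<^sup>+i. (indicator (X i) x :: ennreal) \<partial>count_space I)" for x
  proof (cases "x \<in> (\<Union>i\<in>I. X i)")
    case True
    then obtain j where "j \<in> I" "x \<in> X j" by blast
    with True nn_integral_ge_point[OF \<open>j \<in> I\<close>, of "\<lambda>i. indicator (X i) x"] show ?thesis by simp
  qed simp
  have "emeasure M (\<Union>i\<in>I. X i) = (\<integral>\<^sup>+x. indicator (\<Union>i\<in>I. X i) x \<partial>M)"
    by (rule nn_integral_indicator[symmetric]) measurable
  also have "\<dots> \<le> (\<integral>\<^sup>+x. \<integral>\<^sup>+i. indicator (X i) x \<partial>count_space I \<partial>M)"
    by (intro nn_integral_mono le)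
  also have "\<dots> = (\<integral>\<^sup>+i. emeasure M (X i) \<partial>count_space I)"
    by (subst nn_integral_count_space_nn_integral) (auto intro!: nn_integral_cong)
  finally show ?thesis .
qed

text \<open>By the Vitali covering lemma some disjoint subfamily of the closed intervals has
  fivefold enlargements that cover everything. Disjoint intervals have masses adding up to at most
  the total mass of \<open>g\<close>, hence the factor \<open>5\<close>.\<close>

lemma maximal_inequality:
  fixes g :: "real \<Rightarrow> ennreal" and \<kappa> :: real
  assumes g [measurable]: "g \<in> borel_measurable borel" and fin: "(\<integral>\<^sup>+x. g x \<partial>lborel) < \<infinity>"
    and "\<kappa> > 0"
    and K: "\<And>a b. (a, b) \<in> K \<Longrightarrow> a < b \<and> ennreal (\<kappa> * (b - a)) \<le> (\<integral>\<^sup>+x\<in>{a<..<b}. g x \<partial>lborel)"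
  shows "ennreal \<kappa> * emeasure lborel (\<Union>(a, b)\<in>K. {a<..<b}) \<le> 5 * (\<integral>\<^sup>+x. g x \<partial>lborel)"
proof -
  define m where "m p = (fst p + snd p) / 2" for p :: "real \<times> real"
  define r where "r p = (snd p - fst p) / 2" for p :: "real \<times> real"
  have cb: "cball (m p) (r p) = {fst p..snd p}" for p
    by (auto simp: m_def r_def cball_eq_atLeastAtMost field_simps)
  define I where "I = enn2real (\<integral>\<^sup>+x. g x \<partial>lborel)"
  have I: "(\<integral>\<^sup>+x. g x \<partial>lborel) = ennreal I" "0 \<le> I"
    using fin by (simp_all add: I_def)
  have mass: "ennreal (\<kappa> * (snd p - fst p)) \<le> (\<integral>\<^sup>+x\<in>cball (m p) (r p). g x \<partial>lborel)" if "p \<in> K" for p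
  proof -
    have "ennreal (\<kappa> * (snd p - fst p)) \<le> (\<integral>\<^sup>+x\<in>{fst p<..<snd p}. g x \<partial>lborel)"
      using K[of "fst p" "snd p"] that by simp
    also have "\<dots> \<le> (\<integral>\<^sup>+x\<in>cball (m p) (r p). g x \<partial>lborel)"
      unfolding cb by (intro nn_integral_mono) (auto split: split_indicator)
    finally show ?thesis .
  qed
  \<comment> \<open>The covering lemma needs bounded radii; an interval of average at least
    \<open>\<kappa>\<close> cannot be longer than the total mass divided by
    \<open>\<kappa>\<close>.\<close>
  have r: "0 < r p \<and> r p \<le> I / \<kappa>" if "p \<in> K" for p
  proof -
    have lt: "fst p < snd p" using K[of "fst p" "snd p"] that by simp
    have "ennreal (\<kappa> * (snd p - fst p)) \<le> ennreal I"
      unfolding I(1)[symmetric] using mass[OF that]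
      by (rule order_trans) (intro nn_integral_mono, auto split: split_indicator)
    then have "\<kappa> * (snd p - fst p) \<le> I" using I(2) by (simp add: ennreal_le_iff)
    then have "snd p - fst p \<le> I / \<kappa>" using \<open>\<kappa> > 0\<close> by (simp add: field_simps)
    moreover have "0 < r p" "r p \<le> snd p - fst p" using lt by (auto simp: r_def)
    ultimately show ?thesis by linarith
  qed
  obtain C where C: "countable C" "C \<subseteq> K"
     "pairwise (\<lambda>i j. disjnt (cball (m i) (r i)) (cball (m j) (r j))) C"
     "(\<Union>p\<in>K. cball (m p) (r p)) \<subseteq> (\<Union>i\<in>C. cball (m i) (5 * r i))"
    by (rule Vitali_covering_lemma_cballs[OF order_refl r])
  have sub: "(\<Union>(a, b)\<in>K. {a<..<b}) \<subseteq> (\<Union>i\<in>C. cball (m i) (5 * r i))"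
  proof (rule order_trans[OF _ C(4)])
    show "(\<Union>(a, b)\<in>K. {a<..<b}) \<subseteq> (\<Union>p\<in>K. cball (m p) (r p))"
      unfolding cb by force
  qed
  have "ennreal \<kappa> * emeasure lborel (\<Union>(a, b)\<in>K. {a<..<b})
      \<le> ennreal \<kappa> * emeasure lborel (\<Union>i\<in>C. cball (m i) (5 * r i))"
    using C(1) by (intro mult_left_mono emeasure_mono sub) auto
  also have "\<dots> \<le> ennreal \<kappa> * (\<integral>\<^sup>+i. emeasure lborel (cball (m i) (5 * r i)) \<partial>count_space C)"
    using C(1) by (intro mult_left_mono emeasure_UN_countable_le) auto
  also have "\<dots> = (\<integral>\<^sup>+i. 5 * ennreal (\<kappa> * (snd i - fst i)) \<partial>count_space C)"
  proof -
    have "ennreal \<kappa> * emeasure lborel (cball (m i) (5 * r i)) = 5 * ennreal (\<kappa> * (snd i - fst i))"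
      if "i \<in> C" for i
    proof -
      have "0 < r i" using r[of i] C(2) that by blast
      then have "emeasure lborel (cball (m i) (5 * r i)) = ennreal (5 * (snd i - fst i))"
        by (simp add: cball_eq_atLeastAtMost r_def field_simps)
      then show ?thesis using \<open>\<kappa> > 0\<close> \<open>0 < r i\<close>
        by (simp add: r_def ennreal_mult[symmetric] ennreal_numeral[symmetric] mult_ac del: ennreal_numeral)
    qed
    then show ?thesis
      by (subst nn_integral_cmult[symmetric]) (auto intro!: nn_integral_cong)
  qed
  also have "\<dots> \<le> (\<integral>\<^sup>+i. 5 * (\<integral>\<^sup>+x\<in>cball (m i) (r i). g x \<partial>lborel) \<partial>count_space C)"
    using mass C(2) by (intro nn_integral_mono mult_left_mono) auto
  also have "\<dots> = 5 * (\<integral>\<^sup>+i. emeasure (density lborel g) (cball (m i) (r i)) \<partial>count_space C)"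
    by (subst nn_integral_cmult) (auto simp: emeasure_density)
  also have "\<dots> = 5 * emeasure (density lborel g) (\<Union>i\<in>C. cball (m i) (r i))"
    using C(1,3)
    by (subst emeasure_UN_countable)
      (auto simp: disjoint_family_on_def pairwise_def disjnt_def)
  also have "\<dots> \<le> 5 * (\<integral>\<^sup>+x. g x \<partial>lborel)"
    using emeasure_space[of "density lborel g" "\<Union>i\<in>C. cball (m i) (r i)"]
    by (intro mult_left_mono) (auto simp: emeasure_density)
  finally show ?thesis .
qed

lemma is_interval_mem:
  fixes u v w :: real
  assumes "is_interval S" "u \<in> S" "v \<in> S" "u \<le> w" "w \<le> v"
  shows "w \<in> S"
  using assms unfolding is_interval_1 by blast

text \<open>A component of \<open>G\<close>, cut by \<open>Q\<close>, has an end point in \<open>Q - G\<close> because \<open>z\<close> is there.\<close>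

lemma component_endpoint:
  fixes G Q I :: "real set"
  assumes "open G" "I \<in> components G" "is_interval Q" "z \<in> Q" "z \<notin> G" "bounded Q" "Q \<inter> I \<noteq> {}"
  obtains a b c where "a \<le> c" "c \<le> b" "c \<notin> G" "c \<in> Q" "{a<..<b} \<subseteq> Q \<inter> I" "Q \<inter> I \<subseteq> {a..b}"
    "z \<le> c \<and> c = a \<or> c \<le> z \<and> c = b"
proof -
  define J where "J = Q \<inter> I"
  have I: "connected I" "I \<subseteq> G"
    using in_components_connected[OF assms(2)] in_components_subset[OF assms(2)] by auto
  have J: "is_interval J" "J \<noteq> {}" "bounded J"
    using assms I by (auto simp: J_def is_interval_connected_1[symmetric] is_interval_Int bounded_Int)
  have bdd: "bdd_above J" "bdd_below J"
    using J(3) by (auto simp: bounded_imp_bdd_above bounded_imp_bdd_below)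
  define a b where "a = Inf J" and "b = Sup J"
  have J_sub: "J \<subseteq> {a..b}"
    using bdd by (auto simp: a_def b_def cInf_lower cSup_upper)
  have sub_J: "{a<..<b} \<subseteq> J"
  proof
    fix x assume x: "x \<in> {a<..<b}"
    obtain p where p: "p \<in> J" "p < x"
      using cInf_lessD[OF J(2), of x] x by (auto simp: a_def)
    obtain q where q: "q \<in> J" "x < q"
      using less_cSupD[OF J(2), of x] x by (auto simp: b_def)
    show "x \<in> J"
      using p q by (intro is_interval_mem[OF J(1) p(1) q(1)]) auto
  qed
  have int_I: "is_interval I" using I(1) by (simp add: is_interval_connected_1)
  obtain y where y: "y \<in> J" using J(2) by blast
  have "z \<notin> I" "y \<in> Q" "y \<in> I" using assms(5) I y by (auto simp: J_def)
  have ball_sub: "ball c e \<subseteq> I" if "ball c e \<subseteq> G" "ball c e \<inter> J \<noteq> {}" for c e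
    by (rule components_maximal[OF assms(2)]) (use that in \<open>auto simp: J_def\<close>)
  have "z < y \<or> y < z" using \<open>z \<notin> I\<close> \<open>y \<in> I\<close> by (metis linorder_neqE)
  then show ?thesis
  proof
    assume "z < y"
    have z_lower: "z \<le> x" if "x \<in> J" for x
      using is_interval_mem[OF int_I _ \<open>y \<in> I\<close>, of x z] that \<open>z \<notin> I\<close> \<open>z < y\<close>
      by (cases "z \<le> x") (auto simp: J_def)
    have "z \<le> a" "a \<le> y"
      using z_lower J(2) J_sub y by (auto simp: a_def intro: cInf_greatest)
    then have "a \<in> Q"
      by (rule is_interval_mem[OF assms(3,4) \<open>y \<in> Q\<close>])
    have "a \<notin> G"
    proof
      assume "a \<in> G"
      then obtain e where e: "0 < e" "ball a e \<subseteq> G"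
        using assms(1) open_contains_ball by blast
      obtain p where "p \<in> J" "p < a + e"
        using cInf_lessD[OF J(2), of "a + e"] e(1) by (auto simp: a_def)
      then have "p \<in> ball a e" using J_sub by (auto simp: dist_real_def)
      then have *: "ball a e \<subseteq> I" using ball_sub[OF e(2)] \<open>p \<in> J\<close> by blast
      have "a \<noteq> z" using * \<open>z \<notin> I\<close> centre_in_ball[of z e] e(1) by blast
      then have "z < a" using \<open>z \<le> a\<close> by simp
      \<comment> \<open>If \<open>a\<close> were in \<open>G\<close>, the component would contain a
        ball around \<open>a\<close>. A small move from \<open>a\<close> towards \<open>z\<close>
        stays in \<open>Q\<close>, hence in \<open>J\<close>, below the infimum of
        \<open>J\<close>.\<close>
      define w where "w = max z (a - e / 2)"
      have "w \<in> ball a e" "w < a" "z \<le> w"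
        using \<open>z < a\<close> e(1) by (auto simp: w_def dist_real_def)
      then have "w \<in> Q"
        by (intro is_interval_mem[OF assms(3,4) \<open>a \<in> Q\<close>]) auto
      then have "w \<in> J" using * \<open>w \<in> ball a e\<close> by (auto simp: J_def)
      then show False using J_sub \<open>w < a\<close> by auto
    qed
    then show ?thesis
      using that[of a a b] J_sub sub_J \<open>a \<in> Q\<close> \<open>a \<notin> G\<close> \<open>z \<le> a\<close> y by (fastforce simp: J_def)
  next
    assume "y < z"
    have z_upper: "x \<le> z" if "x \<in> J" for x
      using is_interval_mem[OF int_I \<open>y \<in> I\<close>, of x z] that \<open>z \<notin> I\<close> \<open>y < z\<close>
      by (cases "x \<le> z") (auto simp: J_def)
    have "b \<le> z" "y \<le> b"
      using z_upper J(2) J_sub y by (auto simp: b_def intro: cSup_least)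
    then have "b \<in> Q"
      by (intro is_interval_mem[OF assms(3) \<open>y \<in> Q\<close> assms(4)])
    have "b \<notin> G"
    proof
      assume "b \<in> G"
      then obtain e where e: "0 < e" "ball b e \<subseteq> G"
        using assms(1) open_contains_ball by blast
      obtain p where "p \<in> J" "b - e < p"
        using less_cSupD[OF J(2), of "b - e"] e(1) by (auto simp: b_def)
      then have "p \<in> ball b e" using J_sub by (auto simp: dist_real_def)
      then have *: "ball b e \<subseteq> I" using ball_sub[OF e(2)] \<open>p \<in> J\<close> by blast
      have "b \<noteq> z" using * \<open>z \<notin> I\<close> centre_in_ball[of z e] e(1) by blast
      then have "b < z" using \<open>b \<le> z\<close> by simp
      define w where "w = min z (b + e / 2)"
      have "w \<in> ball b e" "b < w" "w \<le> z"
        using \<open>b < z\<close> e(1) by (auto simp: w_def dist_real_def)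
      then have "w \<in> Q"
        by (intro is_interval_mem[OF assms(3) \<open>b \<in> Q\<close> assms(4)]) auto
      then have "w \<in> J" using * \<open>w \<in> ball b e\<close> by (auto simp: J_def)
      then show False using J_sub \<open>b < w\<close> by auto
    qed
    then show ?thesis
      using that[of a b b] J_sub sub_J \<open>b \<in> Q\<close> \<open>b \<notin> G\<close> \<open>b \<le> z\<close> y by (fastforce simp: J_def)
  qed
qed

text \<open>The open set has countably many components. Each one, cut by \<open>Q\<close>, is an
  interval up to its end points and has an end point outside \<open>G\<close>, where
  \<open>le\<close> applies; the bounds are then added up.\<close>

lemma nn_integral_open_inter_interval_le:
  fixes f :: "real \<Rightarrow> ennreal" and G Q :: "real set"
  assumes f [measurable]: "f \<in> borel_measurable borel"
    and "open G" "is_interval Q" "Q \<subseteq> {0..1}" "z \<in> Q" "z \<notin> G" "0 < z" "z < 1"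
    and le: "\<And>a b c. c \<notin> G \<Longrightarrow> 0 < c \<Longrightarrow> c < 1 \<Longrightarrow> 0 \<le> a \<Longrightarrow> a \<le> c \<Longrightarrow> c \<le> b \<Longrightarrow> b \<le> 1 \<Longrightarrow>
      (\<integral>\<^sup>+x\<in>{a..b}. f x \<partial>lborel) \<le> ennreal (l * (b - a))"
    and "0 \<le> l"
  shows "(\<integral>\<^sup>+x\<in>Q \<inter> G. f x \<partial>lborel) \<le> ennreal l * emeasure lborel (Q \<inter> G)"
proof -
  have Q [measurable]: "Q \<in> sets borel"
    using assms(3) by (rule real_interval_borel_measurable)
  have I: "open I" if "I \<in> components G" for I
    using that assms(2) by (rule open_components[rotated])
  have cnt: "countable (components G)"
    using pairwise_disjoint_components I
    by (intro countable_disjoint_open_subsets) (auto simp: pairwise_def disjnt_def)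
  have disj: "disjoint_family_on (\<lambda>I. Q \<inter> I) (components G)"
    using components_nonoverlap by (fastforce simp: disjoint_family_on_def)
  have eq: "Q \<inter> G = (\<Union>I\<in>components G. Q \<inter> I)"
    using Union_components[of G] by blast
  have sets: "Q \<inter> I \<in> sets borel" if "I \<in> components G" for I
    using I[OF that] by measurable
  have comp: "(\<integral>\<^sup>+x\<in>Q \<inter> I. f x \<partial>lborel) \<le> ennreal l * emeasure lborel (Q \<inter> I)"
    if I_comp: "I \<in> components G" for I
  proof (cases "Q \<inter> I = {}")
    case False
    have "bounded Q" by (rule bounded_subset[OF bounded_closed_interval assms(4)])
    obtain a b c where abc: "a \<le> c" "c \<le> b" "c \<notin> G" "c \<in> Q" "{a<..<b} \<subseteq> Q \<inter> I"
      "Q \<inter> I \<subseteq> {a..b}" "z \<le> c \<and> c = a \<or> c \<le> z \<and> c = b"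
      by (rule component_endpoint[OF assms(2) I_comp assms(3,5,6) \<open>bounded Q\<close> False])
    have "a \<noteq> b"
    proof
      assume "a = b"
      then have "Q \<inter> I \<subseteq> {c}" using abc by auto
      then show False using False abc in_components_subset[OF that] by blast
    qed
    then have "a < b" using abc by simp
    \<comment> \<open>Only the open interval is known to lie in \<open>Q\<close>; its closure still
      lies in the closed unit interval, which bounds the end points.\<close>
    then have "{a..b} \<subseteq> closure {a<..<b}" by simp
    also have "\<dots> \<subseteq> {0..1}"
      using abc(5) assms(4) by (intro closure_minimal) auto
    finally have ab: "0 \<le> a" "b \<le> 1" using \<open>a < b\<close> by auto
    have c01: "0 < c \<and> c < 1"
      using abc(7) ab assms(7,8) \<open>a < b\<close> by auto
    have "(\<integral>\<^sup>+x\<in>Q \<inter> I. f x \<partial>lborel) \<le> (\<integral>\<^sup>+x\<in>{a..b}. f x \<partial>lborel)"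
      using abc(6) by (intro nn_integral_mono) (auto split: split_indicator)
    also have "\<dots> \<le> ennreal (l * (b - a))"
      using le[of c a b] c01 abc ab by simp
    also have "\<dots> = ennreal l * emeasure lborel {a<..<b}"
      using \<open>a < b\<close> assms(10) by (simp add: ennreal_mult)
    also have "\<dots> \<le> ennreal l * emeasure lborel (Q \<inter> I)"
      using abc(5) sets[OF that] by (intro mult_left_mono emeasure_mono) auto
    finally show ?thesis .
  qed simp
  have "(\<integral>\<^sup>+x\<in>Q \<inter> G. f x \<partial>lborel) = emeasure (density lborel f) (Q \<inter> G)"
    using assms(2) by (subst emeasure_density) auto
  also have "\<dots> = (\<integral>\<^sup>+I. emeasure (density lborel f) (Q \<inter> I) \<partial>count_space (components G))"
    unfolding eq using cnt disj sets by (subst emeasure_UN_countable) auto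
  also have "\<dots> \<le> (\<integral>\<^sup>+I. ennreal l * emeasure lborel (Q \<inter> I) \<partial>count_space (components G))"
    using comp sets by (intro nn_integral_mono) (auto simp: emeasure_density)
  also have "\<dots> = ennreal l * (\<integral>\<^sup>+I. emeasure lborel (Q \<inter> I) \<partial>count_space (components G))"
    by (rule nn_integral_cmult) simp
  also have "\<dots> = ennreal l * emeasure lborel (Q \<inter> G)"
    unfolding eq using cnt disj sets by (subst emeasure_UN_countable) auto
  finally show ?thesis .
qed

section \<open>Approximation on dyadic cells\<close>

text \<open>Index of the level-\<open>s\<close> cell that contains \<open>x\<close>. Negative
  \<open>x\<close> get index \<open>0\<close> through \<open>nat\<close>, hence the guards
  \<open>0 \<le> x\<close> in what follows.\<close>

definition idx :: "nat \<Rightarrow> real \<Rightarrow> nat" where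
  "idx s x = nat \<lfloor>x * 2 ^ s\<rfloor>"

definition cell :: "nat \<Rightarrow> nat \<Rightarrow> real set" where
  "cell s i = {real i / 2 ^ s..<real (Suc i) / 2 ^ s}"

lemma idx_eq_iff: "0 \<le> x \<Longrightarrow> idx s x = i \<longleftrightarrow> real i \<le> x * 2 ^ s \<and> x * 2 ^ s < real i + 1"
  unfolding idx_def by (subst eq_nat_nat_iff[of _ "int i", simplified]) (auto simp: floor_eq_iff)

lemma idx_bounds:
  assumes "0 \<le> x"
  shows "real (idx s x) \<le> x * 2 ^ s" "x * 2 ^ s < real (idx s x) + 1"
    "real (idx s x) / 2 ^ s \<le> x" "x < real (Suc (idx s x)) / 2 ^ s"
proof -
  show *: "real (idx s x) \<le> x * 2 ^ s" "x * 2 ^ s < real (idx s x) + 1"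
    using idx_eq_iff[OF assms, of s "idx s x"] by simp_all
  then show "real (idx s x) / 2 ^ s \<le> x" "x < real (Suc (idx s x)) / 2 ^ s"
    by (simp_all add: field_simps)
qed

lemma mem_cell_iff: "x \<in> cell s i \<longleftrightarrow> 0 \<le> x \<and> idx s x = i"
proof (cases "0 \<le> x")
  case True
  then show ?thesis by (simp add: idx_eq_iff cell_def field_simps)
next
  case False
  then have "x < real i / 2 ^ s" by (meson divide_nonneg_pos not_le of_nat_0_le_iff order_less_le_trans zero_less_numeral zero_less_power)
  with False show ?thesis by (simp add: cell_def)
qed

lemma idx_div:
  assumes "0 \<le> x"
  shows "idx (s + d) x div 2 ^ d = idx s x"
proof (rule sym, subst idx_eq_iff[OF assms], intro conjI)
  define q where "q = idx (s + d) x div 2 ^ d"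
  have "q * 2 ^ d \<le> idx (s + d) x" by (simp add: q_def)
  then have "real q * 2 ^ d \<le> real (idx (s + d) x)"
    by (drule_tac of_nat_mono[where 'a = real]) (simp add: algebra_simps)
  also have "\<dots> \<le> x * 2 ^ s * 2 ^ d"
    using idx_bounds(1)[OF assms, of "s + d"] by (simp add: power_add mult_ac)
  finally show "real q \<le> x * 2 ^ s" by simp
  have "idx (s + d) x < (q + 1) * 2 ^ d"
    unfolding q_def by (subst div_less_iff_less_mult[symmetric]) auto
  then have "Suc (idx (s + d) x) \<le> (q + 1) * 2 ^ d" by simp
  then have "real (idx (s + d) x) + 1 \<le> (real q + 1) * 2 ^ d"
    by (drule_tac of_nat_mono[where 'a = real]) (simp add: algebra_simps)
  moreover have "x * 2 ^ s * 2 ^ d < real (idx (s + d) x) + 1"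
    using idx_bounds(2)[OF assms, of "s + d"] by (simp add: power_add mult_ac)
  ultimately have "x * 2 ^ s * 2 ^ d < (real q + 1) * 2 ^ d" by linarith
  then show "x * 2 ^ s < real q + 1" by simp
qed

lemma idx_Suc_div: "0 \<le> x \<Longrightarrow> idx (Suc s) x div 2 = idx s x"
  using idx_div[of x s 1] by simp

lemma cell_mono: "cell (s + d) i \<subseteq> cell s (i div 2 ^ d)"
  by (auto simp: mem_cell_iff idx_div)

lemma idx_less: "0 \<le> x \<Longrightarrow> x < 1 \<Longrightarrow> idx s x < 2 ^ s"
proof -
  assume x: "0 \<le> x" "x < 1"
  have "x * 2 ^ s < 1 * 2 ^ s"
    by (rule mult_strict_right_mono) (use x in auto)
  then have "real (idx s x) < 2 ^ s"
    using idx_bounds(1)[OF x(1), of s] by linarith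
  then have "real (idx s x) < real (2 ^ s)" by simp
  then show "idx s x < 2 ^ s" by (simp only: of_nat_less_iff)
qed

lemma idx_measurable [measurable]: "idx s \<in> borel \<rightarrow>\<^sub>M count_space UNIV"
  unfolding idx_def by measurable

text \<open>The closed cell lies in the open rational interval; strict comparisons keep this
  decidable and make every interior point visible at a late enough level.\<close>

definition inside :: "nat \<Rightarrow> nat \<Rightarrow> nat \<Rightarrow> bool" where
  "inside s i k \<longleftrightarrow> rat_code (fst (prod_decode k)) < real i / 2 ^ s \<and>
     real (Suc i) / 2 ^ s < rat_code (snd (prod_decode k))"

lemma decidable_inside [rec_intros]:
  "recursive s \<Longrightarrow> recursive i \<Longrightarrow> recursive k \<Longrightarrow> decidable (\<lambda>x. inside (s x) (i x) (k x))"
  unfolding inside_def by (intro rec_intros)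

lemma inside_subset: "inside s i k \<Longrightarrow> {real i / 2 ^ s..real (Suc i) / 2 ^ s} \<subseteq> rat_interval k"
  by (auto simp: inside_def mem_rat_interval_iff)

lemma dyadic_Suc_mono:
  assumes "i' div 2 = i"
  shows "real i / 2 ^ s \<le> real i' / 2 ^ Suc s" "real (Suc i') / 2 ^ Suc s \<le> real (Suc i) / 2 ^ s"
proof -
  have "2 * i \<le> i'" "Suc i' \<le> 2 * Suc i" using assms by auto
  then have "2 * real i \<le> real i'" "real (Suc i') \<le> 2 * real (Suc i)"
    by (auto dest!: of_nat_mono[where 'a = real])
  then have "2 * real i / 2 ^ Suc s \<le> real i' / 2 ^ Suc s"
    "real (Suc i') / 2 ^ Suc s \<le> 2 * real (Suc i) / 2 ^ Suc s"
    by (simp_all only: divide_right_mono zero_le_power zero_le_numeral)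
  then show "real i / 2 ^ s \<le> real i' / 2 ^ Suc s" "real (Suc i') / 2 ^ Suc s \<le> real (Suc i) / 2 ^ s"
    by (simp_all del: of_nat_Suc)
qed

lemma inside_Suc: "inside s i k \<Longrightarrow> i' div 2 = i \<Longrightarrow> inside (Suc s) i' k"
  unfolding inside_def using dyadic_Suc_mono[of i' i s] by linarith

lemma inside_eventually:
  assumes "x \<in> rat_interval k" "0 \<le> x"
  shows "\<forall>\<^sub>F s in sequentially. inside s (idx s x) k"
proof -
  define \<epsilon> where "\<epsilon> = min (x - rat_code (fst (prod_decode k))) (rat_code (snd (prod_decode k)) - x)"
  have "\<epsilon> > 0" using assms(1) by (simp add: \<epsilon>_def mem_rat_interval_iff)
  have "(\<lambda>s. (1 / 2) ^ s :: real) \<longlonglongrightarrow> 0" by (rule LIMSEQ_power_zero) simp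
  then have "\<forall>\<^sub>F s in sequentially. (1 / 2) ^ s < \<epsilon>"
    using \<open>\<epsilon> > 0\<close> by (rule order_tendstoD)
  then show ?thesis
  proof eventually_elim
    case (elim s)
    then have s: "1 / 2 ^ s < \<epsilon>" by (simp add: power_divide)
    have "real (Suc (idx s x)) / 2 ^ s = real (idx s x) / 2 ^ s + 1 / 2 ^ s"
      by (simp add: add_divide_distrib)
    then show ?case
      using s idx_bounds[OF assms(2), of s] unfolding inside_def \<epsilon>_def by auto
  qed
qed

text \<open>The level \<open>s\<close> also serves as the stage: \<open>u s i\<close> holds if one
  of the first \<open>s + 1\<close> indices enumerates an interval around the closed cell. The
  bounded search makes \<open>u\<close> decidable, and the point \<open>1\<close> is lost because
  cells are half-open on the right.\<close>

lemma eff_open_cells: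
  assumes "eff_open U"
  obtains u where "decidable2 u" "\<And>s i. u s i \<Longrightarrow> i < 2 ^ s"
    "\<And>s i. u s i \<Longrightarrow> {real i / 2 ^ s..real (Suc i) / 2 ^ s} \<subseteq> U"
    "\<And>s i i'. u s i \<Longrightarrow> i' div 2 = i \<Longrightarrow> u (Suc s) i'"
    "\<And>x. x \<in> U \<Longrightarrow> x < 1 \<Longrightarrow> \<exists>s. u s (idx s x)"
proof -
  obtain P f where P: "decidable P" "recursive f"
    "U = {0..1} \<inter> (\<Union>x\<in>{x. P x}. rat_interval (f x))"
    using assms by (rule eff_openE)
  define u where "u s i \<longleftrightarrow> i < 2 ^ s \<and> (\<exists>e<Suc s. P e \<and> inside s i (f e))" for s i
  show ?thesis
  proof
    show "decidable2 u"
      unfolding u_def by (intro rec_intros decidable_comp[OF P(1)] recursive_comp[OF P(2)])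
    show "i < 2 ^ s" if "u s i" for s i
      using that by (simp add: u_def)
    show "{real i / 2 ^ s..real (Suc i) / 2 ^ s} \<subseteq> U" if u: "u s i" for s i
    proof -
      have "Suc i \<le> 2 ^ s" using u by (simp add: u_def)
      then have "real (Suc i) \<le> 2 ^ s"
        by (auto dest!: of_nat_mono[where 'a = real])
      then have "{real i / 2 ^ s..real (Suc i) / 2 ^ s} \<subseteq> {0..1}"
        by (auto simp: field_simps intro: order_trans)
      moreover obtain e where "P e" "inside s i (f e)"
        using u by (auto simp: u_def)
      ultimately show ?thesis
        unfolding P(3) using inside_subset by blast
    qed
    show "u (Suc s) i'" if "u s i" "i' div 2 = i" for s i i'
      using that inside_Suc unfolding u_def by (auto intro: less_SucI)
    show "\<exists>s. u s (idx s x)" if x: "x \<in> U" "x < 1" for x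
    proof -
      obtain e where e: "P e" "x \<in> rat_interval (f e)" "0 \<le> x"
        using x(1) by (auto simp: P(3))
      have "\<forall>\<^sub>F s in sequentially. inside s (idx s x) (f e) \<and> e \<le> s"
        by (intro eventually_conj inside_eventually e eventually_ge_at_top)
      then obtain s where "inside s (idx s x) (f e)" "e \<le> s"
        by (auto simp: eventually_sequentially)
      then show ?thesis
        using e x(2) idx_less[of x s] by (auto simp: u_def less_Suc_eq_le)
    qed
  qed
qed

text \<open>For a downward closed property, counting its instances yields its threshold; this
  expresses a maximum by a recursive sum.\<close>

lemma count_initial_segment:
  fixes R :: "nat \<Rightarrow> bool"
  assumes "\<And>p q. R q \<Longrightarrow> p \<le> q \<Longrightarrow> R p"
  shows "q < (\<Sum>q<n. of_bool (R q)) \<longleftrightarrow> q < n \<and> R q"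
proof (induction n)
  case (Suc n)
  have "(\<Sum>q<n. of_bool (R q) :: nat) \<le> (\<Sum>q<n. 1)" by (intro sum_mono) auto
  then have le: "(\<Sum>q<n. of_bool (R q) :: nat) \<le> n" by simp
  show ?case
  proof (cases "R n")
    case True
    then have "\<And>q. q < n \<Longrightarrow> R q" using assms by auto
    then have "(\<Sum>q<n. of_bool (R q) :: nat) = n" by simp
    with True assms show ?thesis by (auto simp: less_Suc_eq)
  next
    case False
    with Suc show ?thesis by (auto simp: less_Suc_eq)
  qed
qed simp

definition step :: "nat \<Rightarrow> (nat \<Rightarrow> real) \<Rightarrow> real \<Rightarrow> ennreal" where
  "step s c x = ennreal (if 0 \<le> x then c (idx s x) else 0)"

lemma step_measurable [measurable]: "step s c \<in> borel_measurable borel"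
  unfolding step_def by measurable

lemma nn_integral_step:
  fixes c :: "nat \<Rightarrow> real" and i n :: nat
  assumes "\<And>i. 0 \<le> c i"
  shows "(\<integral>\<^sup>+x\<in>{real i / 2 ^ s..<real (i + n) / 2 ^ s}. step s c x \<partial>lborel) =
    ennreal ((\<Sum>l<n. c (i + l)) / 2 ^ s)"
proof (induction n)
  case (Suc n)
  have cell: "(\<integral>\<^sup>+x\<in>cell s j. step s c x \<partial>lborel) = ennreal (c j / 2 ^ s)" for j
  proof -
    have "(\<integral>\<^sup>+x\<in>cell s j. step s c x \<partial>lborel) = (\<integral>\<^sup>+x. ennreal (c j) * indicator (cell s j) x \<partial>lborel)"
      by (intro nn_integral_cong) (auto simp: step_def mem_cell_iff split: split_indicator)
    also have "\<dots> = ennreal (c j) * emeasure lborel (cell s j)"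
      by (intro nn_integral_cmult_indicator) (simp add: cell_def)
    also have "emeasure lborel (cell s j) = ennreal (1 / 2 ^ s)"
      by (simp add: cell_def divide_right_mono diff_divide_distrib[symmetric])
    finally show ?thesis by (simp add: assms ennreal_mult[symmetric])
  qed
  have split: "{real i / 2 ^ s..<real (i + Suc n) / 2 ^ s} =
      {real i / 2 ^ s..<real (i + n) / 2 ^ s} \<union> cell s (i + n)"
    unfolding cell_def by (subst ivl_disj_un_two(3)) (auto simp: divide_right_mono)
  have "(\<integral>\<^sup>+x\<in>{real i / 2 ^ s..<real (i + Suc n) / 2 ^ s}. step s c x \<partial>lborel) =
      (\<integral>\<^sup>+x\<in>{real i / 2 ^ s..<real (i + n) / 2 ^ s}. step s c x \<partial>lborel) +
      (\<integral>\<^sup>+x\<in>cell s (i + n). step s c x \<partial>lborel)"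
    unfolding split by (rule nn_integral_disjoint_pair) (auto simp: cell_def)
  also have "\<dots> = ennreal ((\<Sum>l<Suc n. c (i + l)) / 2 ^ s)"
    unfolding Suc cell using assms
    by (subst ennreal_plus[symmetric]) (auto intro!: divide_nonneg_pos sum_nonneg simp: add_divide_distrib)
  finally show ?case .
qed simp

section \<open>Increasing step functions with recursive values\<close>

text \<open>The value on cell \<open>i\<close> at stage \<open>s\<close> is
  \<open>h s i / 2 ^ s\<close>; the factor \<open>2\<close> in \<open>h_Suc\<close> says that these
  rescaled values never decrease.\<close>

locale cell_approximation =
  fixes h :: "nat \<Rightarrow> nat \<Rightarrow> nat"
  assumes recursive_h: "recursive2 h"
    and h_Suc: "i' div 2 = i \<Longrightarrow> 2 * h s i \<le> h (Suc s) i'"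
begin

definition approx :: "nat \<Rightarrow> real \<Rightarrow> ennreal" where
  "approx s = step s (\<lambda>i. real (h s i) / 2 ^ s)"

definition limit :: "real \<Rightarrow> ennreal" where
  "limit x = (SUP s. approx s x)"

text \<open>Division by \<open>n * 2 ^ s\<close> shows the meaning: the average of
  \<open>approx s\<close> over \<open>n\<close> consecutive cells exceeds \<open>l\<close>.\<close>

definition heavy :: "nat \<Rightarrow> nat \<Rightarrow> nat \<Rightarrow> nat \<Rightarrow> bool" where
  "heavy l s i n \<longleftrightarrow> l * n * 2 ^ s < (\<Sum>k<n. h s (i + k))"

definition heavy_set :: "nat \<Rightarrow> real set" where
  "heavy_set l = (\<Union>(s, i, n)\<in>{(s, i, n). heavy l s i n}. {real i / 2 ^ s<..<real (i + n) / 2 ^ s})"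

lemma heavy_subset: "heavy l s i n \<Longrightarrow> {real i / 2 ^ s<..<real (i + n) / 2 ^ s} \<subseteq> heavy_set l"
  unfolding heavy_set_def by (rule UN_upper[of "(s, i, n)", THEN order_trans[rotated]]) auto

lemma approx_measurable [measurable]: "approx s \<in> borel_measurable borel"
  by (simp add: approx_def)

lemma limit_measurable [measurable]: "limit \<in> borel_measurable borel"
  unfolding limit_def by measurable

lemma incseq_approx: "incseq approx"
proof (rule incseq_SucI, rule le_funI)
  fix s x
  show "approx s x \<le> approx (Suc s) x"
  proof (cases "0 \<le> x")
    case True
    have "2 * h s (idx s x) \<le> h (Suc s) (idx (Suc s) x)"
      by (rule h_Suc) (rule idx_Suc_div[OF True])
    then have "2 * real (h s (idx s x)) \<le> real (h (Suc s) (idx (Suc s) x))"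
      by (drule_tac of_nat_mono[where 'a = real]) (simp add: algebra_simps)
    with True show ?thesis
      by (auto simp: approx_def step_def field_simps intro!: ennreal_leI)
  qed (simp add: approx_def step_def)
qed

lemma nn_integral_limit:
  assumes [measurable]: "A \<in> sets borel"
  shows "(\<integral>\<^sup>+x\<in>A. limit x \<partial>lborel) = (SUP s. \<integral>\<^sup>+x\<in>A. approx s x \<partial>lborel)"
    and "incseq (\<lambda>s. \<integral>\<^sup>+x\<in>A. approx s x \<partial>lborel)"
proof -
  have inc: "incseq (\<lambda>s x. approx s x * indicator A x)"
    using incseq_approx by (auto simp: incseq_def le_fun_def mult_right_mono)
  have "limit x * indicator A x = (SUP s. approx s x * indicator A x)" for x
    by (auto simp: limit_def split: split_indicator)
  then show "(\<integral>\<^sup>+x\<in>A. limit x \<partial>lborel) = (SUP s. \<integral>\<^sup>+x\<in>A. approx s x \<partial>lborel)"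
    using nn_integral_monotone_convergence_SUP[OF inc, of lborel] by simp
  show "incseq (\<lambda>s. \<integral>\<^sup>+x\<in>A. approx s x \<partial>lborel)"
    using inc by (auto simp: incseq_def le_fun_def intro!: nn_integral_mono)
qed

lemma nn_integral_approx:
  "(\<integral>\<^sup>+x\<in>{real i / 2 ^ s..<real (i + n) / 2 ^ s}. approx s x \<partial>lborel) =
    ennreal (real (\<Sum>k<n. h s (i + k)) / (2 ^ s * 2 ^ s))"
  unfolding approx_def by (subst nn_integral_step) (auto simp: sum_divide_distrib)

lemma open_heavy_set: "open (heavy_set l)"
  unfolding heavy_set_def by auto

lemma unif_eff_open_heavy_set:
  assumes "recursive l"
  shows "unif_eff_open (\<lambda>m. {0..1} \<inter> heavy_set (l m))"
proof (rule unif_eff_openI)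
  let ?m = "\<lambda>x. fst (prod_decode x)" let ?s = "\<lambda>x. fst (prod_decode (snd (prod_decode x)))"
  let ?i = "\<lambda>x. fst (prod_decode (snd (prod_decode (snd (prod_decode x)))))"
  let ?n = "\<lambda>x. snd (prod_decode (snd (prod_decode (snd (prod_decode x)))))"
  show "decidable (\<lambda>x. heavy (l (?m x)) (?s x) (?i x) (?n x))"
    unfolding heavy_def by (intro rec_intros recursive2_comp[OF recursive_h] recursive_comp[OF assms])
  show "recursive ?m" by (intro rec_intros)
  show "recursive (\<lambda>x. prod_encode (dyadic_code (?i x) (?s x), dyadic_code (?i x + ?n x) (?s x)))"
    by (intro rec_intros)
  show "{0..1} \<inter> heavy_set (l m) = {0..1} \<inter>
      (\<Union>x\<in>{x. heavy (l (?m x)) (?s x) (?i x) (?n x) \<and> ?m x = m}.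
        rat_interval (prod_encode (dyadic_code (?i x) (?s x), dyadic_code (?i x + ?n x) (?s x))))" for m
  proof (intro arg_cong[where f = "(\<inter>) {0..1}"] set_eqI iffI)
    fix y assume "y \<in> heavy_set (l m)"
    then obtain s i n where "heavy (l m) s i n" "y \<in> {real i / 2 ^ s<..<real (i + n) / 2 ^ s}"
      by (auto simp: heavy_set_def)
    then show "y \<in> (\<Union>x\<in>{x. heavy (l (?m x)) (?s x) (?i x) (?n x) \<and> ?m x = m}.
        rat_interval (prod_encode (dyadic_code (?i x) (?s x), dyadic_code (?i x + ?n x) (?s x))))"
      by (intro UN_I[of "prod_encode (m, prod_encode (s, prod_encode (i, n)))"]) auto
  qed (force simp: heavy_set_def)
qed

text \<open>At each stage \<open>{a..b}\<close> is widened to a block of cells with \<open>c\<close>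
  in its interior. As \<open>c\<close> is not in \<open>heavy_set l\<close>, the block is not heavy,
  and the error of widening vanishes as \<open>s\<close> grows.\<close>

lemma nn_integral_limit_le:
  assumes "c \<notin> heavy_set l" "0 < c" "0 \<le> a" "a \<le> c" "c \<le> b"
  shows "(\<integral>\<^sup>+x\<in>{a..b}. limit x \<partial>lborel) \<le> ennreal (l * (b - a))"
proof -
  have bound: "(\<integral>\<^sup>+x\<in>{a..b}. approx s x \<partial>lborel) \<le> ennreal (l * (b - a) + 4 * l * (1 / 2) ^ s)" for s
  proof -
    \<comment> \<open>The extra cell on the left puts \<open>c\<close> into the interior even at a
      grid point; if \<open>idx s a = 0\<close>, truncation leaves \<open>i = 0\<close> and
      \<open>0 < c\<close> does this. The block exceeds \<open>{a..b}\<close> by at most four cells,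
      whence the error term \<open>4 * l * (1 / 2) ^ s\<close>.\<close>
    define i where "i = idx s a - 1"
    define n where "n = idx s b + 2 - i"
    have "0 \<le> b" using assms by simp
    note ia = idx_bounds[OF assms(3), of s] and ib = idx_bounds[OF \<open>0 \<le> b\<close>, of s]
    have "real (idx s a) < real (idx s b) + 1"
    proof -
      have "a * 2 ^ s \<le> b * 2 ^ s" by (rule mult_right_mono) (use assms(4,5) in auto)
      then show ?thesis using ia(1) ib(2) by linarith
    qed
    then have le: "idx s a \<le> idx s b" by linarith
    then have n: "i + n = idx s b + 2" by (auto simp: i_def n_def)
    have "real n \<le> real (idx s b) - real (idx s a) + 3"
      using le by (auto simp: n_def i_def of_nat_diff)
    also have "\<dots> \<le> (b - a) * 2 ^ s + 4"
      using ia(2) ib(1) by (simp add: algebra_simps)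
    finally have n_le: "real n \<le> (b - a) * 2 ^ s + 4" .
    have "real i / 2 ^ s < c"
    proof (cases "idx s a = 0")
      case False
      then have "real i < real (idx s a)" by (simp add: i_def)
      then have "real i / 2 ^ s < real (idx s a) / 2 ^ s" by (simp add: divide_strict_right_mono)
      then show ?thesis using ia(3) assms(4) by linarith
    qed (use assms(2) in \<open>simp add: i_def\<close>)
    moreover have "real i / 2 ^ s \<le> a"
    proof -
      have "real i / 2 ^ s \<le> real (idx s a) / 2 ^ s" by (simp add: i_def divide_right_mono)
      then show ?thesis using ia(3) by linarith
    qed
    moreover have "b < real (i + n) / 2 ^ s"
    proof -
      have "real (Suc (idx s b)) / 2 ^ s \<le> real (i + n) / 2 ^ s"
        unfolding n by (simp add: divide_right_mono)
      then show ?thesis using ib(4) by linarith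
    qed
    ultimately have sub: "{a..b} \<subseteq> {real i / 2 ^ s..<real (i + n) / 2 ^ s}"
      and "c \<in> {real i / 2 ^ s<..<real (i + n) / 2 ^ s}"
      using assms(5) by auto
    then have "\<not> heavy l s i n"
      using assms(1) heavy_subset by blast
    then have light: "(\<Sum>k<n. h s (i + k)) \<le> l * n * 2 ^ s" by (simp add: heavy_def)
    have "(\<integral>\<^sup>+x\<in>{a..b}. approx s x \<partial>lborel) \<le>
        (\<integral>\<^sup>+x\<in>{real i / 2 ^ s..<real (i + n) / 2 ^ s}. approx s x \<partial>lborel)"
      using sub by (intro nn_integral_mono) (auto split: split_indicator)
    also have "\<dots> = ennreal (real (\<Sum>k<n. h s (i + k)) / (2 ^ s * 2 ^ s))"
      by (rule nn_integral_approx)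
    also have "\<dots> \<le> ennreal (real (l * n * 2 ^ s) / (2 ^ s * 2 ^ s))"
      using light by (intro ennreal_leI divide_right_mono) (simp_all del: of_nat_sum of_nat_mult)
    also have "\<dots> = ennreal (real l * (real n / 2 ^ s))"
      by simp
    also have "\<dots> \<le> ennreal (real l * (((b - a) * 2 ^ s + 4) / 2 ^ s))"
      using n_le by (intro ennreal_leI mult_left_mono divide_right_mono) auto
    also have "\<dots> = ennreal (l * (b - a) + 4 * l * (1 / 2) ^ s)"
      by (simp add: field_simps)
    finally show ?thesis .
  qed
  have "(\<lambda>s. \<integral>\<^sup>+x\<in>{a..b}. approx s x \<partial>lborel) \<longlonglongrightarrow> (\<integral>\<^sup>+x\<in>{a..b}. limit x \<partial>lborel)"
    unfolding nn_integral_limit(1)[of "{a..b}", simplified] by (intro LIMSEQ_SUP nn_integral_limit) simp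
  moreover have "(\<lambda>s. ennreal (l * (b - a) + 4 * l * (1 / 2) ^ s)) \<longlonglongrightarrow> ennreal (l * (b - a) + 4 * real l * 0)"
    by (intro tendsto_ennrealI tendsto_add tendsto_mult tendsto_const LIMSEQ_power_zero) simp_all
  ultimately show ?thesis
    using LIMSEQ_le bound by fastforce
qed

text \<open>Averages of \<open>approx s\<close> are lower bounds for those of \<open>limit\<close>,
  so one use of the maximal inequality handles all stages.\<close>

lemma emeasure_heavy_set_le:
  assumes "(\<integral>\<^sup>+x. limit x \<partial>lborel) < \<infinity>" "l > 0"
  shows "of_nat l * emeasure lborel (heavy_set l) \<le> 5 * (\<integral>\<^sup>+x. limit x \<partial>lborel)"
proof -
  define K where "K = (\<lambda>(s, i, n). (real i / 2 ^ s, real (i + n) / 2 ^ s)) ` {(s, i, n). heavy l s i n}"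
  have "heavy_set l = (\<Union>(a, b)\<in>K. {a<..<b})"
    unfolding heavy_set_def K_def by (simp add: case_prod_beta)
  moreover have "ennreal (real l) * emeasure lborel (\<Union>(a, b)\<in>K. {a<..<b}) \<le> 5 * (\<integral>\<^sup>+x. limit x \<partial>lborel)"
  proof (rule maximal_inequality)
    fix a b assume "(a, b) \<in> K"
    then obtain s i n where ab: "heavy l s i n" "a = real i / 2 ^ s" "b = real (i + n) / 2 ^ s"
      by (auto simp: K_def)
    then have "n \<noteq> 0" by (intro notI) (simp add: heavy_def)
    then have "a < b" by (simp add: ab divide_strict_right_mono)
    have "real (l * n * 2 ^ s) \<le> real (\<Sum>k<n. h s (i + k))"
      using ab(1) unfolding heavy_def by (simp only: of_nat_le_iff less_imp_le)
    then have "real l * (b - a) \<le> real (\<Sum>k<n. h s (i + k)) / (2 ^ s * 2 ^ s)"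
      by (simp add: ab(2,3) field_simps)
    then have "ennreal (real l * (b - a)) \<le> (\<integral>\<^sup>+x\<in>{a..<b}. approx s x \<partial>lborel)"
      unfolding ab(2,3) nn_integral_approx by (rule ennreal_leI)
    also have "\<dots> \<le> (\<integral>\<^sup>+x\<in>{a..<b}. limit x \<partial>lborel)"
      unfolding limit_def by (intro nn_integral_mono mult_right_mono SUP_upper) auto
    also have "\<dots> = (\<integral>\<^sup>+x\<in>{a<..<b}. limit x \<partial>lborel)"
      by (intro nn_integral_cong_AE) (use AE_lborel_singleton[of a] in eventually_elim, auto split: split_indicator)
    finally show "a < b \<and> ennreal (real l * (b - a)) \<le> (\<integral>\<^sup>+x\<in>{a<..<b}. limit x \<partial>lborel)"
      using \<open>a < b\<close> by simp
  qed (use assms in auto)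
  ultimately show ?thesis by (simp add: ennreal_of_nat_eq_real_of_nat)
qed

text \<open>A point that is not dyadic lies in the interior of its cell at every level, so blocks of
  a single cell suffice.\<close>

lemma limit_le:
  assumes "x \<notin> heavy_set l" "0 < x" "\<And>s i. x \<noteq> real i / 2 ^ s"
  shows "limit x \<le> of_nat l"
  unfolding limit_def
proof (rule SUP_least)
  fix s
  have "x \<in> {real (idx s x) / 2 ^ s<..<real (idx s x + 1) / 2 ^ s}"
    using idx_bounds[of x s] assms(2) assms(3)[of "idx s x" s] by simp
  then have "\<not> heavy l s (idx s x) 1"
    using assms(1) heavy_subset by blast
  then have "h s (idx s x) \<le> l * 2 ^ s" by (simp add: heavy_def)
  then have "real (h s (idx s x)) \<le> real l * 2 ^ s"
    by (drule_tac of_nat_mono[where 'a = real]) (simp add: algebra_simps)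
  then show "approx s x \<le> of_nat l"
    by (auto simp: approx_def step_def ennreal_of_nat_eq_real_of_nat field_simps intro!: ennreal_leI)
qed

end

section \<open>Lower semicomputable functions as limits of step functions\<close>

lemma ennreal_dense_real: "y < z \<Longrightarrow> \<exists>r\<ge>0. y < ennreal r \<and> ennreal r < z" for y z :: ennreal
proof -
  assume "y < z"
  then obtain w where "y < w" "w < z" using dense by blast
  then show ?thesis by (cases w) auto
qed

lemma lower_semicomputable_approximation:
  assumes "lower_semicomputable f"
  obtains h where "cell_approximation h"
    "\<And>x. 0 \<le> x \<Longrightarrow> x < 1 \<Longrightarrow> cell_approximation.limit h x = f x"
    "\<And>x. \<not> (0 \<le> x \<and> x < 1) \<Longrightarrow> cell_approximation.limit h x = 0"
proof -
  obtain P g k where P: "decidable P" "recursive g" "recursive k" and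
    U: "\<forall>m. {x \<in> {0..1}. ereal (rat_code m) < enn2ereal (f x)} =
      {0..1} \<inter> (\<Union>e\<in>{e. P e \<and> g e = m}. rat_interval (k e))"
    using unif_eff_openE[OF assms[unfolded lower_semicomputable_def]] by blast
  \<comment> \<open>By stage \<open>s\<close> some interval around the cell has been enumerated on
    which \<open>f\<close> exceeds a level of at least \<open>Suc q / 2 ^ s\<close>. The negated
    \<open><\<close> fits the decidable comparison with dyadic numbers.\<close>
  define R where "R s i q \<longleftrightarrow> (\<exists>e<Suc s. P e \<and> inside s i (k e) \<and> \<not> rat_code (g e) < real (Suc q) / 2 ^ s)"
    for s i q
  \<comment> \<open>The value \<open>h s i / 2 ^ s\<close> rounds the best level known on the cell
    down to a multiple of \<open>1 / 2 ^ s\<close> and caps it at \<open>s\<close>, which keeps the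
    sum finite and still reaches every level in the limit. Cells beyond the unit interval get
    \<open>0\<close>.\<close>
  define h where "h s i = (if i < 2 ^ s then \<Sum>q<s * 2 ^ s. of_bool (R s i q) else 0 :: nat)" for s i
  have R_mono: "R s i p" if "R s i q" "p \<le> q" for s i p q
  proof -
    have "real (Suc p) / 2 ^ s \<le> real (Suc q) / 2 ^ s"
      using that(2) by (simp add: divide_right_mono)
    with that(1) show ?thesis unfolding R_def by (meson not_le order_trans)
  qed
  have h_less: "q < h s i \<longleftrightarrow> i < 2 ^ s \<and> q < s * 2 ^ s \<and> R s i q" for s i q
    using count_initial_segment[of "R s i" q "s * 2 ^ s"] R_mono by (auto simp: h_def)
  interpret cell_approximation h
  proof
    show "recursive2 h"
      unfolding h_def R_def
      by (intro rec_intros decidable_comp[OF P(1)] recursive_comp[OF P(2)] recursive_comp[OF P(3)])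
    fix i' i s :: nat assume i: "i' div 2 = i"
    show "2 * h s i \<le> h (Suc s) i'"
    proof (cases "h s i")
      case (Suc q)
      then have q: "i < 2 ^ s" "q < s * 2 ^ s" "R s i q"
        using h_less[of q s i] by simp_all
      have "R (Suc s) i' (Suc (2 * q))"
      proof -
        obtain e where "e < Suc s" "P e" "inside s i (k e)" "\<not> rat_code (g e) < real (Suc q) / 2 ^ s"
          using q(3) by (auto simp: R_def)
        moreover have "real (Suc (Suc (2 * q))) / 2 ^ Suc s = real (Suc q) / 2 ^ s"
          by (simp add: field_simps)
        ultimately show ?thesis
          using inside_Suc[OF _ i] unfolding R_def by (metis less_SucI)
      qed
      moreover have "i' < 2 ^ Suc s" using q(1) i by auto
      moreover have "Suc (2 * q) < Suc s * 2 ^ Suc s" using q(2) by simp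
      ultimately have "Suc (2 * q) < h (Suc s) i'" by (simp add: h_less)
      with Suc show ?thesis by simp
    qed simp
  qed
  have le: "approx s x \<le> f x" if x: "0 \<le> x" "x < 1" for s x
  proof (cases "h s (idx s x)")
    case (Suc q)
    then have "R s (idx s x) q" using h_less[of q s "idx s x"] by simp
    then obtain e where e: "P e" "inside s (idx s x) (k e)" "real (Suc q) / 2 ^ s \<le> rat_code (g e)"
      by (auto simp: R_def not_less)
    have "x \<in> rat_interval (k e)"
      using inside_subset[OF e(2)] idx_bounds[OF x(1), of s] by auto
    then have "x \<in> {x \<in> {0..1}. ereal (rat_code (g e)) < enn2ereal (f x)}"
      unfolding U[rule_format] using e(1) x by auto
    then have "ereal (real (Suc q) / 2 ^ s) \<le> enn2ereal (f x)"
      using e(3) by (metis (mono_tags, lifting) ereal_less_eq(3) less_imp_le mem_Collect_eq order_trans)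
    then have "ennreal (real (Suc q) / 2 ^ s) \<le> f x"
      by (simp add: less_eq_ennreal.rep_eq enn2ereal_ennreal)
    then show ?thesis using x(1) Suc by (simp add: approx_def step_def)
  qed (simp add: approx_def step_def)
  have ge: "f x \<le> limit x" if x: "0 \<le> x" "x < 1" for x
  proof (rule dense_le)
    fix y assume "y < f x"
    then obtain r where r: "y < ennreal r" "ennreal r < f x" "0 \<le> r"
      using ennreal_dense_real by blast
    obtain y' where y': "y = ennreal y'" "0 \<le> y'"
      using r(1) by (metis ennreal_cases ennreal_less_top not_less_iff_gr_or_eq order_less_trans)
    then have "y' < r" using r(1) by (simp add: ennreal_less_iff)
    obtain q where q: "q \<in> \<rat>" "y' < q" "q < r"
      using Rats_dense_in_real[OF \<open>y' < r\<close>] by blast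
    obtain m where m: "rat_code m = q" using rat_code_surj[OF q(1)] by blast
    have "0 < q" using q y' by simp
    have "ereal q < enn2ereal (f x)"
    proof -
      have "ennreal q < f x" using r(2) q(3) by (meson ennreal_leI less_imp_le order_le_less_trans)
      then show ?thesis using \<open>0 < q\<close> by (simp add: less_ennreal.rep_eq enn2ereal_ennreal)
    qed
    then have "x \<in> {x \<in> {0..1}. ereal (rat_code m) < enn2ereal (f x)}" using x m by simp
    then obtain e where e: "P e" "g e = m" "x \<in> rat_interval (k e)"
      unfolding U[rule_format] by blast
    have "(\<lambda>s. q - (1 / 2) ^ s) \<longlonglongrightarrow> q - 0"
      by (intro tendsto_intros LIMSEQ_power_zero) simp
    then have "\<forall>\<^sub>F s in sequentially. y' < q - (1 / 2) ^ s"
      using q(2) by (intro order_tendstoD) auto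
    \<comment> \<open>Such an \<open>s\<close> is late enough for the index \<open>e\<close> to be
      found and for the cap \<open>s\<close> to lie above \<open>q\<close>.\<close>
    moreover have "\<forall>\<^sub>F s in sequentially. nat \<lceil>q\<rceil> + e \<le> s"
      by (rule eventually_ge_at_top)
    ultimately have "\<forall>\<^sub>F s in sequentially. y' < q - (1 / 2) ^ s \<and> inside s (idx s x) (k e) \<and> nat \<lceil>q\<rceil> + e \<le> s"
      using inside_eventually[OF e(3) x(1)] by eventually_elim auto
    then obtain s where s: "y' < q - (1 / 2) ^ s" "inside s (idx s x) (k e)" "nat \<lceil>q\<rceil> + e \<le> s"
      by (auto simp: eventually_sequentially)
    have qs: "q \<le> real s" using s(3) by linarith
    define p where "p = nat \<lfloor>q * 2 ^ s\<rfloor>"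
    have p: "real p \<le> q * 2 ^ s" "q * 2 ^ s < real p + 1"
      using \<open>0 < q\<close> by (simp_all add: p_def)
    have "p \<le> h s (idx s x)"
    proof (cases p)
      case (Suc p')
      have "real (Suc p') / 2 ^ s \<le> q" using p(1) Suc by (simp add: field_simps)
      then have "R s (idx s x) p'"
        using e(1,2) s(2,3) m unfolding R_def by (intro exI[of _ e]) auto
      moreover have "p' < s * 2 ^ s"
      proof -
        have "real p \<le> real s * 2 ^ s" using mult_right_mono[OF qs, of "2 ^ s"] p(1) by (meson order_trans zero_le_numeral zero_le_power)
        then have "p \<le> s * 2 ^ s"
          by (simp flip: of_nat_le_iff[where 'a = real])
        with Suc show ?thesis by simp
      qed
      ultimately have "p' < h s (idx s x)"
        using idx_less[OF x] by (simp add: h_less)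
      with Suc show ?thesis by simp
    qed simp
    then have "real p / 2 ^ s \<le> real (h s (idx s x)) / 2 ^ s" by (simp add: divide_right_mono)
    moreover have "q < (real p + 1) / 2 ^ s"
      using p(2) by (simp add: pos_less_divide_eq)
    then have "q - (1 / 2) ^ s < real p / 2 ^ s"
      by (simp add: power_divide add_divide_distrib)
    ultimately have "y' \<le> real (h s (idx s x)) / 2 ^ s" using s(1) by linarith
    then have "y \<le> approx s x"
      using x(1) by (simp add: y' approx_def step_def ennreal_leI)
    also have "\<dots> \<le> limit x" unfolding limit_def by (intro SUP_upper) simp
    finally show "y \<le> limit x" .
  qed
  show ?thesis
  proof (rule that[of h])
    show "cell_approximation h" by unfold_locales
    show "limit x = f x" if "0 \<le> x" "x < 1" for x
      using le ge that unfolding limit_def by (intro antisym SUP_least) auto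
    show "limit x = 0" if "\<not> (0 \<le> x \<and> x < 1)" for x
    proof -
      have "approx s x = 0" for s
      proof (cases "0 \<le> x")
        case True
        then have "1 \<le> x" using that by simp
        then have "1 * 2 ^ s < real (idx s x) + 1"
          using idx_bounds(2)[OF True, of s] mult_right_mono[OF \<open>1 \<le> x\<close>, of "2 ^ s"]
          by (meson order_le_less_trans zero_le_numeral zero_le_power)
        then have "real (2 ^ s) < real (Suc (idx s x))" by simp
        then have "2 ^ s \<le> idx s x" unfolding of_nat_less_iff by simp
        then show ?thesis by (simp add: approx_def step_def h_def)
      qed (simp add: approx_def step_def)
      then show ?thesis by (simp add: limit_def)
    qed
  qed
qed

section \<open>Integral tests and shrinking intervals\<close>

lemma fmeasurable_Icc: "{a..b :: real} \<in> fmeasurable lborel"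
  by (simp add: fmeasurable_def emeasure_lborel_Icc_eq)

text \<open>The intervals of radius \<open>1 / 2 ^ (s + m + 2)\<close> around a dyadic rational form
  a test. On this finer grid their end points are dyadic, so their codes are recursive in
  \<open>m\<close>.\<close>

lemma ml_random_not_dyadic:
  assumes "ml_random z"
  shows "z \<noteq> real i / 2 ^ s"
proof
  assume z: "z = real i / 2 ^ s"
  obtain c where c: "rat_code c = -1" using rat_code_surj[of "-1"] by auto
  \<comment> \<open>\<open>dyadic_code\<close> covers nonnegative numbers only, so for
    \<open>i = 0\<close> the left end is the fixed number \<open>-1\<close>; otherwise the
    difference of naturals does not truncate.\<close>
  define lo where "lo m = (if i = 0 then c else dyadic_code (i * 2 ^ (m + 2) - 1) (s + m + 2))" for m
  define hi where "hi m = dyadic_code (i * 2 ^ (m + 2) + 1) (s + m + 2)" for m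
  define U where "U m = {0..1} \<inter> {rat_code (lo m)<..<rat_code (hi m)}" for m
  have hi: "rat_code (hi m) = z + 1 / 2 ^ (s + m + 2)" for m
    by (simp add: hi_def z field_simps power_add)
  have lo: "rat_code (lo m) = z - 1 / 2 ^ (s + m + 2)" if "i \<noteq> 0" for m
  proof -
    have "1 \<le> i * 2 ^ (m + 2)" using that by simp
    then have "real (i * 2 ^ (m + 2) - 1) = real i * 2 ^ (m + 2) - 1"
      by (subst of_nat_diff) auto
    then show ?thesis using that by (simp add: lo_def z field_simps power_add)
  qed
  have lo0: "rat_code (lo m) = -1" if "i = 0" for m
    using that by (simp add: lo_def c)
  have "ml_test U"
    unfolding ml_test_def
  proof (intro conjI allI)
    show "unif_eff_open U"
    proof (rule unif_eff_openI[of "\<lambda>x. True" "\<lambda>x. x" "\<lambda>m. prod_encode (lo m, hi m)"])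
      show "recursive (\<lambda>m. prod_encode (lo m, hi m))"
        unfolding lo_def hi_def by (intro rec_intros)
      show "decidable (\<lambda>x. True)" using recursive_const[of 1] by simp
    qed (auto intro: rec_intros simp: U_def)
    fix m
    have "U m \<subseteq> {z - 1 / 2 ^ (s + m + 2)..z + 1 / 2 ^ (s + m + 2)}"
    proof (cases "i = 0")
      case True
      then have "z - 1 / 2 ^ (s + m + 2) \<le> 0" by (simp add: z)
      then show ?thesis unfolding U_def hi by fastforce
    next
      case False
      show ?thesis unfolding U_def hi lo[OF False] by auto
    qed
    then have "measure lborel (U m) \<le> measure lborel {z - 1 / 2 ^ (s + m + 2)..z + 1 / 2 ^ (s + m + 2)}"
      by (intro measure_mono_fmeasurable) (auto simp: U_def fmeasurable_def)
    also have "\<dots> = 2 / 2 ^ (s + m + 2)" by simp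
    also have "\<dots> = (1 / 2) ^ m * (1 / 2) ^ Suc s"
      by (simp add: power_add power_divide)
    also have "\<dots> \<le> (1 / 2) ^ m"
      by (rule mult_left_le) (auto intro: power_le_one simp del: power_Suc)
    finally show "measure lborel (U m) \<le> (1 / 2) ^ m" .
  qed
  moreover have "z \<in> U m" for m
  proof -
    have "z \<in> {0..1}" using assms by (simp add: ml_random_def)
    moreover have "rat_code (lo m) < z" using lo lo0 z by (cases "i = 0") auto
    ultimately show ?thesis by (simp add: U_def hi)
  qed
  ultimately show False using assms by (auto simp: ml_random_def)
qed

lemma ml_random_bounds:
  assumes "ml_random z"
  shows "0 < z" "z < 1"
  using assms ml_random_not_dyadic[OF assms, of 0 0] ml_random_not_dyadic[OF assms, of 1 0]
  by (auto simp: ml_random_def)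

section \<open>Tests built from effectively open sets\<close>

lemma lower_semicomputable_SUP:
  assumes "unif_eff_open U"
  shows "lower_semicomputable (\<lambda>x. SUP m. if x \<in> U m then of_nat m else 0)"
proof -
  obtain P g k where P: "decidable P" "recursive g" "recursive k" and
    U: "\<forall>m. U m = {0..1} \<inter> (\<Union>e\<in>{e. P e \<and> g e = m}. rat_interval (k e))"
    using unif_eff_openE[OF assms] by blast
  obtain c d where cd: "rat_code c = -1" "rat_code d = 2"
    using rat_code_surj[of "-1"] rat_code_surj[of 2] by auto
  have level: "ereal q < enn2ereal (SUP m. if x \<in> U m then of_nat m else 0) \<longleftrightarrow>
      q < 0 \<or> (\<exists>m. x \<in> U m \<and> q < real m)" for q x
  proof (cases "q < 0")
    case True
    then have "ereal q < 0" by simp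
    also have "0 \<le> enn2ereal (SUP m. if x \<in> U m then of_nat m else 0)" by (rule enn2ereal_nonneg)
    finally show ?thesis using True by simp
  next
    case False
    then have "ereal q < enn2ereal (SUP m. if x \<in> U m then of_nat m else 0) \<longleftrightarrow>
        ennreal q < (SUP m. if x \<in> U m then of_nat m else 0)"
      by (simp add: less_ennreal.rep_eq enn2ereal_ennreal)
    also have "\<dots> \<longleftrightarrow> (\<exists>m. x \<in> U m \<and> q < real m)"
      unfolding less_SUP_iff using False
      by (auto simp: ennreal_of_nat_eq_real_of_nat ennreal_less_iff split: if_splits)
    finally show ?thesis using False by simp
  qed
  let ?r = "\<lambda>x. fst (prod_decode x)"
  let ?b = "\<lambda>x. fst (prod_decode (snd (prod_decode x)))"
  let ?e = "\<lambda>x. snd (prod_decode (snd (prod_decode x)))"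
  \<comment> \<open>An index is a triple of level code, tag and enumeration index. Tag
    \<open>0\<close> puts the interval from \<open>-1\<close> to \<open>2\<close> into every
    negative level; other tags put an interval of \<open>U (g e)\<close> into all levels below
    \<open>g e\<close>. Numbers are written over \<open>2 ^ 0\<close> to fit the dyadic
    comparison.\<close>
  let ?Q = "\<lambda>x. (?b x = 0 \<and> rat_code (?r x) < real 0 / 2 ^ 0) \<or>
      (0 < ?b x \<and> P (?e x) \<and> rat_code (?r x) < real (g (?e x)) / 2 ^ 0)"
  let ?I = "\<lambda>x. if ?b x = 0 then prod_encode (c, d) else k (?e x)"
  show ?thesis
    unfolding lower_semicomputable_def level
  proof (rule unif_eff_openI[of ?Q ?r ?I])
    show "decidable ?Q"
      by (intro rec_intros decidable_comp[OF P(1)] recursive_comp[OF P(2)])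
    show "recursive ?r" "recursive ?I"
      by (intro rec_intros recursive_comp[OF P(3)])+
    fix r
    show "{x \<in> {0..1}. rat_code r < 0 \<or> (\<exists>m. x \<in> U m \<and> rat_code r < real m)} =
        {0..1} \<inter> (\<Union>x\<in>{x. ?Q x \<and> ?r x = r}. rat_interval (?I x))" (is "?A = ?B")
    proof (intro set_eqI iffI)
      fix y assume y: "y \<in> ?A"
      then consider "rat_code r < 0" | m where "y \<in> U m" "rat_code r < real m" by auto
      then show "y \<in> ?B"
      proof cases
        case 1
        then show ?thesis using y
          by (intro IntI UN_I[of "prod_encode (r, prod_encode (0, 0))"]) (auto simp: cd)
      next
        case 2
        then obtain e where "P e" "g e = m" "y \<in> rat_interval (k e)" using U by auto
        then show ?thesis using y 2
          by (intro IntI UN_I[of "prod_encode (r, prod_encode (1, e))"]) auto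
      qed
    next
      fix y assume y: "y \<in> ?B"
      then obtain x where x: "?Q x" "?r x = r" "y \<in> rat_interval (?I x)" "y \<in> {0..1}" by blast
      show "y \<in> ?A"
      proof (cases "?b x = 0")
        case False
        then have "y \<in> U (g (?e x))" using x U by auto
        with False x show ?thesis by auto
      qed (use x in auto)
    qed
  qed
qed

lemma unif_eff_open_borel: "unif_eff_open U \<Longrightarrow> U m \<in> sets borel"
  by (intro eff_open_borel unif_eff_open_eff_open)

text \<open>The supremum is at most the sum of \<open>m\<close> times the indicator of
  \<open>U m\<close>, whose integral is dominated by the differentiated geometric series at
  \<open>1 / 2\<close>.\<close>

lemma integral_test_ml_test:
  assumes "ml_test U"
  shows "integral_test (\<lambda>x. SUP m. if x \<in> U m then of_nat m else 0)"
  unfolding integral_test_def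
proof
  have U: "unif_eff_open U" "\<And>m. measure lborel (U m) \<le> (1 / 2) ^ m"
    using assms by (auto simp: ml_test_def)
  note [measurable] = unif_eff_open_borel[OF U(1)]
  show "lower_semicomputable (\<lambda>x. SUP m. if x \<in> U m then of_nat m else 0)"
    by (rule lower_semicomputable_SUP) (rule U(1))
  have sub: "U m \<subseteq> {0..1}" for m
    using U(1) by (auto simp: unif_eff_open_def)
  have em: "emeasure lborel (U m) \<le> ennreal ((1 / 2) ^ m)" for m
  proof -
    \<comment> \<open>\<open>measure\<close> assigns \<open>0\<close> to sets of infinite measure,
      so finiteness must come first before the bound transfers to \<open>emeasure\<close>.\<close>
    have "emeasure lborel (U m) \<le> emeasure lborel {0..1::real}" by (intro emeasure_mono sub) simp
    then have "emeasure lborel (U m) \<noteq> \<infinity>" by (auto simp: top_unique)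
    then show ?thesis using U(2)[of m] by (simp add: emeasure_eq_ennreal_measure ennreal_leI)
  qed
  have sums: "(\<lambda>m. real (Suc m) * (1 / 2) ^ m) sums (1 / (1 - 1 / 2)\<^sup>2)"
    using geometric_deriv_sums[of "1 / 2 :: real"] by simp
  have "(\<integral>\<^sup>+x\<in>{0..1}. (SUP m. if x \<in> U m then of_nat m else 0) \<partial>lborel)
      \<le> (\<integral>\<^sup>+x. (\<Sum>m. of_nat m * indicator (U m) x) \<partial>lborel)"
  proof (intro nn_integral_mono)
    fix x :: real
    have "(SUP m. if x \<in> U m then of_nat m else 0) \<le> (\<Sum>m. of_nat m * indicator (U m) x :: ennreal)"
    proof (rule SUP_least)
      fix m
      define g where "g k = (of_nat k * indicator (U k) x :: ennreal)" for k
      have "(if x \<in> U m then of_nat m else 0) = g m"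
        by (simp add: g_def)
      also have "\<dots> = sum g {m}" by simp
      also have "\<dots> \<le> (\<Sum>k. g k)"
        by (rule sum_le_suminf) auto
      also have "\<dots> = (\<Sum>m. of_nat m * indicator (U m) x)"
        by (simp add: g_def)
      finally show "(if x \<in> U m then of_nat m else 0) \<le> (\<Sum>m. of_nat m * indicator (U m) x :: ennreal)" .
    qed
    then show "(SUP m. if x \<in> U m then of_nat m else 0) * indicator {0..1} x
        \<le> (\<Sum>m. of_nat m * indicator (U m) x :: ennreal)"
      by (auto split: split_indicator)
  qed
  also have "\<dots> = (\<Sum>m. of_nat m * emeasure lborel (U m))"
    by (subst nn_integral_suminf) (auto simp: nn_integral_cmult)
  also have "\<dots> \<le> (\<Sum>m. ennreal (real (Suc m) * (1 / 2) ^ m))"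
  proof (rule suminf_le[OF _ summableI summableI])
    fix m
    have "of_nat m \<le> ennreal (real (Suc m))"
      unfolding ennreal_of_nat_eq_real_of_nat by (rule ennreal_leI) simp
    then have "of_nat m * emeasure lborel (U m) \<le> ennreal (real (Suc m)) * ennreal ((1 / 2) ^ m)"
      using em[of m] by (rule mult_mono) simp_all
    also have "\<dots> = ennreal (real (Suc m) * (1 / 2) ^ m)"
      by (rule ennreal_mult[symmetric]) simp_all
    finally show "of_nat m * emeasure lborel (U m) \<le> ennreal (real (Suc m) * (1 / 2) ^ m)" .
  qed
  also have "\<dots> = ennreal (1 / (1 - 1 / 2)\<^sup>2)"
    by (rule suminf_ennreal_eq[OF _ sums]) simp
  also have "\<dots> < \<infinity>" by simp
  finally show "(\<integral>\<^sup>+x\<in>{0..1}. (SUP m. if x \<in> U m then of_nat m else 0) \<partial>lborel) < \<infinity>" .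
qed

text \<open>At a point that lies in all members of a test, the supremum test takes the value
  infinity.\<close>

lemma finite_integral_tests_imp_ml_random:
  assumes "z \<in> {0..1}" "\<And>f. integral_test f \<Longrightarrow> f z < \<infinity>"
  shows "ml_random z"
  unfolding ml_random_def
proof (intro conjI allI impI notI)
  fix U assume U: "ml_test U" "z \<in> (\<Inter>m. U m)"
  have "(SUP m. of_nat m :: ennreal) = \<infinity>"
    by (simp add: ennreal_SUP_of_nat_eq_top)
  moreover have "(SUP m. if z \<in> U m then of_nat m else 0) = (SUP m. of_nat m :: ennreal)"
    using U(2) by (intro SUP_cong) auto
  ultimately have "(SUP m. if z \<in> U m then of_nat m else 0) = (\<infinity> :: ennreal)"
    by (rule trans[rotated])
  with assms(2)[OF integral_test_ml_test[OF U(1)]] show False by (simp only: less_irrefl)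
qed (fact assms(1))

text \<open>The supremum construction for the family with \<open>V\<close> at index \<open>1\<close>
  and empty sets elsewhere returns the indicator.\<close>

lemma integral_test_indicator:
  assumes "eff_open V"
  shows "integral_test (indicator V)"
  unfolding integral_test_def
proof
  have "(SUP m. if x \<in> (if m = 1 then V else {}) then of_nat m else 0) = (indicator V x :: ennreal)" for x
  proof (intro antisym SUP_least)
    fix m :: nat
    show "(if x \<in> (if m = 1 then V else {}) then of_nat m else 0) \<le> (indicator V x :: ennreal)"
      by auto
  next
    show "indicator V x \<le> (SUP m. if x \<in> (if m = 1 then V else {}) then of_nat m else 0 :: ennreal)"
      by (rule SUP_upper2[of 1]) (auto split: split_indicator)
  qed
  then show "lower_semicomputable (indicator V)"
    using lower_semicomputable_SUP[OF eff_open_unif[OF assms, of 1]] by simp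
  have "(\<integral>\<^sup>+x\<in>{0..1}. indicator V x \<partial>lborel) \<le> (\<integral>\<^sup>+x. indicator {0..1::real} x \<partial>lborel)"
    by (intro nn_integral_mono) (auto split: split_indicator)
  then show "(\<integral>\<^sup>+x\<in>{0..1}. indicator V x \<partial>lborel) < \<infinity>"
    by (rule order_le_less_trans) simp
qed

section \<open>Dyadic intervals, shrinking intervals and density\<close>

lemma binary_expansion_bounds:
  assumes "binary_expansion z Z"
  defines "a \<equiv> \<lambda>n. \<Sum>i<n. of_bool (Z i) / 2 ^ Suc i :: real"
  shows "0 \<le> a n" "a n + 1 / 2 ^ n \<le> 1" "a n \<le> z" "z \<le> a n + 1 / 2 ^ n"
proof -
  have lim: "a \<longlonglongrightarrow> z"
    using assms(1) unfolding binary_expansion_def sums_def a_def .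
  \<comment> \<open>The right end \<open>a k + 1 / 2 ^ k\<close> never moves to the right, as the
    next digit adds at most \<open>1 / 2 ^ Suc k\<close>. The case \<open>n = 0\<close> confines all
    intervals to the unit interval.\<close>
  have step: "a (n + k) \<le> a n + 1 / 2 ^ n - 1 / 2 ^ (n + k)" for n k
  proof (induction k)
    case (Suc k)
    have "a (n + Suc k) \<le> a (n + k) + 1 / 2 ^ Suc (n + k)"
      by (simp add: a_def divide_right_mono)
    moreover have "1 / 2 ^ (n + k) = 2 * (1 / 2 ^ Suc (n + k) :: real)" by simp
    ultimately show ?case using Suc unfolding add_Suc_right by linarith
  qed simp
  have inc: "incseq a"
    by (intro incseq_SucI) (simp add: a_def)
  show "0 \<le> a n" by (auto simp: a_def intro: sum_nonneg)
  show "a n + 1 / 2 ^ n \<le> 1" using step[of 0 n] by (simp add: a_def)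
  show "a n \<le> z" by (rule incseq_le[OF inc lim])
  show "z \<le> a n + 1 / 2 ^ n"
  proof (rule LIMSEQ_le_const2[OF lim], intro exI[of _ n] allI impI)
    fix m assume "n \<le> m"
    then obtain k where m: "m = n + k" by (auto simp: le_iff_add)
    have "(0 :: real) \<le> 1 / 2 ^ (n + k)" by simp
    with step[of n k] show "a m \<le> a n + 1 / 2 ^ n" unfolding m by linarith
  qed
qed

lemma lebesgue_point_imp_dyadic_lebesgue_point:
  assumes "lebesgue_point f z"
  shows "dyadic_lebesgue_point f z"
  unfolding dyadic_lebesgue_point_def
proof (intro conjI allI impI)
  show "f z < \<infinity>" using assms by (simp add: lebesgue_point_def)
  fix Z assume Z: "binary_expansion z Z"
  define a where "a n = (\<Sum>i<n. of_bool (Z i) / 2 ^ Suc i :: real)" for n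
  have D: "dyadic_interval Z n = {a n..a n + 1 / 2 ^ n}" for n
    by (simp add: dyadic_interval_def a_def Let_def)
  note bounds = binary_expansion_bounds[OF Z, folded a_def]
  have "filterlim (dyadic_interval Z) (shrinking_intervals z) sequentially"
    unfolding shrinking_intervals_def filterlim_inf filterlim_principal filterlim_filtercomap_iff
  proof
    have "(\<lambda>n. (1 / 2) ^ n :: real) \<longlonglongrightarrow> 0" by (rule LIMSEQ_power_zero) simp
    then show "filterlim (measure lborel \<circ> dyadic_interval Z) (at_right 0) sequentially"
      unfolding filterlim_at comp_def D by (auto simp: power_divide)
    show "\<forall>\<^sub>F n in sequentially. dyadic_interval Z n \<in> {Q. is_interval Q \<and> Q \<subseteq> {0..1} \<and> z \<in> Q}"
      unfolding D using bounds by (intro always_eventually) (auto simp: is_interval_cc intro: order_trans)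
  qed
  then have "(\<lambda>n. (\<integral>\<^sup>+x\<in>dyadic_interval Z n. f x \<partial>lborel) / emeasure lborel (dyadic_interval Z n))
      \<longlonglongrightarrow> f z"
    by (rule filterlim_compose[rotated]) (use assms in \<open>simp add: lebesgue_point_def\<close>)
  moreover have "(\<integral>\<^sup>+x\<in>dyadic_interval Z n. f x \<partial>lborel) / emeasure lborel (dyadic_interval Z n) =
      2 ^ n * (\<integral>\<^sup>+x\<in>dyadic_interval Z n. f x \<partial>lborel)" for n
  proof -
    have "inverse (emeasure lborel (dyadic_interval Z n)) = ennreal (2 ^ n)"
      by (simp add: D inverse_ennreal inverse_eq_divide)
    then show ?thesis
      by (simp add: divide_ennreal_def mult.commute ennreal_power[symmetric])
  qed
  ultimately show "(\<lambda>n. 2 ^ n * (\<integral>\<^sup>+x\<in>dyadic_interval Z n. f x \<partial>lborel)) \<longlonglongrightarrow> f z"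
    by simp
qed

lemma eventually_shrinking_intervals:
  assumes "0 < d" and "\<And>Q. is_interval Q \<Longrightarrow> Q \<subseteq> {0..1} \<Longrightarrow> z \<in> Q \<Longrightarrow> 0 < measure lborel Q \<Longrightarrow>
    measure lborel Q < d \<Longrightarrow> R Q"
  shows "\<forall>\<^sub>F Q in shrinking_intervals z. R Q"
  unfolding shrinking_intervals_def eventually_inf_principal eventually_filtercomap
proof (intro exI[of _ "\<lambda>m. 0 < m \<and> m < d"] conjI allI impI)
  show "\<forall>\<^sub>F m in at_right 0. 0 < m \<and> m < d"
    using assms(1) by (auto simp: eventually_at_right_field)
qed (use assms(2) in auto)

text \<open>Allows \<open>Q\<close>, which may end at \<open>z\<close>, to be replaced by a
  symmetric interval with positive length on both sides, as the density condition asks; this costs a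
  factor \<open>2\<close>.\<close>

lemma interval_subset_measure:
  fixes Q :: "real set"
  assumes "is_interval Q" "Q \<subseteq> {0..1}" "z \<in> Q"
  shows "Q \<subseteq> {z - measure lborel Q..z + measure lborel Q}"
proof
  fix x assume x: "x \<in> Q"
  have fm: "Q \<in> fmeasurable lborel"
  proof (rule fmeasurableI2[OF _ assms(2)])
    show "{0..1::real} \<in> fmeasurable lborel" by (rule fmeasurable_Icc)
    show "Q \<in> sets lborel" using real_interval_borel_measurable[OF assms(1)] by simp
  qed
  have ends: "min x z \<in> Q" "max x z \<in> Q" using x assms(3) by (auto simp: min_def max_def)
  have "{min x z..max x z} \<subseteq> Q"
  proof
    fix w assume "w \<in> {min x z..max x z}"
    then have "min x z \<le> w" "w \<le> max x z" by simp_all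
    then show "w \<in> Q" by (rule is_interval_mem[OF assms(1) ends])
  qed
  then have "measure lborel {min x z..max x z} \<le> measure lborel Q"
    by (rule measure_mono_fmeasurable[OF _ _ fm]) simp
  then show "x \<in> {z - measure lborel Q..z + measure lborel Q}"
    by (cases "x \<le> z") (auto simp: min_def max_def)
qed

text \<open>Ratios never exceed \<open>1\<close> close to \<open>z\<close>, so density
  \<open>1\<close> means that the share of the complement \<open>V\<close> tends to
  \<open>0\<close>.\<close>

lemma lower_density_eq_1_iff:
  assumes z: "0 < z" "z < 1" and V: "V \<in> sets borel" "V \<subseteq> {0..1}"
  shows "lower_density ({0..1} - V) z = 1 \<longleftrightarrow>
    (\<forall>\<epsilon>>0. \<exists>d>0. \<forall>\<gamma> \<delta>. 0 < \<gamma> \<longrightarrow> \<gamma> < d \<longrightarrow> 0 < \<delta> \<longrightarrow> \<delta> < d \<longrightarrow>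
      measure lborel ({z - \<gamma>..z + \<delta>} \<inter> V) \<le> \<epsilon> * (\<gamma> + \<delta>))"
proof -
  define D where "D = (\<lambda>(\<gamma>, \<delta>). ereal (measure lborel ({z - \<gamma>..z + \<delta>} \<inter> ({0..1} - V)) / (\<gamma> + \<delta>)))"
  \<comment> \<open>Below \<open>d0\<close> the intervals stay within the unit interval, and the
    shares of \<open>V\<close> and its complement add up to \<open>1\<close>.\<close>
  define d0 where "d0 = min z (1 - z)"
  have d0: "0 < d0" using z by (simp add: d0_def)
  have fm: "{z - \<gamma>..z + \<delta>} \<inter> V \<in> fmeasurable lborel" for \<gamma> \<delta>
    by (rule fmeasurableI2[of "{z - \<gamma>..z + \<delta>}"]) (use V(1) in \<open>auto simp: fmeasurable_Icc\<close>)
  have D: "D (\<gamma>, \<delta>) = ereal (1 - measure lborel ({z - \<gamma>..z + \<delta>} \<inter> V) / (\<gamma> + \<delta>))"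
    if "0 < \<gamma>" "\<gamma> < d0" "0 < \<delta>" "\<delta> < d0" for \<gamma> \<delta>
  proof -
    have "{z - \<gamma>..z + \<delta>} \<inter> ({0..1} - V) = {z - \<gamma>..z + \<delta>} - {z - \<gamma>..z + \<delta>} \<inter> V"
      using that by (auto simp: d0_def)
    then have "measure lborel ({z - \<gamma>..z + \<delta>} \<inter> ({0..1} - V)) =
        measure lborel {z - \<gamma>..z + \<delta>} - measure lborel ({z - \<gamma>..z + \<delta>} \<inter> V)"
      using V(1) 
      by (simp only:) (rule measure_Diff, auto simp: emeasure_lborel_Icc_eq split: if_splits)
    then show ?thesis using that by (simp add: D_def diff_divide_distrib)
  qed
  have ev: "(\<forall>\<^sub>F p in at_right 0 \<times>\<^sub>F at_right 0. R p) \<longleftrightarrow>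
      (\<exists>d>0. \<forall>\<gamma> \<delta>. 0 < \<gamma> \<longrightarrow> \<gamma> < d \<longrightarrow> 0 < \<delta> \<longrightarrow> \<delta> < d \<longrightarrow> R (\<gamma>, \<delta>))" for R :: "real \<times> real \<Rightarrow> bool"
  proof
    assume "\<forall>\<^sub>F p in at_right 0 \<times>\<^sub>F at_right 0. R p"
    then obtain P Q where PQ: "eventually P (at_right 0)" "eventually Q (at_right 0)"
      "\<And>x y. P x \<Longrightarrow> Q y \<Longrightarrow> R (x, y)"
      unfolding eventually_prod_filter by blast
    then obtain b c where "0 < b" "0 < c" "\<And>y. 0 < y \<Longrightarrow> y < b \<Longrightarrow> P y" "\<And>y. 0 < y \<Longrightarrow> y < c \<Longrightarrow> Q y"
      unfolding eventually_at_right_field by blast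
    then show "\<exists>d>0. \<forall>\<gamma> \<delta>. 0 < \<gamma> \<longrightarrow> \<gamma> < d \<longrightarrow> 0 < \<delta> \<longrightarrow> \<delta> < d \<longrightarrow> R (\<gamma>, \<delta>)"
      using PQ(3) by (intro exI[of _ "min b c"]) auto
  next
    assume "\<exists>d>0. \<forall>\<gamma> \<delta>. 0 < \<gamma> \<longrightarrow> \<gamma> < d \<longrightarrow> 0 < \<delta> \<longrightarrow> \<delta> < d \<longrightarrow> R (\<gamma>, \<delta>)"
    then obtain d where d: "d > 0" "\<And>\<gamma> \<delta>. 0 < \<gamma> \<Longrightarrow> \<gamma> < d \<Longrightarrow> 0 < \<delta> \<Longrightarrow> \<delta> < d \<Longrightarrow> R (\<gamma>, \<delta>)"
      by blast
    have "\<forall>\<^sub>F x in at_right 0. 0 < x \<and> x < d"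
      using d(1) by (auto simp: eventually_at_right_field)
    then show "\<forall>\<^sub>F p in at_right 0 \<times>\<^sub>F at_right 0. R p"
      unfolding eventually_prod_filter using d(2) by blast
  qed
  have "Liminf (at_right 0 \<times>\<^sub>F at_right 0) D \<le> 1"
  proof -
    have "\<forall>\<^sub>F p in at_right 0 \<times>\<^sub>F at_right 0. D p \<le> 1"
      unfolding ev using d0 by (intro exI[of _ d0]) (auto simp: D one_ereal_def)
    moreover have "at_right 0 \<times>\<^sub>F at_right (0 :: real) \<noteq> (bot :: (real \<times> real) filter)"
      by (simp add: prod_filter_eq_bot)
    ultimately show ?thesis
      using Liminf_mono[of D "\<lambda>_. 1"] Liminf_const[of "at_right 0 \<times>\<^sub>F at_right (0 :: real)" "1 :: ereal"]
      by fastforce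
  qed
  then have "lower_density ({0..1} - V) z = 1 \<longleftrightarrow> 1 \<le> Liminf (at_right 0 \<times>\<^sub>F at_right 0) D"
    by (auto simp: lower_density_def D_def)
  also have "\<dots> \<longleftrightarrow> (\<forall>y<1. \<forall>\<^sub>F p in at_right 0 \<times>\<^sub>F at_right 0. y < D p)"
    by (rule le_Liminf_iff)
  also have "\<dots> \<longleftrightarrow> (\<forall>\<epsilon>>0. \<exists>d>0. \<forall>\<gamma> \<delta>. 0 < \<gamma> \<longrightarrow> \<gamma> < d \<longrightarrow> 0 < \<delta> \<longrightarrow> \<delta> < d \<longrightarrow>
      measure lborel ({z - \<gamma>..z + \<delta>} \<inter> V) \<le> \<epsilon> * (\<gamma> + \<delta>))"
  proof (intro iffI allI impI)
    fix \<epsilon> :: real assume "\<forall>y<1. \<forall>\<^sub>F p in at_right 0 \<times>\<^sub>F at_right 0. y < D p" "0 < \<epsilon>"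
    then have "\<forall>\<^sub>F p in at_right 0 \<times>\<^sub>F at_right 0. ereal (1 - \<epsilon>) < D p"
      by (simp add: one_ereal_def)
    then obtain d where d: "d > 0" "\<And>\<gamma> \<delta>. 0 < \<gamma> \<Longrightarrow> \<gamma> < d \<Longrightarrow> 0 < \<delta> \<Longrightarrow> \<delta> < d \<Longrightarrow> ereal (1 - \<epsilon>) < D (\<gamma>, \<delta>)"
      unfolding ev by blast
    show "\<exists>d>0. \<forall>\<gamma> \<delta>. 0 < \<gamma> \<longrightarrow> \<gamma> < d \<longrightarrow> 0 < \<delta> \<longrightarrow> \<delta> < d \<longrightarrow>
      measure lborel ({z - \<gamma>..z + \<delta>} \<inter> V) \<le> \<epsilon> * (\<gamma> + \<delta>)"
    proof (intro exI[of _ "min d d0"] conjI allI impI)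
      fix \<gamma> \<delta> assume "0 < \<gamma>" "\<gamma> < min d d0" "0 < \<delta>" "\<delta> < min d d0"
      then show "measure lborel ({z - \<gamma>..z + \<delta>} \<inter> V) \<le> \<epsilon> * (\<gamma> + \<delta>)"
        using d(2)[of \<gamma> \<delta>] D[of \<gamma> \<delta>] by (simp add: field_simps)
    qed (use d d0 in simp)
  next
    fix y :: ereal assume *: "\<forall>\<epsilon>>0. \<exists>d>0. \<forall>\<gamma> \<delta>. 0 < \<gamma> \<longrightarrow> \<gamma> < d \<longrightarrow> 0 < \<delta> \<longrightarrow> \<delta> < d \<longrightarrow>
      measure lborel ({z - \<gamma>..z + \<delta>} \<inter> V) \<le> \<epsilon> * (\<gamma> + \<delta>)" "y < 1"
    then obtain r where r: "y < ereal r" "ereal r < 1" by (metis ereal_dense2)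
    define \<epsilon> where "\<epsilon> = 1 - r"
    have "0 < \<epsilon>" using r(2) by (simp add: \<epsilon>_def one_ereal_def)
    with *(1) obtain d where d: "d > 0" "\<And>\<gamma> \<delta>. 0 < \<gamma> \<Longrightarrow> \<gamma> < d \<Longrightarrow> 0 < \<delta> \<Longrightarrow> \<delta> < d \<Longrightarrow>
        measure lborel ({z - \<gamma>..z + \<delta>} \<inter> V) \<le> \<epsilon> * (\<gamma> + \<delta>)"
      by blast
    show "\<forall>\<^sub>F p in at_right 0 \<times>\<^sub>F at_right 0. y < D p"
      unfolding ev
    proof (intro exI[of _ "min d d0"] conjI allI impI)
      fix \<gamma> \<delta> assume gd: "0 < \<gamma>" "\<gamma> < min d d0" "0 < \<delta>" "\<delta> < min d d0"
      then have "measure lborel ({z - \<gamma>..z + \<delta>} \<inter> V) / (\<gamma> + \<delta>) \<le> \<epsilon>"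
        using d(2)[of \<gamma> \<delta>] by (simp add: field_simps)
      then have "ereal r \<le> D (\<gamma>, \<delta>)"
        using D[of \<gamma> \<delta>] gd by (simp add: \<epsilon>_def)
      with r(1) show "y < D (\<gamma>, \<delta>)" by (rule less_le_trans)
    qed (use d d0 in simp)
  qed
  finally show ?thesis .
qed

section \<open>Density random points are Lebesgue points\<close>

lemma AE_not_dyadic: "AE x in lborel. \<forall>s i. x \<noteq> real i / 2 ^ s"
proof -
  have "{x. \<exists>s i. x = real i / 2 ^ s} = range (\<lambda>(s, i). real i / 2 ^ s)"
    by auto
  then have "countable {x. \<exists>s i. x = real i / 2 ^ s}"
    by simp
  then show ?thesis
    by (auto dest!: countable_imp_null_set_lborel[THEN AE_not_in])
qed

lemma eff_open_superlevel:
  "lower_semicomputable f \<Longrightarrow> eff_open {x \<in> {0..1}. ereal (rat_code r) < enn2ereal (f x)}"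
  unfolding lower_semicomputable_def by (rule unif_eff_open_eff_open)

lemma emeasure_eq_measure_unit_interval: "Q \<in> sets borel \<Longrightarrow> Q \<subseteq> {0..1} \<Longrightarrow> emeasure lborel Q = ennreal (measure lborel Q)"
  for Q :: "real set"
  by (intro emeasure_eq_measure2 fmeasurableI2[OF fmeasurable_Icc]) auto

lemma density_random_imp_lebesgue_point:
  assumes "density_random z" "integral_test f"
  shows "lebesgue_point f z"
proof -
  have ml: "ml_random z" using assms(1) by (simp add: density_random_def)
  note z = ml_random_bounds[OF ml] and z_nondyadic = ml_random_not_dyadic[OF ml]
  have lsc: "lower_semicomputable f" and int: "(\<integral>\<^sup>+x\<in>{0..1}. f x \<partial>lborel) < \<infinity>"
    using assms(2) by (auto simp: integral_test_def)
  obtain h where "cell_approximation h"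
    and F: "\<And>x. 0 \<le> x \<Longrightarrow> x < 1 \<Longrightarrow> cell_approximation.limit h x = f x"
    and F0: "\<And>x. \<not> (0 \<le> x \<and> x < 1) \<Longrightarrow> cell_approximation.limit h x = 0"
    using lower_semicomputable_approximation[OF lsc] by blast
  interpret cell_approximation h by fact
  have int_F: "(\<integral>\<^sup>+x. limit x \<partial>lborel) < \<infinity>"
  proof (rule order_le_less_trans[OF _ int], rule nn_integral_mono)
    show "limit x \<le> f x * indicator {0..1} x" for x
      using F[of x] F0[of x] by (cases "0 \<le> x \<and> x < 1") auto
  qed
  then have "5 * (\<integral>\<^sup>+x. limit x \<partial>lborel) < top"
    by (simp add: ennreal_mult_less_top)
  \<comment> \<open>\<open>K\<close> absorbs the factor \<open>5\<close> and the integral, so that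
    the heavy set at level \<open>K * 2 ^ m\<close> has measure at most
    \<open>(1 / 2) ^ m\<close>.\<close>
  then obtain K where K: "5 * (\<integral>\<^sup>+x. limit x \<partial>lborel) < of_nat K"
    using ennreal_Ex_less_of_nat by blast
  then have "K > 0" by (intro Nat.gr0I) auto
  have "ml_test (\<lambda>m. {0..1} \<inter> heavy_set (K * 2 ^ m))"
    unfolding ml_test_def
  proof (intro conjI allI)
    show "unif_eff_open (\<lambda>m. {0..1} \<inter> heavy_set (K * 2 ^ m))"
      by (intro unif_eff_open_heavy_set rec_intros)
    fix m
    let ?H = "{0..1} \<inter> heavy_set (K * 2 ^ m)"
    have H: "?H \<in> sets borel" "heavy_set (K * 2 ^ m) \<in> sets borel"
      using open_heavy_set by auto
    have "ennreal (real (K * 2 ^ m) * measure lborel ?H) = of_nat (K * 2 ^ m) * emeasure lborel ?H"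
      unfolding emeasure_eq_measure_unit_interval[OF H(1) Int_lower1] ennreal_of_nat_eq_real_of_nat
      by (rule ennreal_mult) auto
    also have "\<dots> \<le> of_nat (K * 2 ^ m) * emeasure lborel (heavy_set (K * 2 ^ m))"
      using H(2) by (intro mult_left_mono emeasure_mono) auto
    also have "\<dots> \<le> 5 * (\<integral>\<^sup>+x. limit x \<partial>lborel)"
      using \<open>K > 0\<close> by (intro emeasure_heavy_set_le int_F) simp
    also have "\<dots> \<le> ennreal (real K)"
      using K by (simp add: ennreal_of_nat_eq_real_of_nat)
    finally have "real (K * 2 ^ m) * measure lborel ?H \<le> real K"
      by (simp add: ennreal_le_iff)
    then have "2 ^ m * measure lborel ?H \<le> 1"
      using \<open>K > 0\<close> by (simp add: mult.assoc)
    then show "measure lborel ?H \<le> (1 / 2) ^ m"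
      by (simp add: power_divide field_simps)
  qed
  then have "z \<notin> (\<Inter>m. {0..1} \<inter> heavy_set (K * 2 ^ m))"
    using ml unfolding ml_random_def by blast
  then obtain m where "z \<notin> {0..1} \<inter> heavy_set (K * 2 ^ m)" by blast
  define L where "L = K * 2 ^ m"
  have zL: "z \<notin> heavy_set L"
    using \<open>z \<notin> {0..1} \<inter> heavy_set (K * 2 ^ m)\<close> z by (simp add: L_def)
  have "f z \<le> of_nat L"
    using limit_le[OF zL z(1) z_nondyadic] F[of z] z by simp
  then have fz: "f z < \<infinity>"
    using of_nat_less_top[of L] by (metis infinity_ennreal_def order_le_less_trans)
  then obtain v where v: "f z = ennreal v" "0 \<le> v"
    by (metis ennreal_cases infinity_ennreal_def less_irrefl)
  have bound: "(\<integral>\<^sup>+x\<in>Q. f x \<partial>lborel) \<le> ennreal (q * measure lborel Q + L * measure lborel (Q \<inter> (heavy_set L \<union> V)))"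
    if Q: "is_interval Q" "Q \<subseteq> {0..1}" "z \<in> Q" and V: "V \<in> sets borel"
      and q: "0 \<le> q" "\<And>x. x \<in> {0..1} \<Longrightarrow> x \<notin> V \<Longrightarrow> f x \<le> ennreal q" for Q V q
  proof -
    have [measurable]: "Q \<in> sets borel" "V \<in> sets borel" "heavy_set L \<in> sets borel"
      using real_interval_borel_measurable[OF Q(1)] V open_heavy_set by auto
    \<comment> \<open>On \<open>?A\<close> the end points of components give the average
      \<open>L\<close>; on \<open>?B\<close> almost every value is at most \<open>L\<close>, outside
      the heavy set; on \<open>?C\<close> values are at most \<open>q\<close>. Overlaps are harmless
      for an upper bound.\<close>
    let ?A = "Q \<inter> heavy_set L" and ?B = "Q \<inter> (V - heavy_set L)" and ?C = "Q - V"
    have "(\<integral>\<^sup>+x\<in>Q. f x \<partial>lborel) = (\<integral>\<^sup>+x\<in>Q. limit x \<partial>lborel)"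
    proof (rule nn_integral_cong_AE)
      show "AE x in lborel. f x * indicator Q x = limit x * indicator Q x"
        using AE_lborel_singleton[of "1 :: real"]
      proof eventually_elim
        case (elim x)
        then show ?case using Q(2) F[of x] by (cases "x \<in> Q") auto
      qed
    qed
    also have "\<dots> \<le> (\<integral>\<^sup>+x. limit x * indicator ?A x + limit x * indicator ?B x + limit x * indicator ?C x \<partial>lborel)"
      by (intro nn_integral_mono) (auto split: split_indicator)
    also have "\<dots> = (\<integral>\<^sup>+x\<in>?A. limit x \<partial>lborel) + (\<integral>\<^sup>+x\<in>?B. limit x \<partial>lborel) + (\<integral>\<^sup>+x\<in>?C. limit x \<partial>lborel)"
      by (simp add: nn_integral_add)
    also have "\<dots> \<le> ennreal L * emeasure lborel ?A + ennreal L * emeasure lborel ?B + ennreal q * emeasure lborel Q"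
    proof (intro add_mono)
      show "(\<integral>\<^sup>+x\<in>?A. limit x \<partial>lborel) \<le> ennreal L * emeasure lborel ?A"
        by (rule nn_integral_open_inter_interval_le[OF limit_measurable open_heavy_set Q zL z])
          (auto intro: nn_integral_limit_le)
      have "(\<integral>\<^sup>+x\<in>?B. limit x \<partial>lborel) \<le> (\<integral>\<^sup>+x. ennreal L * indicator ?B x \<partial>lborel)"
      proof (rule nn_integral_mono_AE)
        show "AE x in lborel. limit x * indicator ?B x \<le> ennreal L * indicator ?B x"
          using AE_not_dyadic
        proof eventually_elim
          case (elim x)
          have "limit x \<le> ennreal L" if "x \<in> ?B"
          proof -
            have "x \<noteq> 0" using elim[rule_format, of 0 0] by simp
            then have "0 < x" using that Q(2) by (force simp: less_le)
            then show ?thesis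
              using limit_le[of x L] that elim by (auto simp: ennreal_of_nat_eq_real_of_nat)
          qed
          then show ?case by (auto split: split_indicator)
        qed
      qed
      then show "(\<integral>\<^sup>+x\<in>?B. limit x \<partial>lborel) \<le> ennreal L * emeasure lborel ?B"
        by (simp add: nn_integral_cmult_indicator)
      have "(\<integral>\<^sup>+x\<in>?C. limit x \<partial>lborel) \<le> (\<integral>\<^sup>+x. ennreal q * indicator Q x \<partial>lborel)"
      proof (rule nn_integral_mono)
        fix x :: real
        have "limit x \<le> ennreal q" if "x \<in> ?C"
          using that q(2)[of x] Q(2) F[of x] F0[of x] by (cases "0 \<le> x \<and> x < 1") auto
        then show "limit x * indicator ?C x \<le> ennreal q * indicator Q x"
          by (auto split: split_indicator)
      qed
      then show "(\<integral>\<^sup>+x\<in>?C. limit x \<partial>lborel) \<le> ennreal q * emeasure lborel Q"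
        by (simp add: nn_integral_cmult_indicator)
    qed
    also have "ennreal L * emeasure lborel ?A + ennreal L * emeasure lborel ?B =
        ennreal L * emeasure lborel (Q \<inter> (heavy_set L \<union> V))"
    proof -
      have "emeasure lborel ?A + emeasure lborel ?B = emeasure lborel (?A \<union> ?B)"
        by (rule plus_emeasure) auto
      moreover have "?A \<union> ?B = Q \<inter> (heavy_set L \<union> V)" by blast
      ultimately show ?thesis by (simp add: distrib_left[symmetric])
    qed
    also have "\<dots> + ennreal q * emeasure lborel Q =
        ennreal (q * measure lborel Q + L * measure lborel (Q \<inter> (heavy_set L \<union> V)))"
    proof -
      have "Q \<inter> (heavy_set L \<union> V) \<subseteq> {0..1}" using Q(2) by blast
      then show ?thesis using q(1) Q(2)
        by (simp add: emeasure_eq_measure_unit_interval ennreal_mult[symmetric] add.commute)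
    qed
    finally show ?thesis .
  qed
  have upper: "\<forall>\<^sub>F Q in shrinking_intervals z. (\<integral>\<^sup>+x\<in>Q. f x \<partial>lborel) / emeasure lborel Q < a"
    if a: "f z < a" for a
  proof -
    obtain b where b: "0 \<le> b" "f z < ennreal b" "ennreal b < a"
      using ennreal_dense_real[OF a] by blast
    then have "v < b" using v by (simp add: ennreal_less_iff)
    then obtain q where q: "q \<in> \<rat>" "v < q" "q < b" using Rats_dense_in_real by blast
    obtain r where r: "rat_code r = q" using rat_code_surj[OF q(1)] by blast
    have "0 \<le> q" using q(2) v(2) by simp
    define V where "V = {x \<in> {0..1}. ereal (rat_code r) < enn2ereal (f x)}"
    have V_iff: "x \<in> V \<longleftrightarrow> x \<in> {0..1} \<and> ennreal q < f x" for x
      using \<open>0 \<le> q\<close> by (simp add: V_def r less_ennreal.rep_eq enn2ereal_ennreal)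
    have V: "eff_open V" unfolding V_def by (rule eff_open_superlevel[OF lsc])
    \<comment> \<open>\<open>W\<close> misses \<open>z\<close> because \<open>f z < q\<close>, and
      it contains all parts of the unit interval where only the bound by \<open>L\<close> is
      available; density is applied to its complement.\<close>
    define W where "W = ({0..1} \<inter> heavy_set L) \<union> V"
    have "eff_open ({0..1} \<inter> heavy_set L)"
      using unif_eff_open_eff_open[OF unif_eff_open_heavy_set[of "\<lambda>_. L"]] recursive_const[of L] by simp
    then have W: "eff_open W" unfolding W_def using V by (rule eff_open_Un)
    have W_sub: "W \<subseteq> {0..1}" by (auto simp: W_def V_def)
    have "z \<notin> W" using zL q(2) v by (auto simp: W_def V_iff ennreal_less_iff)
    have "{0..1} - ({0..1} - W) = W" using W_sub by blast
    then have "eff_closed ({0..1} - W)" using W by (simp add: eff_closed_def)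
    then have "lower_density ({0..1} - W) z = 1"
      using assms(1) \<open>z \<notin> W\<close> z by (auto simp: density_random_def)
    \<comment> \<open>The symmetric interval has length \<open>2 * ?m\<close>, so the contribution
      of \<open>W\<close> is at most \<open>2 * L * \<epsilon> * ?m\<close>, which this choice keeps
      within \<open>(b - q) * ?m\<close>.\<close>
    moreover define \<epsilon> where "\<epsilon> = (b - q) / (2 * real L + 1)"
    have "0 < \<epsilon>" using q(3) by (simp add: \<epsilon>_def add_nonneg_pos)
    ultimately obtain d where d: "d > 0" "\<And>\<gamma> \<delta>. 0 < \<gamma> \<Longrightarrow> \<gamma> < d \<Longrightarrow> 0 < \<delta> \<Longrightarrow> \<delta> < d \<Longrightarrow>
        measure lborel ({z - \<gamma>..z + \<delta>} \<inter> W) \<le> \<epsilon> * (\<gamma> + \<delta>)"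
      using lower_density_eq_1_iff[OF z eff_open_borel[OF W] W_sub] by blast
    show ?thesis
    proof (rule eventually_shrinking_intervals[OF d(1)])
      fix Q assume Q: "is_interval Q" "Q \<subseteq> {0..1}" "z \<in> Q" "0 < measure lborel Q" "measure lborel Q < d"
      let ?m = "measure lborel Q"
      have Q_borel: "Q \<in> sets borel" using real_interval_borel_measurable[OF Q(1)] .
      have "Q \<inter> (heavy_set L \<union> V) \<subseteq> {z - ?m..z + ?m} \<inter> W"
        using interval_subset_measure[OF Q(1-3)] Q(2) by (auto simp: W_def)
      then have "measure lborel (Q \<inter> (heavy_set L \<union> V)) \<le> measure lborel ({z - ?m..z + ?m} \<inter> W)"
        using Q_borel eff_open_borel[OF V] eff_open_borel[OF W] open_heavy_set[of L]
        by (intro measure_mono_fmeasurable fmeasurableI2[OF fmeasurable_Icc]) auto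
      also have "\<dots> \<le> \<epsilon> * (?m + ?m)" using d(2) Q(4,5) by blast
      finally have "L * measure lborel (Q \<inter> (heavy_set L \<union> V)) \<le> L * (\<epsilon> * (?m + ?m))"
        by (intro mult_left_mono) auto
      also have "\<dots> = (2 * real L * \<epsilon>) * ?m" by simp
      also have "\<dots> \<le> (b - q) * ?m"
      proof (rule mult_right_mono)
        have "2 * real L * \<epsilon> \<le> (2 * real L + 1) * \<epsilon>" using \<open>0 < \<epsilon>\<close> by (intro mult_right_mono) auto
        also have "\<dots> = b - q" by (simp add: \<epsilon>_def add_nonneg_eq_0_iff)
        finally show "2 * real L * \<epsilon> \<le> b - q" .
      qed simp
      finally have "q * ?m + L * measure lborel (Q \<inter> (heavy_set L \<union> V)) \<le> b * ?m"
        by (simp add: algebra_simps)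
      then have "(\<integral>\<^sup>+x\<in>Q. f x \<partial>lborel) \<le> ennreal (b * ?m)"
        using bound[OF Q(1-3) eff_open_borel[OF V] \<open>0 \<le> q\<close>] V_iff
        by (meson ennreal_leI not_less order_trans)
      then have "(\<integral>\<^sup>+x\<in>Q. f x \<partial>lborel) / emeasure lborel Q \<le> ennreal (b * ?m) / ennreal ?m"
        unfolding emeasure_eq_measure_unit_interval[OF Q_borel Q(2)] by (rule divide_right_mono_ennreal)
      also have "\<dots> = ennreal b" using Q(4) b(1) by (simp add: divide_ennreal)
      also have "\<dots> < a" by fact
      finally show "(\<integral>\<^sup>+x\<in>Q. f x \<partial>lborel) / emeasure lborel Q < a" .
    qed
  qed
  \<comment> \<open>Lower semicontinuity suffices here: \<open>f\<close> stays above
    \<open>q\<close> on a whole neighbourhood of \<open>z\<close> in the unit interval.\<close>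
  have lower: "\<forall>\<^sub>F Q in shrinking_intervals z. a < (\<integral>\<^sup>+x\<in>Q. f x \<partial>lborel) / emeasure lborel Q"
    if a: "a < f z" for a
  proof -
    obtain a' where a': "a = ennreal a'" "0 \<le> a'"
      using a fz by (metis ennreal_cases infinity_ennreal_def not_less_iff_gr_or_eq order_less_trans)
    then have "a' < v" using a v by (simp add: ennreal_less_iff)
    then obtain q where q: "q \<in> \<rat>" "a' < q" "q < v" using Rats_dense_in_real by blast
    obtain r where r: "rat_code r = q" using rat_code_surj[OF q(1)] by blast
    have "0 \<le> q" using q(2) a'(2) by simp
    define V where "V = {x \<in> {0..1}. ereal (rat_code r) < enn2ereal (f x)}"
    have V_iff: "x \<in> V \<longleftrightarrow> x \<in> {0..1} \<and> ennreal q < f x" for x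
      using \<open>0 \<le> q\<close> by (simp add: V_def r less_ennreal.rep_eq enn2ereal_ennreal)
    have "eff_open V" unfolding V_def by (rule eff_open_superlevel[OF lsc])
    then obtain W where W: "open W" "V = {0..1} \<inter> W" by (rule eff_open_openE)
    have "z \<in> V" using z q(3) v \<open>0 \<le> q\<close> by (simp add: V_iff ennreal_less_iff)
    then obtain d where d: "0 < d" "ball z d \<subseteq> W" using W open_contains_ball by blast
    show ?thesis
    proof (rule eventually_shrinking_intervals[OF d(1)])
      fix Q assume Q: "is_interval Q" "Q \<subseteq> {0..1}" "z \<in> Q" "0 < measure lborel Q" "measure lborel Q < d"
      let ?m = "measure lborel Q"
      have Q_borel: "Q \<in> sets borel" using real_interval_borel_measurable[OF Q(1)] .
      have "Q \<subseteq> ball z d"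
        using interval_subset_measure[OF Q(1-3)] Q(5) by (force simp: dist_real_def)
      then have "Q \<subseteq> V" using d(2) W(2) Q(2) by blast
      have "ennreal (q * ?m) = (\<integral>\<^sup>+x. ennreal q * indicator Q x \<partial>lborel)"
        using Q_borel \<open>0 \<le> q\<close> by (simp add: nn_integral_cmult_indicator emeasure_eq_measure_unit_interval[OF Q_borel Q(2)] ennreal_mult)
      also have "\<dots> \<le> (\<integral>\<^sup>+x\<in>Q. f x \<partial>lborel)"
        using \<open>Q \<subseteq> V\<close> V_iff by (intro nn_integral_mono) (auto split: split_indicator intro: less_imp_le)
      finally have "ennreal (q * ?m) / ennreal ?m \<le> (\<integral>\<^sup>+x\<in>Q. f x \<partial>lborel) / emeasure lborel Q"
        unfolding emeasure_eq_measure_unit_interval[OF Q_borel Q(2)] by (rule divide_right_mono_ennreal)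
      moreover have "ennreal (q * ?m) / ennreal ?m = ennreal q"
        using Q(4) \<open>0 \<le> q\<close> by (simp add: divide_ennreal)
      moreover have "a < ennreal q" using q(2) a' by (simp add: ennreal_less_iff)
      ultimately show "a < (\<integral>\<^sup>+x\<in>Q. f x \<partial>lborel) / emeasure lborel Q" by simp
    qed
  qed
  show ?thesis
    unfolding lebesgue_point_def using fz upper lower by (auto intro: order_tendstoI)
qed

section \<open>Dyadic Lebesgue points are density random\<close>

lemma dyadic_lebesgue_point_indicator:
  assumes "dyadic_lebesgue_point (indicator V) z" "z \<notin> V" "V \<in> sets borel" "0 \<le> z" "z < 1" "0 < \<epsilon>"
  shows "\<forall>\<^sub>F n in sequentially. measure lborel (V \<inter> cell n (idx n z)) < \<epsilon> / 2 ^ n"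
proof -
  \<comment> \<open>Parities of the indices are the digits of the expansion whose partial sums are
    the left ends of the cells around \<open>z\<close>; its dyadic intervals are the closures of
    these cells.\<close>
  define Z where "Z i = odd (idx (Suc i) z)" for i
  have partial: "(\<Sum>i<n. of_bool (Z i) / 2 ^ Suc i) = real (idx n z) / 2 ^ n" for n
  proof (induction n)
    case 0
    then show ?case using idx_less[OF assms(4,5), of 0] by simp
  next
    case (Suc n)
    have "idx (Suc n) z = 2 * idx n z + of_bool (Z n)"
      unfolding Z_def idx_Suc_div[OF assms(4), of n, symmetric]
      by (cases "odd (idx (Suc n) z)") auto
    then have "real (idx (Suc n) z) = 2 * real (idx n z) + of_bool (Z n)" by simp
    with Suc show ?case by (simp add: add_divide_distrib)
  qed
  have lim: "(\<lambda>n. real (idx n z) / 2 ^ n) \<longlonglongrightarrow> z"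
  proof (rule tendsto_sandwich)
    have "(\<lambda>n. z - (1 / 2) ^ n) \<longlonglongrightarrow> z - 0"
      by (intro tendsto_diff tendsto_const LIMSEQ_power_zero) simp
    then show "(\<lambda>n. z - (1 / 2) ^ n) \<longlonglongrightarrow> z" by simp
    have "z - (1 / 2) ^ n \<le> real (idx n z) / 2 ^ n" for n
      using idx_bounds(4)[OF assms(4), of n] by (simp add: power_divide add_divide_distrib)
    then show "\<forall>\<^sub>F n in sequentially. z - (1 / 2) ^ n \<le> real (idx n z) / 2 ^ n" by simp
  qed (use idx_bounds(3)[OF assms(4)] in auto)
  then have "binary_expansion z Z"
    unfolding binary_expansion_def sums_def partial .
  then have "(\<lambda>n. 2 ^ n * (\<integral>\<^sup>+x\<in>dyadic_interval Z n. indicator V x \<partial>lborel)) \<longlonglongrightarrow> 0"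
    using assms(1,2) by (auto simp: dyadic_lebesgue_point_def)
  then have "\<forall>\<^sub>F n in sequentially. 2 ^ n * (\<integral>\<^sup>+x\<in>dyadic_interval Z n. indicator V x \<partial>lborel) < ennreal \<epsilon>"
    using assms(6) by (intro order_tendstoD) auto
  then show ?thesis
  proof eventually_elim
    case (elim n)
    have D: "dyadic_interval Z n = {real (idx n z) / 2 ^ n..real (idx n z) / 2 ^ n + 1 / 2 ^ n}"
      unfolding dyadic_interval_def partial Let_def ..
    have "cell n (idx n z) \<subseteq> dyadic_interval Z n"
      unfolding D cell_def by (auto simp: add_divide_distrib)
    have "ennreal (2 ^ n * measure lborel (V \<inter> cell n (idx n z))) = 2 ^ n * emeasure lborel (V \<inter> cell n (idx n z))"
    proof -
      have "V \<inter> cell n (idx n z) \<in> fmeasurable lborel"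
        unfolding cell_def using assms(3)
        by (intro fmeasurableI2[OF fmeasurable_Icc[of "real (idx n z) / 2 ^ n" "real (Suc (idx n z)) / 2 ^ n"]]) auto
      then show ?thesis
        by (simp add: emeasure_eq_measure2 ennreal_mult ennreal_power[symmetric])
    qed
    also have "\<dots> \<le> 2 ^ n * (\<integral>\<^sup>+x. indicator (V \<inter> cell n (idx n z)) x \<partial>lborel)"
      using assms(3) by (subst nn_integral_indicator) (auto simp: cell_def)
    also have "\<dots> \<le> 2 ^ n * (\<integral>\<^sup>+x\<in>dyadic_interval Z n. indicator V x \<partial>lborel)"
      using \<open>cell n (idx n z) \<subseteq> dyadic_interval Z n\<close>
      by (intro mult_left_mono nn_integral_mono) (auto split: split_indicator)
    also note elim
    finally show ?case by (simp add: ennreal_less_iff field_simps)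
  qed
qed

section \<open>Enumeration of chains\<close>

text \<open>A number is read as a stack of vertices. The state holds a flag, the current vertex and
  the remaining stack; each step pops a vertex, and the flag stays \<open>1\<close> only along
  edges. Paths of length \<open>m\<close> thus become witnesses of a decidable relation.\<close>

lemma relpow_enumerable:
  assumes "decidable2 E"
  obtains P g k where "decidable P" "recursive g" "recursive k"
    "\<And>m J. (J0, J) \<in> {(J, K). E J K} ^^ m \<longleftrightarrow> (\<exists>x. P x \<and> g x = m \<and> k x = J)"
proof -
  define chain where "chain m e = rec_nat (prod_encode (1, prod_encode (J0, e)))
      (\<lambda>_ r. prod_encode
        (fst (prod_decode r) * of_bool (E (fst (prod_decode (snd (prod_decode r))))
            (fst (prod_decode (snd (prod_decode (snd (prod_decode r))))))),
         snd (prod_decode (snd (prod_decode r))))) m" for m e :: nat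
  \<comment> \<open>The remainder \<open>e'\<close> is arbitrary, since the next vertex is popped
    from it in the induction step.\<close>
  have chain: "(\<exists>e. chain m e = prod_encode (1, prod_encode (J, e'))) \<longleftrightarrow> (J0, J) \<in> {(J, K). E J K} ^^ m"
    for m J e'
  proof (induction m arbitrary: J e')
    case 0
    show ?case by (auto simp: chain_def)
  next
    case (Suc m)
    have "(\<exists>e. chain (Suc m) e = prod_encode (1, prod_encode (J, e'))) \<longleftrightarrow>
        (\<exists>I e. chain m e = prod_encode (1, prod_encode (I, prod_encode (J, e'))) \<and> E I J)"
    proof (intro iffI; elim exE)
      fix e assume e: "chain (Suc m) e = prod_encode (1, prod_encode (J, e'))"
      obtain c I p where c: "chain m e = prod_encode (c, prod_encode (I, p))"
        by (metis prod_decode_inverse surj_pair)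
      then have "chain (Suc m) e = prod_encode (c * of_bool (E I (fst (prod_decode p))), p)"
        by (simp add: chain_def)
      then have "prod_encode (c * of_bool (E I (fst (prod_decode p))), p) = prod_encode (1, prod_encode (J, e'))"
        using e by (rule trans[OF sym])
      then have *: "c * of_bool (E I (fst (prod_decode p))) = 1 \<and> p = prod_encode (J, e')"
        by (rule iffD1[OF prod.inject, OF iffD1[OF prod_encode_eq]])
      have "E I (fst (prod_decode p))"
        by (rule ccontr) (use conjunct1[OF *] in simp)
      with * have "c = 1" "E I J" "p = prod_encode (J, e')" by simp_all
      then show "\<exists>I e. chain m e = prod_encode (1, prod_encode (I, prod_encode (J, e'))) \<and> E I J"
        using c by blast
    next
      fix I e assume "chain m e = prod_encode (1, prod_encode (I, prod_encode (J, e'))) \<and> E I J"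
      then have "chain (Suc m) e = prod_encode (1, prod_encode (J, e'))"
        by (simp add: chain_def)
      then show "\<exists>e. chain (Suc m) e = prod_encode (1, prod_encode (J, e'))" ..
    qed
    also have "\<dots> \<longleftrightarrow> (\<exists>I. (J0, I) \<in> {(J, K). E J K} ^^ m \<and> E I J)"
      using Suc by blast
    also have "\<dots> \<longleftrightarrow> (J0, J) \<in> {(J, K). E J K} ^^ Suc m"
      by auto
    finally show ?case .
  qed
  let ?c = "\<lambda>x. chain (fst (prod_decode x)) (snd (prod_decode x))"
  have rec: "recursive ?c"
    unfolding chain_def
    by (intro recursive_rec_nat rec_intros recursive2_comp[OF assms])
  show ?thesis
  proof (rule that)
    show "decidable (\<lambda>x. fst (prod_decode (?c x)) = 1)"
      by (intro rec_intros rec)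
    show "recursive (\<lambda>x. fst (prod_decode x))" by (intro rec_intros)
    show "recursive (\<lambda>x. fst (prod_decode (snd (prod_decode (?c x)))))"
      by (intro rec_intros rec)
    fix m J
    have "(J0, J) \<in> {(J, K). E J K} ^^ m \<longleftrightarrow> (\<exists>e e'. chain m e = prod_encode (1, prod_encode (J, e')))"
      using chain by blast
    also have "\<dots> \<longleftrightarrow> (\<exists>e. fst (prod_decode (chain m e)) = 1 \<and> fst (prod_decode (snd (prod_decode (chain m e)))) = J)"
    proof (intro iff_exI iffI; elim exE conjE)
      fix e assume "fst (prod_decode (chain m e)) = 1" "fst (prod_decode (snd (prod_decode (chain m e)))) = J"
      then have "chain m e = prod_encode (1, prod_encode (J, snd (prod_decode (snd (prod_decode (chain m e))))))"
        by (metis prod.collapse prod_decode_inverse)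
      then show "\<exists>e'. chain m e = prod_encode (1, prod_encode (J, e'))" ..
    qed simp
    also have "\<dots> \<longleftrightarrow> (\<exists>x. fst (prod_decode (?c x)) = 1 \<and> fst (prod_decode x) = m \<and>
        fst (prod_decode (snd (prod_decode (?c x)))) = J)" (is "_ \<longleftrightarrow> (\<exists>x. ?R x)")
    proof (intro iffI; elim exE)
      fix e assume "fst (prod_decode (chain m e)) = 1 \<and> fst (prod_decode (snd (prod_decode (chain m e)))) = J"
      then have "?R (prod_encode (m, e))" by simp
      then show "\<exists>x. ?R x" ..
    qed blast
    finally show "(J0, J) \<in> {(J, K). E J K} ^^ m \<longleftrightarrow> (\<exists>x. ?R x)" .
  qed
qed

section \<open>Marked cells and their generations\<close>

lemma cell_eq_union:
  assumes "t \<le> s"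
  shows "cell t a = {real (a * 2 ^ (s - t)) / 2 ^ s..<real (a * 2 ^ (s - t) + 2 ^ (s - t)) / 2 ^ s}"
proof -
  have "(2 :: real) ^ s = 2 ^ (s - t) * 2 ^ t" using assms by (simp add: power_add[symmetric])
  then have "real (k * 2 ^ (s - t)) / 2 ^ s = real k / 2 ^ t" for k
    by simp
  from this[of a] this[of "Suc a"] show ?thesis
    unfolding cell_def by (simp add: add.commute)
qed

lemma cell_borel [measurable]: "cell s i \<in> sets borel"
  by (simp add: cell_def)

lemma measure_cell: "measure lborel (cell s i) = 1 / 2 ^ s" "emeasure lborel (cell s i) = ennreal (1 / 2 ^ s)"
  by (simp_all add: cell_def divide_right_mono diff_divide_distrib[symmetric])

lemma fmeasurable_cell: "A \<in> sets borel \<Longrightarrow> A \<inter> cell s i \<in> fmeasurable lborel"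
  by (rule fmeasurableI2[of "cell s i"]) (auto simp: fmeasurable_def measure_cell)

lemma fmeasurable_cell': "A \<in> sets borel \<Longrightarrow> A \<subseteq> cell s i \<Longrightarrow> A \<in> fmeasurable lborel"
  using fmeasurable_cell[of A s i] by (simp add: Int_absorb2)

text \<open>The union is the increasing limit of its finite parts, so a bound for all finite sums of
  weights is enough.\<close>

lemma emeasure_UN_nat_le:
  fixes X :: "nat \<Rightarrow> real set"
  assumes [measurable]: "\<And>k. X k \<in> sets borel"
    and "\<And>k. emeasure lborel (X k) \<le> ennreal (w k)" "\<And>k. 0 \<le> w k"
    and fin: "\<And>A. finite A \<Longrightarrow> A \<subseteq> G \<Longrightarrow> sum w A \<le> c"
  shows "emeasure lborel (\<Union>k\<in>G. X k) \<le> ennreal c"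
proof -
  define Y where "Y n = (\<Union>k\<in>G \<inter> {..<n}. X k)" for n
  have eq: "(\<Union>k\<in>G. X k) = (\<Union>n. Y n)" by (auto simp: Y_def)
  have inc: "incseq Y"
    unfolding incseq_def Y_def by (intro allI impI UN_mono) auto
  have "emeasure lborel (Y n) \<le> ennreal c" for n
  proof -
    have "emeasure lborel (Y n) \<le> (\<Sum>k\<in>G \<inter> {..<n}. emeasure lborel (X k))"
      unfolding Y_def by (rule emeasure_subadditive_finite) auto
    also have "\<dots> \<le> (\<Sum>k\<in>G \<inter> {..<n}. ennreal (w k))"
      by (intro sum_mono assms(2))
    also have "\<dots> = ennreal (sum w (G \<inter> {..<n}))"
      by (simp add: sum_ennreal assms(3))
    also have "\<dots> \<le> ennreal c"
      by (intro ennreal_leI fin) auto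
    finally show ?thesis .
  qed
  moreover have "range Y \<subseteq> sets lborel" by (auto simp: Y_def)
  ultimately show ?thesis
    unfolding eq using SUP_emeasure_incseq[OF _ inc, of lborel] by (metis SUP_least)
qed

locale cell_set =
  fixes u :: "nat \<Rightarrow> nat \<Rightarrow> bool" and D :: nat
  assumes dec_u: "decidable2 u" and u_Suc: "u s i \<Longrightarrow> i' div 2 = i \<Longrightarrow> u (Suc s) i'"
    and D_pos: "0 < D"
begin

definition stage :: "nat \<Rightarrow> real set" where
  "stage s = {x. 0 \<le> x \<and> u s (idx s x)}"

definition count :: "nat \<Rightarrow> nat \<Rightarrow> nat \<Rightarrow> nat" where
  "count s t a = (\<Sum>l<2 ^ (s - t). of_bool (u s (a * 2 ^ (s - t) + l)))"

text \<open>The bound \<open>b<a + 2\<close> keeps the search finite, \<open>j\<close> keeps the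
  neighbour within the cell \<open>(n, j)\<close>, and the last inequality says that the
  stage-\<open>s\<close> set fills more than a fraction \<open>1 / D\<close> of it.\<close>

definition dense_neighbour :: "nat \<Rightarrow> nat \<Rightarrow> nat \<Rightarrow> nat \<Rightarrow> nat \<Rightarrow> bool" where
  "dense_neighbour n j s t a \<longleftrightarrow> (\<exists>b<a + 2. (b = a + 1 \<or> a = b + 1) \<and> b div 2 ^ (t - n) = j \<and>
     2 ^ (s - t) < D * count s t b)"

text \<open>The level-\<open>s\<close> subcell \<open>i\<close> of the cell \<open>(n, j)\<close> is marked if it lies in the left half of a cell
  which, within \<open>(n, j)\<close>, is adjacent to a cell of the same size where the set has density above
  \<open>1 / D\<close> by stage \<open>s\<close>.\<close>

definition marked :: "nat \<Rightarrow> nat \<Rightarrow> nat \<Rightarrow> nat \<Rightarrow> bool" where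
  "marked n j s i \<longleftrightarrow> (\<exists>t<s. n \<le> t \<and> (i div 2 ^ (s - t)) div 2 ^ (t - n) = j \<and>
     even (i div 2 ^ (s - Suc t)) \<and> dense_neighbour n j s t (i div 2 ^ (s - t)))"

text \<open>The fraction is at most \<open>1 / (40 * D)\<close>, where
  \<open>40 = 5 * 4 * 2\<close>: \<open>5\<close> from the maximal inequality, \<open>4\<close> from
  blocks of four cells around a dense one, \<open>2\<close> so that marks take up at most half of
  the cell.\<close>

definition sparse :: "nat \<Rightarrow> nat \<Rightarrow> nat \<Rightarrow> bool" where
  "sparse n j s \<longleftrightarrow> 40 * D * count s n j \<le> 2 ^ (s - n)"

text \<open>The cells where a mark first appears. Sparsity is checked at the very stage of marking,
  so the bound on the marks holds in every cell, even where the set becomes dense later. By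
  \<open>n < s\<close> levels grow along chains.\<close>

definition newly_marked :: "nat \<Rightarrow> nat \<Rightarrow> nat \<Rightarrow> nat \<Rightarrow> bool" where
  "newly_marked n j s i \<longleftrightarrow> n < s \<and> marked n j s i \<and> \<not> marked n j (s - 1) (i div 2) \<and> sparse n j s"

lemma recursive_count [rec_intros]:
  "recursive s \<Longrightarrow> recursive t \<Longrightarrow> recursive a \<Longrightarrow> recursive (\<lambda>x. count (s x) (t x) (a x))"
  unfolding count_def
  by (intro rec_intros recursive2_comp[OF dec_u] | erule recursive_comp)+

lemma decidable_dense_neighbour [rec_intros]:
  "recursive n \<Longrightarrow> recursive j \<Longrightarrow> recursive s \<Longrightarrow> recursive t \<Longrightarrow> recursive a \<Longrightarrow>
    decidable (\<lambda>x. dense_neighbour (n x) (j x) (s x) (t x) (a x))"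
  unfolding dense_neighbour_def by (intro rec_intros | erule recursive_comp)+

lemma decidable_marked [rec_intros]:
  "recursive n \<Longrightarrow> recursive j \<Longrightarrow> recursive s \<Longrightarrow> recursive i \<Longrightarrow>
    decidable (\<lambda>x. marked (n x) (j x) (s x) (i x))"
  unfolding marked_def by (intro rec_intros | erule recursive_comp)+

lemma decidable_newly_marked [rec_intros]:
  "recursive n \<Longrightarrow> recursive j \<Longrightarrow> recursive s \<Longrightarrow> recursive i \<Longrightarrow>
    decidable (\<lambda>x. newly_marked (n x) (j x) (s x) (i x))"
  unfolding newly_marked_def sparse_def by (intro rec_intros)

lemma stage_borel [measurable]: "stage s \<in> sets borel"
proof -
  have "{x \<in> space borel. 0 \<le> x \<and> u s (idx s x)} \<in> sets borel" by measurable
  then show ?thesis by (simp add: stage_def)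
qed

lemma incseq_stage: "incseq stage"
  by (rule incseq_SucI) (auto simp: stage_def intro: u_Suc idx_Suc_div)

lemma emeasure_stage:
  assumes "t \<le> s"
  shows "emeasure lborel (stage s \<inter> cell t a) = ennreal (real (count s t a) / 2 ^ s)"
proof -
  have "emeasure lborel (stage s \<inter> cell t a) = (\<integral>\<^sup>+x. indicator (stage s \<inter> cell t a) x \<partial>lborel)"
    by (rule nn_integral_indicator[symmetric]) simp
  also have "\<dots> = (\<integral>\<^sup>+x\<in>cell t a. step s (\<lambda>i. of_bool (u s i)) x \<partial>lborel)"
    by (intro nn_integral_cong) (auto simp: stage_def step_def mem_cell_iff split: split_indicator)
  also have "\<dots> = ennreal ((\<Sum>l<2 ^ (s - t). of_bool (u s (a * 2 ^ (s - t) + l))) / 2 ^ s)"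
    unfolding cell_eq_union[OF assms] by (rule nn_integral_step) simp
  finally show ?thesis by (simp add: count_def)
qed

lemma measure_stage: "t \<le> s \<Longrightarrow> measure lborel (stage s \<inter> cell t a) = real (count s t a) / 2 ^ s"
  by (simp add: measure_def emeasure_stage)

lemma less_count_iff:
  assumes "t \<le> s"
  shows "2 ^ (s - t) < D * count s t b \<longleftrightarrow> 1 / (D * 2 ^ t) < measure lborel (stage s \<inter> cell t b)"
proof -
  have "(2 :: real) ^ s = 2 ^ (s - t) * 2 ^ t" using assms by (simp add: power_add[symmetric])
  then have "1 / (D * 2 ^ t) < measure lborel (stage s \<inter> cell t b) \<longleftrightarrow>
      real (2 ^ (s - t)) < real (D * count s t b)"
    using D_pos by (simp add: measure_stage[OF assms] field_simps)
  then show ?thesis by (simp only: of_nat_less_iff)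
qed

lemma sparse_iff:
  assumes "n \<le> s"
  shows "sparse n j s \<longleftrightarrow> measure lborel (stage s \<inter> cell n j) \<le> 1 / (40 * D * 2 ^ n)"
proof -
  have "(2 :: real) ^ s = 2 ^ (s - n) * 2 ^ n" using assms by (simp add: power_add[symmetric])
  then have "measure lborel (stage s \<inter> cell n j) \<le> 1 / (40 * D * 2 ^ n) \<longleftrightarrow>
      real (40 * D * count s n j) \<le> real (2 ^ (s - n))"
    using D_pos by (simp add: measure_stage[OF assms] field_simps)
  then show ?thesis unfolding sparse_def by (simp only: of_nat_le_iff)
qed

lemma measure_stage_mono: "s \<le> s' \<Longrightarrow> measure lborel (stage s \<inter> cell t b) \<le> measure lborel (stage s' \<inter> cell t b)"
  using incseq_stage by (intro measure_mono_fmeasurable fmeasurable_cell) (auto simp: incseq_def)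

lemma marked_Suc:
  assumes "marked n j s i" "i' div 2 = i"
  shows "marked n j (Suc s) i'"
proof -
  obtain t where t: "t < s" "n \<le> t" "(i div 2 ^ (s - t)) div 2 ^ (t - n) = j"
    "even (i div 2 ^ (s - Suc t))" "dense_neighbour n j s t (i div 2 ^ (s - t))"
    using assms(1) unfolding marked_def by blast
  have div: "i' div 2 ^ Suc k = i div 2 ^ k" for k
    using assms(2) by (simp add: div_mult2_eq)
  have "Suc s - t = Suc (s - t)" "Suc s - Suc t = Suc (s - Suc t)" using t(1) by auto
  then have eq: "i' div 2 ^ (Suc s - t) = i div 2 ^ (s - t)" "i' div 2 ^ (Suc s - Suc t) = i div 2 ^ (s - Suc t)"
    by (simp_all only: div)
  have "s - t = Suc (s - Suc t)" using t(1) by simp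
  then have eq': "i' div 2 ^ (s - t) = i div 2 ^ (s - Suc t)" by (simp only: div)
  have "2 ^ (Suc s - t) < D * count (Suc s) t b" if "2 ^ (s - t) < D * count s t b" for b
    using that measure_stage_mono[of s "Suc s" t b] t(1)
    by (simp add: less_count_iff)
  then have "dense_neighbour n j (Suc s) t (i div 2 ^ (s - t))"
    using t(5) unfolding dense_neighbour_def by blast
  with t show ?thesis
    unfolding marked_def by (intro exI[of _ t]) (simp add: eq eq')
qed

definition marked_set :: "nat \<Rightarrow> nat \<Rightarrow> nat \<Rightarrow> real set" where
  "marked_set n j s = {x. 0 \<le> x \<and> marked n j s (idx s x)}"

lemma marked_set_borel [measurable]: "marked_set n j s \<in> sets borel"
proof -
  have "{x \<in> space borel. 0 \<le> x \<and> marked n j s (idx s x)} \<in> sets borel" by measurable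
  then show ?thesis by (simp add: marked_set_def)
qed

lemma marked_set_mono: "s \<le> s' \<Longrightarrow> marked_set n j s \<subseteq> marked_set n j s'"
proof -
  have "incseq (marked_set n j)"
    by (rule incseq_SucI) (auto simp: marked_set_def intro: marked_Suc idx_Suc_div)
  then show "s \<le> s' \<Longrightarrow> ?thesis" by (auto simp: incseq_def)
qed

lemma idx_div_le: "0 \<le> x \<Longrightarrow> t \<le> s \<Longrightarrow> idx s x div 2 ^ (s - t) = idx t x"
  using idx_div[of x t "s - t"] by simp

lemma cell_subset: "n \<le> t \<Longrightarrow> b div 2 ^ (t - n) = j \<Longrightarrow> cell t b \<subseteq> cell n j"
  using cell_mono[of n "t - n" b] by simp

lemma marked_set_iff:
  assumes "0 \<le> x"
  shows "x \<in> marked_set n j s \<longleftrightarrow> (\<exists>t<s. n \<le> t \<and> idx n x = j \<and> even (idx (Suc t) x) \<and>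
    dense_neighbour n j s t (idx t x))"
proof -
  have *: "idx s x div 2 ^ (s - t) div 2 ^ (t - n) = idx n x" "idx s x div 2 ^ (s - t) = idx t x"
    "idx s x div 2 ^ (s - Suc t) = idx (Suc t) x" if "t < s" "n \<le> t" for t
    using that assms by (simp_all add: idx_div_le)
  show ?thesis
    unfolding marked_set_def marked_def using assms * by auto
qed

text \<open>A marked point lies next to a dense cell, in a block of four cells on which the set has
  average at least \<open>1 / (4 * D)\<close>. The maximal inequality at this threshold and sparsity
  give \<open>5 * 4 * D / (40 * D * 2 ^ n)\<close>.\<close>

lemma emeasure_marked_set_le:
  assumes "sparse n j s" "n \<le> s"
  shows "emeasure lborel (marked_set n j s) \<le> ennreal (1 / 2 * (1 / 2) ^ n)"
proof -
  \<comment> \<open>\<open>p\<close> is the left one of the dense cell and its neighbour; one more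
    cell on either side puts both into the open interval.\<close>
  define K where "K = {((real p - 1) / 2 ^ t, (real p + 3) / 2 ^ t) | p t b.
      (b = p \<or> b = Suc p) \<and> n \<le> t \<and> t \<le> s \<and> cell t b \<subseteq> cell n j \<and> 2 ^ (s - t) < D * count s t b}"
  have sub: "marked_set n j s \<subseteq> (\<Union>(a, b)\<in>K. {a<..<b})"
  proof
    fix x assume x: "x \<in> marked_set n j s"
    then have "0 \<le> x" by (simp add: marked_set_def)
    then obtain t where t: "t < s" "n \<le> t" "dense_neighbour n j s t (idx t x)"
      using x by (auto simp: marked_set_iff)
    then obtain b where b: "b = idx t x + 1 \<or> idx t x = b + 1" "b div 2 ^ (t - n) = j"
      "2 ^ (s - t) < D * count s t b"
      by (auto simp: dense_neighbour_def)
    define p where "p = min b (idx t x)"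
    have "b = p \<or> b = Suc p" "p \<le> idx t x" "idx t x \<le> Suc p" using b(1) by (auto simp: p_def)
    have "((real p - 1) / 2 ^ t, (real p + 3) / 2 ^ t) \<in> K"
      unfolding K_def
    proof (rule CollectI, rule exI[of _ p], rule exI[of _ t], rule exI[of _ b], intro conjI refl)
      show "b = p \<or> b = Suc p" "n \<le> t" "t \<le> s" "2 ^ (s - t) < D * count s t b"
        using \<open>b = p \<or> b = Suc p\<close> t b(3) by simp_all
      show "cell t b \<subseteq> cell n j" by (rule cell_subset[OF t(2) b(2)])
    qed
    moreover have "(real p - 1) / 2 ^ t < x" "x < (real p + 3) / 2 ^ t"
      using idx_bounds(1,2)[OF \<open>0 \<le> x\<close>, of t] \<open>p \<le> idx t x\<close> \<open>idx t x \<le> Suc p\<close>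
      by (simp_all add: field_simps)
    ultimately show "x \<in> (\<Union>(a, b)\<in>K. {a<..<b})" by (force)
  qed
  have Dpos: "0 < real D" using D_pos by simp
  have int: "(\<integral>\<^sup>+x. indicator (stage s \<inter> cell n j) x \<partial>lborel) = ennreal (measure lborel (stage s \<inter> cell n j))"
    by (simp add: emeasure_eq_measure2[OF fmeasurable_cell])
  have "ennreal (1 / (4 * D)) * emeasure lborel (\<Union>(a, b)\<in>K. {a<..<b}) \<le>
      5 * (\<integral>\<^sup>+x. indicator (stage s \<inter> cell n j) x \<partial>lborel)"
  proof (rule maximal_inequality)
    show "(\<integral>\<^sup>+x. indicator (stage s \<inter> cell n j) x \<partial>lborel) < \<infinity>" unfolding int by simp
    fix a b assume "(a, b) \<in> K"
    then obtain p t c where *: "a = (real p - 1) / 2 ^ t" "b = (real p + 3) / 2 ^ t" "c = p \<or> c = Suc p"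
      "n \<le> t" "t \<le> s" "cell t c \<subseteq> cell n j" "2 ^ (s - t) < D * count s t c"
      unfolding K_def by blast
    have "cell t c \<subseteq> {a<..<b}"
      using *(3) unfolding cell_def *(1,2) by (auto simp: field_simps)
    have "b - a = 4 / 2 ^ t" by (simp add: *(1,2) diff_divide_distrib[symmetric])
    then have "1 / (4 * D) * (b - a) = 1 / (D * 2 ^ t)" by simp
    also have "\<dots> \<le> measure lborel (stage s \<inter> cell t c)"
      using *(7) less_count_iff[OF *(5)] by simp
    finally have "ennreal (1 / (4 * D) * (b - a)) \<le> emeasure lborel (stage s \<inter> cell t c)"
      by (simp add: emeasure_eq_measure2[OF fmeasurable_cell] ennreal_leI)
    also have "\<dots> = (\<integral>\<^sup>+x. indicator (stage s \<inter> cell t c) x \<partial>lborel)"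
      by (rule nn_integral_indicator[symmetric]) simp
    also have "\<dots> \<le> (\<integral>\<^sup>+x\<in>{a<..<b}. indicator (stage s \<inter> cell n j) x \<partial>lborel)"
      using *(6) \<open>cell t c \<subseteq> {a<..<b}\<close> by (intro nn_integral_mono) (auto split: split_indicator)
    finally show "a < b \<and> ennreal (1 / (4 * D) * (b - a)) \<le>
        (\<integral>\<^sup>+x\<in>{a<..<b}. indicator (stage s \<inter> cell n j) x \<partial>lborel)"
      by (simp add: *(1,2) divide_strict_right_mono)
  qed (use Dpos in auto)
  also have "\<dots> \<le> 5 * ennreal (1 / (40 * D * 2 ^ n))"
    unfolding int using assms by (intro mult_left_mono ennreal_leI) (auto simp: sparse_iff)
  also have "\<dots> = ennreal (1 / (4 * D)) * ennreal (1 / 2 * (1 / 2) ^ n)"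
    using Dpos by (simp add: ennreal_mult[symmetric] ennreal_numeral[symmetric] power_divide del: ennreal_numeral)
  finally have "ennreal (1 / (4 * D)) * emeasure lborel (\<Union>(a, b)\<in>K. {a<..<b}) \<le>
      ennreal (1 / (4 * D)) * ennreal (1 / 2 * (1 / 2) ^ n)" .
  then have "emeasure lborel (\<Union>(a, b)\<in>K. {a<..<b}) \<le> ennreal (1 / 2 * (1 / 2) ^ n)"
    using Dpos by (subst (asm) ennreal_mult_le_mult_iff) auto
  moreover have "emeasure lborel (marked_set n j s) \<le> emeasure lborel (\<Union>(a, b)\<in>K. {a<..<b})"
  proof (rule emeasure_mono[OF sub])
    have "open (\<Union>(a, b)\<in>K. {a<..<b})" by (intro open_UN) auto
    then show "(\<Union>(a, b)\<in>K. {a<..<b}) \<in> sets lborel" by simp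
  qed
  ultimately show ?thesis by (rule order_trans[rotated])
qed

lemma newly_marked_cell_subset: "newly_marked n j s i \<Longrightarrow> cell s i \<subseteq> marked_set n j s"
  by (auto simp: newly_marked_def marked_set_def mem_cell_iff)

text \<open>For different levels, a common point is marked at the lower one and, as marks persist,
  at the one just before the higher, where a newly marked cell has to be unmarked.\<close>

lemma newly_marked_disjoint:
  assumes "newly_marked n j s i" "newly_marked n j s' i'" "(s, i) \<noteq> (s', i')"
  shows "cell s i \<inter> cell s' i' = {}"
proof -
  have False if new: "newly_marked n j s i" "newly_marked n j s' i'" and "s < s'"
    and x: "x \<in> cell s i" "x \<in> cell s' i'" for s s' i i' x
  proof -
    have x0: "0 \<le> x" and i: "idx s' x = i'" using x(2) by (simp_all add: mem_cell_iff)
    have "x \<in> marked_set n j s" using newly_marked_cell_subset[OF new(1)] x(1) by blast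
    then have "x \<in> marked_set n j (s' - 1)"
      by (rule subsetD[OF marked_set_mono, rotated]) (use \<open>s < s'\<close> in simp)
    moreover have "i' div 2 = idx (s' - 1) x"
      using idx_Suc_div[OF x0, of "s' - 1"] \<open>s < s'\<close> i by simp
    ultimately show False using new(2) by (simp add: marked_set_def newly_marked_def)
  qed
  note this[OF assms(1,2)] this[OF assms(2,1)]
  moreover have "i = i'" if "s = s'" "x \<in> cell s i" "x \<in> cell s' i'" for x
    using that by (simp add: mem_cell_iff)
  ultimately show ?thesis using assms(3) by (metis disjoint_iff linorder_neqE_nat)
qed

text \<open>A cell of the largest level \<open>S\<close> in \<open>A\<close> certifies sparsity at
  stage \<open>S\<close>. All cells of \<open>A\<close> are disjoint and lie in the marked set of
  that stage.\<close>

lemma sum_newly_marked_le: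
  assumes "finite A" "\<And>s i. (s, i) \<in> A \<Longrightarrow> newly_marked n j s i"
  shows "(\<Sum>p\<in>A. (1 / 2) ^ fst p) \<le> 1 / 2 * (1 / 2 :: real) ^ n"
proof (cases "A = {}")
  case False
  define S where "S = Max (fst ` A)"
  have "S \<in> fst ` A" unfolding S_def using assms(1) False by (intro Max_in) auto
  then obtain k where "(S, k) \<in> A" by auto
  then have S: "sparse n j S" "n \<le> S" using assms(2)[of S k] by (simp_all add: newly_marked_def)
  have le: "s \<le> S" if "(s, i) \<in> A" for s i
    unfolding S_def using assms(1) that by (intro Max_ge) (auto simp: rev_image_eqI)
  have "(\<Sum>p\<in>A. (1 / 2) ^ fst p) = (\<Sum>p\<in>A. measure lborel (case p of (s, i) \<Rightarrow> cell s i))"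
    by (intro sum.cong) (auto simp: measure_cell power_divide)
  also have "\<dots> = measure lborel (\<Union>p\<in>A. case p of (s, i) \<Rightarrow> cell s i)"
  proof (rule measure_finite_Union[symmetric])
    show "disjoint_family_on (\<lambda>p. case p of (s, i) \<Rightarrow> cell s i) A"
      unfolding disjoint_family_on_def
    proof (intro ballI impI)
      fix p q assume "p \<in> A" "q \<in> A" "p \<noteq> q"
      moreover obtain s i s' i' where "p = (s, i)" "q = (s', i')" by fastforce
      ultimately show "(case p of (s, i) \<Rightarrow> cell s i) \<inter> (case q of (s, i) \<Rightarrow> cell s i) = {}"
        using newly_marked_disjoint[of n j s i s' i'] assms(2) by simp
    qed
  qed (use assms(1) in \<open>auto simp: measure_cell split: prod.splits\<close>)
  also have "\<dots> \<le> measure lborel (marked_set n j S)"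
  proof (rule measure_mono_fmeasurable)
    show "(\<Union>p\<in>A. case p of (s, i) \<Rightarrow> cell s i) \<subseteq> marked_set n j S"
      using newly_marked_cell_subset assms(2) marked_set_mono[OF le] by fastforce
    show "(\<Union>p\<in>A. case p of (s, i) \<Rightarrow> cell s i) \<in> sets lborel"
      using assms(1) by (auto split: prod.splits)
    show "marked_set n j S \<in> fmeasurable lborel"
      using emeasure_marked_set_le[OF S] by (auto simp: fmeasurable_def intro: order_le_less_trans)
  qed
  also have "\<dots> \<le> 1 / 2 * (1 / 2) ^ n"
    unfolding measure_def using emeasure_marked_set_le[OF S] by (intro enn2real_leI) simp_all
  finally show ?thesis .
qed simp

definition successor :: "nat \<Rightarrow> nat \<Rightarrow> bool" where
  "successor J K \<longleftrightarrow> newly_marked (fst (prod_decode J)) (snd (prod_decode J)) (fst (prod_decode K)) (snd (prod_decode K))"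

abbreviation generation :: "nat \<Rightarrow> nat \<Rightarrow> nat set" where
  "generation J m \<equiv> {K. (J, K) \<in> {(J, K). successor J K} ^^ m}"

text \<open>Each member is charged to one chosen parent; the children of a parent have at most half
  of its measure, so every generation halves the total.\<close>

lemma sum_generation_le:
  assumes "finite A" "A \<subseteq> generation J m"
  shows "(\<Sum>K\<in>A. (1 / 2) ^ fst (prod_decode K)) \<le> (1 / 2 :: real) ^ m"
  using assms
proof (induction m arbitrary: A)
  case 0
  then have "A \<subseteq> {J}" by auto
  then have "(\<Sum>K\<in>A. (1 / 2 :: real) ^ fst (prod_decode K)) \<le> (\<Sum>K\<in>{J}. (1 / 2) ^ fst (prod_decode K))"
    by (intro sum_mono2) auto
  also have "\<dots> \<le> 1" by (simp add: power_le_one)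
  finally show ?case by simp
next
  case (Suc m)
  have "\<forall>K\<in>A. \<exists>I. I \<in> generation J m \<and> successor I K"
    using Suc.prems(2) by auto
  then obtain parent where parent: "\<And>K. K \<in> A \<Longrightarrow> parent K \<in> generation J m \<and> successor (parent K) K"
    by metis
  have le: "(\<Sum>K\<in>{K \<in> A. parent K = I}. (1 / 2) ^ fst (prod_decode K)) \<le> 1 / 2 * (1 / 2 :: real) ^ fst (prod_decode I)"
    for I
  proof -
    have "(\<Sum>K\<in>{K \<in> A. parent K = I}. (1 / 2 :: real) ^ fst (prod_decode K)) =
        (\<Sum>p\<in>prod_decode ` {K \<in> A. parent K = I}. (1 / 2) ^ fst p)"
      by (subst sum.reindex[OF inj_prod_decode]) simp
    also have "\<dots> \<le> 1 / 2 * (1 / 2) ^ fst (prod_decode I)"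
    proof (rule sum_newly_marked_le[where j = "snd (prod_decode I)"])
      show "finite (prod_decode ` {K \<in> A. parent K = I})" using Suc.prems(1) by simp
      fix s i assume "(s, i) \<in> prod_decode ` {K \<in> A. parent K = I}"
      then obtain K where "K \<in> A" "parent K = I" "prod_decode K = (s, i)" by auto
      then show "newly_marked (fst (prod_decode I)) (snd (prod_decode I)) s i"
        using parent[of K] by (simp add: successor_def)
    qed
    finally show ?thesis .
  qed
  have "(\<Sum>K\<in>A. (1 / 2 :: real) ^ fst (prod_decode K)) =
      (\<Sum>I\<in>parent ` A. \<Sum>K\<in>{K \<in> A. parent K = I}. (1 / 2) ^ fst (prod_decode K))"
    by (rule sum.image_gen[OF Suc.prems(1)])
  also have "\<dots> \<le> (\<Sum>I\<in>parent ` A. 1 / 2 * (1 / 2) ^ fst (prod_decode I))"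
    by (intro sum_mono le)
  also have "\<dots> = 1 / 2 * (\<Sum>I\<in>parent ` A. (1 / 2) ^ fst (prod_decode I))"
    by (rule sum_distrib_left[symmetric])
  also have "\<dots> \<le> 1 / 2 * (1 / 2) ^ m"
    using parent Suc.prems(1) by (intro mult_left_mono Suc.IH) auto
  finally show ?case by simp
qed

text \<open>Tests consist of open intervals, so interiors are used; a random point is not dyadic and
  lies in the interior of each of its cells.\<close>

definition open_cell :: "nat \<Rightarrow> real set" where
  "open_cell K = {real (snd (prod_decode K)) / 2 ^ fst (prod_decode K)<..<
    real (Suc (snd (prod_decode K))) / 2 ^ fst (prod_decode K)}"

definition cell_code :: "nat \<Rightarrow> nat" where
  "cell_code K = prod_encode (dyadic_code (snd (prod_decode K)) (fst (prod_decode K)),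
    dyadic_code (Suc (snd (prod_decode K))) (fst (prod_decode K)))"

lemma rat_interval_cell_code: "rat_interval (cell_code K) = open_cell K"
  by (simp add: cell_code_def open_cell_def)

lemma recursive_cell_code [rec_intros]: "recursive k \<Longrightarrow> recursive (\<lambda>x. cell_code (k x))"
  unfolding cell_code_def by (intro rec_intros)

lemma ml_test_generation: "ml_test (\<lambda>m. {0..1} \<inter> (\<Union>K\<in>generation J m. open_cell K))"
  unfolding ml_test_def
proof (intro conjI allI)
  have "decidable2 successor"
    unfolding successor_def by (intro rec_intros)
  then obtain P g k where P: "decidable P" "recursive g" "recursive k"
    "\<And>m K. (J, K) \<in> {(J, K). successor J K} ^^ m \<longleftrightarrow> (\<exists>x. P x \<and> g x = m \<and> k x = K)"
    by (rule relpow_enumerable[of successor J]) blast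
  show "unif_eff_open (\<lambda>m. {0..1} \<inter> (\<Union>K\<in>generation J m. open_cell K))"
  proof (rule unif_eff_openI[OF P(1,2)])
    show "recursive (\<lambda>x. cell_code (k x))" by (intro rec_intros P)
    show "{0..1} \<inter> (\<Union>K\<in>generation J m. open_cell K) =
        {0..1} \<inter> (\<Union>x\<in>{x. P x \<and> g x = m}. rat_interval (cell_code (k x)))" for m
      unfolding P(4) rat_interval_cell_code by blast
  qed
  fix m
  have "emeasure lborel (\<Union>K\<in>generation J m. open_cell K) \<le> ennreal ((1 / 2) ^ m)"
  proof (rule emeasure_UN_nat_le)
    show "emeasure lborel (open_cell K) \<le> ennreal ((1 / 2) ^ fst (prod_decode K))" for K
      by (simp add: open_cell_def divide_right_mono diff_divide_distrib[symmetric] power_divide)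
  qed (auto simp: open_cell_def intro: sum_generation_le)
  moreover have "emeasure lborel ({0..1} \<inter> (\<Union>K\<in>generation J m. open_cell K)) \<le>
      emeasure lborel (\<Union>K\<in>generation J m. open_cell K)"
    by (rule emeasure_mono) (auto simp: open_cell_def)
  ultimately show "measure lborel ({0..1} \<inter> (\<Union>K\<in>generation J m. open_cell K)) \<le> (1 / 2) ^ m"
    unfolding measure_def by (intro enn2real_leI) (auto intro: order_trans)
qed

text \<open>Otherwise \<open>z\<close> would survive into all generations.\<close>

lemma ml_random_not_marked:
  assumes "ml_random z" and sparse: "\<And>n s. n0 \<le> n \<Longrightarrow> n \<le> s \<Longrightarrow> sparse n (idx n z) s"
  shows "\<exists>n\<ge>n0. \<forall>s. z \<notin> marked_set n (idx n z) s"
proof (rule ccontr)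
  assume "\<not> ?thesis"
  then have marked: "\<exists>s. z \<in> marked_set n (idx n z) s" if "n0 \<le> n" for n using that by blast
  note z = ml_random_bounds[OF assms(1)] ml_random_not_dyadic[OF assms(1)]
  have z0: "0 \<le> z" using z by simp
  define J where "J n = prod_encode (n, idx n z)" for n
  have succ: "\<exists>s\<ge>n0. successor (J n) (J s)" if n: "n0 \<le> n" for n
  proof -
    \<comment> \<open>At the least stage the cell around \<open>z\<close> is marked and the
      enclosing cell one stage earlier is not, so it is newly marked.\<close>
    define s where "s = (LEAST s. z \<in> marked_set n (idx n z) s)"
    have s: "z \<in> marked_set n (idx n z) s" unfolding s_def using marked[OF n] by (rule LeastI_ex)
    then have "n < s" using z0 by (auto simp: marked_set_iff)
    have "z \<notin> marked_set n (idx n z) (s - 1)"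
    proof
      assume "z \<in> marked_set n (idx n z) (s - 1)"
      then have "s \<le> s - 1" unfolding s_def by (rule Least_le)
      with \<open>n < s\<close> show False by simp
    qed
    moreover have "idx s z div 2 = idx (s - 1) z"
      using idx_Suc_div[OF z0, of "s - 1"] \<open>n < s\<close> by simp
    ultimately have "newly_marked n (idx n z) s (idx s z)"
      using s \<open>n < s\<close> sparse[OF n, of s] z0 by (simp add: newly_marked_def marked_set_def)
    then show ?thesis using \<open>n < s\<close> n by (intro exI[of _ s]) (simp add: successor_def J_def)
  qed
  have "\<exists>n\<ge>n0. J n \<in> generation (J n0) m" for m
  proof (induction m)
    case (Suc m)
    then obtain n where "n0 \<le> n" "J n \<in> generation (J n0) m" by blast
    moreover obtain s where "n0 \<le> s" "successor (J n) (J s)" using succ[OF \<open>n0 \<le> n\<close>] by blast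
    ultimately show ?case by (intro exI[of _ s]) auto
  qed auto
  then have "\<exists>n. J n \<in> generation (J n0) m" for m by blast
  moreover have "z \<in> open_cell (J n)" for n
    using idx_bounds(3,4)[OF z0, of n] z(3)[of "idx n z" n] by (simp add: open_cell_def J_def)
  ultimately have "z \<in> {0..1} \<inter> (\<Union>K\<in>generation (J n0) m. open_cell K)" for m
    using z(1,2) by (simp only: Int_iff UN_iff Bex_def) (auto simp: less_imp_le)
  then have "z \<in> (\<Inter>m. {0..1} \<inter> (\<Union>K\<in>generation (J n0) m. open_cell K))" by blast
  with assms(1) ml_test_generation[of "J n0"] show False
    unfolding ml_random_def by blast
qed

end

section \<open>From dyadic to full density\<close>

text \<open>An interval around \<open>z\<close> whose length lies between half a cell and one cell
  of level \<open>t\<close> meets only the cell of \<open>z\<close> and its neighbours. One of these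
  has a third of its mass in \<open>U\<close>, hence more than \<open>\<epsilon> / 6\<close> of a
  cell, which explains the bound on \<open>D\<close>.\<close>

lemma dense_cell_near:
  assumes U: "U \<in> sets borel" "U \<subseteq> {0..1}" and "0 \<le> z" "0 < \<epsilon>" and D: "6 / \<epsilon> < real D"
    and dense: "\<And>d. 0 < d \<Longrightarrow> \<exists>\<gamma> \<delta>. 0 < \<gamma> \<and> \<gamma> < d \<and> 0 < \<delta> \<and> \<delta> < d \<and>
      \<epsilon> * (\<gamma> + \<delta>) < measure lborel ({z - \<gamma>..z + \<delta>} \<inter> U)"
  obtains t b where "N \<le> t" "b \<le> idx t z + 1" "idx t z \<le> b + 1"
    "1 / (real D * 2 ^ t) < measure lborel (U \<inter> cell t b)"
proof -
  obtain \<gamma> \<delta> where gd: "0 < \<gamma>" "\<gamma> < (1 / 2) ^ (N + 2)" "0 < \<delta>" "\<delta> < (1 / 2) ^ (N + 2)"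
    "\<epsilon> * (\<gamma> + \<delta>) < measure lborel ({z - \<gamma>..z + \<delta>} \<inter> U)"
    using dense[of "(1 / 2) ^ (N + 2)"] by auto
  define l where "l = \<gamma> + \<delta>"
  have l: "0 < l" "l < (1 / 2) ^ (N + 1)" using gd by (simp_all add: l_def)
  \<comment> \<open>Thus \<open>l\<close> lies above \<open>1 / 2 ^ k\<close> and not above twice
    this value, and the level is \<open>t = k - 1\<close>. The exponent \<open>N + 2\<close> above
    forces \<open>N \<le> t\<close>.\<close>
  define k where "k = (LEAST k. (1 / 2) ^ k < l)"
  have "\<exists>k. (1 / 2) ^ k < l" using l(1) by (intro real_arch_pow_inv) auto
  then have k: "(1 / 2) ^ k < l" unfolding k_def by (rule LeastI_ex)
  have "N + 1 < k"
  proof (rule ccontr)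
    assume "\<not> N + 1 < k"
    then have "(1 / 2 :: real) ^ (N + 1) \<le> (1 / 2) ^ k" by (intro power_decreasing) auto
    with k l(2) show False by linarith
  qed
  define t where "t = k - 1"
  have t: "N \<le> t" "k = Suc t" using \<open>N + 1 < k\<close> by (auto simp: t_def)
  have "\<not> (1 / 2) ^ t < l" unfolding t_def k_def
    by (rule not_less_Least) (use t(2) in \<open>simp add: k_def[symmetric]\<close>)
  then have lt: "l \<le> 1 / 2 ^ t" by (simp add: power_divide)
  define a where "a = idx t z"
  \<comment> \<open>For \<open>a = 0\<close> the truncated \<open>a - 1\<close> is \<open>a\<close>
    itself, consistent with the absence of a left neighbour.\<close>
  have "{z - \<gamma>..z + \<delta>} \<inter> U \<subseteq> (U \<inter> cell t (a - 1) \<union> U \<inter> cell t a) \<union> U \<inter> cell t (a + 1)"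
  proof
    fix x assume x: "x \<in> {z - \<gamma>..z + \<delta>} \<inter> U"
    then have "0 \<le> x" using U(2) by auto
    have "x - z \<le> l" "z - x \<le> l" using x gd by (auto simp: l_def)
    then have "(x - z) * 2 ^ t \<le> 1" "(z - x) * 2 ^ t \<le> 1"
      using lt by (simp_all add: pos_le_divide_eq[symmetric])
    then have "real (idx t x) < real a + 2" "real a < real (idx t x) + 2"
      using idx_bounds(1,2)[OF \<open>0 \<le> x\<close>, of t] idx_bounds(1,2)[OF \<open>0 \<le> z\<close>, of t]
      by (simp_all add: a_def left_diff_distrib)
    then have "idx t x = a - 1 \<or> idx t x = a \<or> idx t x = a + 1" by linarith
    then show "x \<in> (U \<inter> cell t (a - 1) \<union> U \<inter> cell t a) \<union> U \<inter> cell t (a + 1)"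
      using x \<open>0 \<le> x\<close> by (auto simp: mem_cell_iff)
  qed
  then have "measure lborel ({z - \<gamma>..z + \<delta>} \<inter> U) \<le>
      measure lborel ((U \<inter> cell t (a - 1) \<union> U \<inter> cell t a) \<union> U \<inter> cell t (a + 1))"
    using U(1) by (intro measure_mono_fmeasurable fmeasurable.Un fmeasurable_cell) auto
  also have "\<dots> \<le> measure lborel (U \<inter> cell t (a - 1) \<union> U \<inter> cell t a) + measure lborel (U \<inter> cell t (a + 1))"
    using U(1) by (intro measure_Un_le) auto
  also have "measure lborel (U \<inter> cell t (a - 1) \<union> U \<inter> cell t a) \<le>
      measure lborel (U \<inter> cell t (a - 1)) + measure lborel (U \<inter> cell t a)"
    using U(1) by (intro measure_Un_le) auto
  finally have le: "measure lborel ({z - \<gamma>..z + \<delta>} \<inter> U) \<le> measure lborel (U \<inter> cell t (a - 1)) +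
      measure lborel (U \<inter> cell t a) + measure lborel (U \<inter> cell t (a + 1))"
    by simp
  have "0 < real D" using D \<open>0 < \<epsilon>\<close> by (meson divide_pos_pos less_trans zero_less_numeral)
  then have "3 / real D \<le> \<epsilon> / 2" using D \<open>0 < \<epsilon>\<close> by (simp add: field_simps)
  then have "3 / real D / 2 ^ t \<le> \<epsilon> / 2 / 2 ^ t" by (rule divide_right_mono) simp
  also have "\<dots> = \<epsilon> * (1 / 2) ^ k" by (simp add: t(2) power_divide)
  also have "\<dots> < \<epsilon> * l" using k \<open>0 < \<epsilon>\<close> by simp
  also have "\<dots> < measure lborel ({z - \<gamma>..z + \<delta>} \<inter> U)" using gd(5) by (simp add: l_def)
  finally have big: "3 * (1 / (real D * 2 ^ t)) < measure lborel ({z - \<gamma>..z + \<delta>} \<inter> U)" by simp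
  have "\<exists>b\<in>{a - 1, a, a + 1}. 1 / (real D * 2 ^ t) < measure lborel (U \<inter> cell t b)"
  proof (rule ccontr)
    assume "\<not> ?thesis"
    then have "measure lborel (U \<inter> cell t (a - 1)) \<le> 1 / (real D * 2 ^ t)"
      "measure lborel (U \<inter> cell t a) \<le> 1 / (real D * 2 ^ t)"
      "measure lborel (U \<inter> cell t (a + 1)) \<le> 1 / (real D * 2 ^ t)"
      by (auto simp: not_less)
    with le have "measure lborel ({z - \<gamma>..z + \<delta>} \<inter> U) \<le>
        1 / (real D * 2 ^ t) + 1 / (real D * 2 ^ t) + 1 / (real D * 2 ^ t)"
      by (meson add_mono order_trans)
    also have "\<dots> = 3 * (1 / (real D * 2 ^ t))" by simp
    finally show False using big leD by blast
  qed
  then obtain b where "b \<in> {a - 1, a, a + 1}" "1 / (real D * 2 ^ t) < measure lborel (U \<inter> cell t b)"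
    by blast
  then show ?thesis using t(1) by (intro that[of t b]) (auto simp: a_def)
qed

lemma dyadic_lebesgue_points_imp_density_random:
  assumes z01: "z \<in> {0..1}" and leb: "\<And>f. integral_test f \<Longrightarrow> dyadic_lebesgue_point f z"
  shows "density_random z"
proof -
  have ml: "ml_random z"
    by (rule finite_integral_tests_imp_ml_random[OF z01]) (use leb in \<open>auto simp: dyadic_lebesgue_point_def\<close>)
  note z = ml_random_bounds[OF ml] and z_nondyadic = ml_random_not_dyadic[OF ml]
  have z0: "0 \<le> z" using z by simp
  have thin: "\<forall>\<^sub>F n in sequentially. measure lborel (V \<inter> cell n (idx n z)) < \<epsilon> / 2 ^ n"
    if "eff_open V" "z \<notin> V" "0 < \<epsilon>" for V \<epsilon>
    using dyadic_lebesgue_point_indicator[OF leb[OF integral_test_indicator[OF that(1)]] that(2)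
        eff_open_borel[OF that(1)] z0 z(2) that(3)] .
  have "lower_density C z = 1" if C: "eff_closed C" "z \<in> C" for C
  proof (rule ccontr)
    assume not1: "lower_density C z \<noteq> 1"
    define U where "U = {0..1} - C"
    have U: "eff_open U" "z \<notin> U" "U \<subseteq> {0..1}" "C = {0..1} - U"
      using C by (auto simp: U_def eff_closed_def)
    note U_borel [measurable] = eff_open_borel[OF U(1)]
    have "\<not> (\<forall>\<epsilon>>0. \<exists>d>0. \<forall>\<gamma> \<delta>. 0 < \<gamma> \<longrightarrow> \<gamma> < d \<longrightarrow> 0 < \<delta> \<longrightarrow> \<delta> < d \<longrightarrow>
        measure lborel ({z - \<gamma>..z + \<delta>} \<inter> U) \<le> \<epsilon> * (\<gamma> + \<delta>))"
      using not1 unfolding U(4) lower_density_eq_1_iff[OF z U_borel U(3)] .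
    then obtain \<epsilon> where \<epsilon>: "0 < \<epsilon>" and
      not: "\<not> (\<exists>d>0. \<forall>\<gamma> \<delta>. 0 < \<gamma> \<longrightarrow> \<gamma> < d \<longrightarrow> 0 < \<delta> \<longrightarrow> \<delta> < d \<longrightarrow>
        measure lborel ({z - \<gamma>..z + \<delta>} \<inter> U) \<le> \<epsilon> * (\<gamma> + \<delta>))"
      by blast
    have dense: "\<exists>\<gamma> \<delta>. 0 < \<gamma> \<and> \<gamma> < d \<and> 0 < \<delta> \<and> \<delta> < d \<and>
        \<epsilon> * (\<gamma> + \<delta>) < measure lborel ({z - \<gamma>..z + \<delta>} \<inter> U)" if "0 < d" for d
      using not that by (meson not_le)
    obtain D where D: "6 / \<epsilon> < real D" using reals_Archimedean2 by blast
    have "0 < real D" using D \<epsilon> by (meson divide_pos_pos less_trans zero_less_numeral)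
    obtain u where u: "decidable2 u" "\<And>s i. u s i \<Longrightarrow> i < 2 ^ s"
      "\<And>s i. u s i \<Longrightarrow> {real i / 2 ^ s..real (Suc i) / 2 ^ s} \<subseteq> U"
      "\<And>s i i'. u s i \<Longrightarrow> i' div 2 = i \<Longrightarrow> u (Suc s) i'"
      "\<And>x. x \<in> U \<Longrightarrow> x < 1 \<Longrightarrow> \<exists>s. u s (idx s x)"
      using eff_open_cells[OF U(1)] by blast
    interpret cell_set u D
      by unfold_locales (use u(1,4) \<open>0 < real D\<close> in auto)
    have stage_U: "stage s \<subseteq> U" for s
    proof
      fix x assume "x \<in> stage s"
      then have x: "0 \<le> x" "u s (idx s x)" by (simp_all add: stage_def)
      then show "x \<in> U" using u(3)[OF x(2)] idx_bounds(3,4)[OF x(1), of s] by auto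
    qed
    \<comment> \<open>This fraction is the threshold in \<open>sparse_iff\<close>; stages are
      subsets of \<open>U\<close>, so the late cells around \<open>z\<close> are sparse at all
      stages.\<close>
    have "\<forall>\<^sub>F n in sequentially. measure lborel (U \<inter> cell n (idx n z)) < 1 / (40 * D) / 2 ^ n"
      using \<open>0 < real D\<close> by (intro thin U) simp
    then obtain n0 where n0: "\<And>n. n0 \<le> n \<Longrightarrow> measure lborel (U \<inter> cell n (idx n z)) < 1 / (40 * D) / 2 ^ n"
      by (auto simp: eventually_sequentially)
    have "sparse n (idx n z) s" if "n0 \<le> n" "n \<le> s" for n s
    proof -
      have "measure lborel (stage s \<inter> cell n (idx n z)) \<le> measure lborel (U \<inter> cell n (idx n z))"
        using stage_U by (intro measure_mono_fmeasurable fmeasurable_cell) auto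
      then show ?thesis using n0[OF that(1)] by (simp add: sparse_iff[OF that(2)])
    qed
    then obtain n where n: "n0 \<le> n" "\<And>s. z \<notin> marked_set n (idx n z) s"
      using ml_random_not_marked[OF ml] by blast
    define j where "j = idx n z"
    have cell_j: "0 \<le> x \<and> x < 1" if "x \<in> cell n j" for x
    proof -
      have "Suc j \<le> 2 ^ n" using idx_less[OF z0 z(2), of n] by (simp add: j_def)
      then have "real (Suc j) \<le> 2 ^ n" by (drule_tac of_nat_mono[where 'a = real]) simp
      then have "real (Suc j) / 2 ^ n \<le> 1" by simp
      moreover have "real j / 2 ^ n \<le> x" "x < real (Suc j) / 2 ^ n"
        using that unfolding cell_def by auto
      moreover have "0 \<le> real j / 2 ^ n" by simp
      ultimately show ?thesis by linarith
    qed
    \<comment> \<open>All marks ever made within the cell \<open>(n, j)\<close>, which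
      \<open>z\<close> avoids; being effectively open, \<open>V\<close> has a test of its own to
      which the hypothesis applies.\<close>
    define V where "V = {0..1} \<inter> (\<Union>K\<in>{K. marked n j (fst (prod_decode K)) (snd (prod_decode K))}. open_cell K)"
    have V: "eff_open V"
    proof (rule eff_openI)
      show "decidable (\<lambda>K. marked n j (fst (prod_decode K)) (snd (prod_decode K)))"
        by (intro rec_intros)
      show "recursive cell_code" using recursive_cell_code[OF recursive_id] .
    qed (simp add: V_def rat_interval_cell_code)
    note V_borel [measurable] = eff_open_borel[OF V]
    have "z \<notin> V"
    proof
      assume "z \<in> V"
      then obtain K where K: "marked n j (fst (prod_decode K)) (snd (prod_decode K))" "z \<in> open_cell K"
        by (auto simp: V_def)
      then have "z \<in> cell (fst (prod_decode K)) (snd (prod_decode K))"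
        by (auto simp: open_cell_def cell_def)
      then have "idx (fst (prod_decode K)) z = snd (prod_decode K)"
        by (simp add: mem_cell_iff)
      then have "z \<in> marked_set n j (fst (prod_decode K))"
        using K(1) z0 by (simp add: marked_set_def)
      then show False using n(2) by (simp add: j_def)
    qed
    \<comment> \<open>The distance from \<open>z\<close> to the border of the cell
      \<open>(n, j)\<close>, positive as \<open>z\<close> is not dyadic. Neighbours at level
      \<open>t\<close> begin within \<open>2 / 2 ^ t\<close> of \<open>z\<close>, so late ones lie
      in this cell.\<close>
    define \<rho> where "\<rho> = min (z - real j / 2 ^ n) (real (Suc j) / 2 ^ n - z)"
    have "real j / 2 ^ n < z"
      using idx_bounds(3)[OF z0, of n] z_nondyadic[of j n] by (simp add: j_def less_le)
    moreover have "z < real (Suc j) / 2 ^ n"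
      using idx_bounds(4)[OF z0, of n] by (simp add: j_def)
    ultimately have "0 < \<rho>" unfolding \<rho>_def by simp
    have "(\<lambda>t. 2 * (1 / 2 :: real) ^ t) \<longlonglongrightarrow> 2 * 0"
      by (intro tendsto_mult tendsto_const LIMSEQ_power_zero) simp
    then have "\<forall>\<^sub>F t in sequentially. 2 * (1 / 2) ^ t < \<rho>"
      using \<open>0 < \<rho>\<close> by (intro order_tendstoD) auto
    moreover have "\<forall>\<^sub>F t in sequentially. measure lborel (V \<inter> cell t (idx t z)) < 1 / 2 / 2 ^ t"
      by (intro thin V \<open>z \<notin> V\<close>) simp
    moreover have "\<forall>\<^sub>F t in sequentially. measure lborel (U \<inter> cell t (idx t z)) < 1 / D / 2 ^ t"
      using \<open>0 < real D\<close> by (intro thin U) simp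
    ultimately have "\<forall>\<^sub>F t in sequentially. 2 * (1 / 2) ^ t < \<rho> \<and>
        measure lborel (V \<inter> cell t (idx t z)) < 1 / 2 / 2 ^ t \<and>
        measure lborel (U \<inter> cell t (idx t z)) < 1 / D / 2 ^ t \<and> n \<le> t"
      using eventually_ge_at_top[of n] by eventually_elim auto
    then obtain N where N: "\<And>t. N \<le> t \<Longrightarrow> 2 * (1 / 2) ^ t < \<rho> \<and>
        measure lborel (V \<inter> cell t (idx t z)) < 1 / 2 / 2 ^ t \<and>
        measure lborel (U \<inter> cell t (idx t z)) < 1 / D / 2 ^ t \<and> n \<le> t"
      by (auto simp: eventually_sequentially)
    obtain t b where tb: "N \<le> t" "b \<le> idx t z + 1" "idx t z \<le> b + 1"
      "1 / (real D * 2 ^ t) < measure lborel (U \<inter> cell t b)"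
      using dense_cell_near[OF U_borel U(3) z0 \<epsilon> D dense] by blast
    have t: "2 * (1 / 2) ^ t < \<rho>" "measure lborel (V \<inter> cell t (idx t z)) < 1 / 2 / 2 ^ t"
      "measure lborel (U \<inter> cell t (idx t z)) < 1 / D / 2 ^ t" "n \<le> t"
      using N[OF tb(1)] by auto
    define a where "a = idx t z"
    \<comment> \<open>In its own cell around \<open>z\<close> the set \<open>U\<close> has density
      below \<open>1 / D\<close>, so the dense cell is a proper neighbour.\<close>
    have "b \<noteq> a" using t(3) tb(4) by (auto simp: a_def)
    then have b: "b = a + 1 \<or> a = b + 1" using tb(2,3) by (auto simp: a_def)
    have b_j: "b div 2 ^ (t - n) = j"
    proof -
      define y where "y = real b / 2 ^ t"
      have y0: "0 \<le> y" by (simp add: y_def)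
      have idx_y: "idx t y = b" using y0 by (simp add: idx_eq_iff y_def)
      have zt: "real a \<le> z * 2 ^ t" "z * 2 ^ t < real a + 1"
        using idx_bounds(1,2)[OF z0, of t] by (simp_all add: a_def)
      have "real b \<le> real a + 1" "real a \<le> real b + 1" using b by auto
      with zt have "(z - y) * 2 ^ t \<le> 2" "(y - z) * 2 ^ t \<le> 2"
        by (simp_all add: y_def left_diff_distrib)
      then have "z - y \<le> 2 * (1 / 2) ^ t" "y - z \<le> 2 * (1 / 2) ^ t"
        by (simp_all add: power_divide pos_le_divide_eq)
      then have "y \<in> cell n j" using t(1) by (auto simp: cell_def \<rho>_def)
      then have "idx n y = j" by (simp add: mem_cell_iff)
      then show ?thesis using idx_div_le[OF y0 t(4)] idx_y by simp
    qed
    have a_j: "a div 2 ^ (t - n) = j"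
      using idx_div_le[OF z0 t(4)] by (simp add: a_def j_def)
    have "(\<lambda>s. measure lborel (stage s \<inter> cell t b)) \<longlonglongrightarrow> measure lborel (\<Union>s. stage s \<inter> cell t b)"
    proof (rule Lim_measure_incseq)
      show "range (\<lambda>s. stage s \<inter> cell t b) \<subseteq> sets lborel" by auto
      show "incseq (\<lambda>s. stage s \<inter> cell t b)" using incseq_stage by (auto simp: incseq_def)
      have "(\<Union>s. stage s \<inter> cell t b) \<in> fmeasurable lborel"
        by (rule fmeasurable_cell'[of _ t b]) auto
      then show "emeasure lborel (\<Union>s. stage s \<inter> cell t b) \<noteq> \<infinity>" by (auto simp: fmeasurable_def)
    qed
    moreover have "U \<inter> cell t b = (\<Union>s. stage s \<inter> cell t b)"
    proof
      show "(\<Union>s. stage s \<inter> cell t b) \<subseteq> U \<inter> cell t b" using stage_U by blast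
      show "U \<inter> cell t b \<subseteq> (\<Union>s. stage s \<inter> cell t b)"
      proof
        fix x assume x: "x \<in> U \<inter> cell t b"
        then have "0 \<le> x \<and> x < 1" using cell_j cell_subset[OF t(4) b_j] by blast
        with x u(5)[of x] show "x \<in> (\<Union>s. stage s \<inter> cell t b)" by (auto simp: stage_def)
      qed
    qed
    ultimately have "\<forall>\<^sub>F s in sequentially. 1 / (real D * 2 ^ t) < measure lborel (stage s \<inter> cell t b)"
      using tb(4) by (intro order_tendstoD) auto
    then have "\<forall>\<^sub>F s in sequentially. 1 / (real D * 2 ^ t) < measure lborel (stage s \<inter> cell t b) \<and> t < s"
      using eventually_gt_at_top by (rule eventually_conj)
    then obtain S where S: "1 / (real D * 2 ^ t) < measure lborel (stage S \<inter> cell t b)" "t < S"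
      by (auto simp: eventually_sequentially)
    then have dense_S: "dense_neighbour n j S t a"
      unfolding dense_neighbour_def using b b_j less_count_iff[of t S b] by (intro exI[of _ b]) auto
    \<comment> \<open>The left half of the cell around \<open>z\<close> is marked by stage
      \<open>S\<close>, so \<open>V\<close> fills half of that cell up to a null set, against the
      thinness of \<open>V\<close> at \<open>z\<close>.\<close>
    have "emeasure lborel (cell (Suc t) (2 * a)) \<le> emeasure lborel (V \<inter> cell t a)"
    proof (rule emeasure_mono_AE)
      show "AE x in lborel. x \<in> cell (Suc t) (2 * a) \<longrightarrow> x \<in> V \<inter> cell t a"
        using AE_not_dyadic
      proof eventually_elim
        case (elim x)
        show ?case
        proof
          assume x: "x \<in> cell (Suc t) (2 * a)"
          then have x_cell: "x \<in> cell t a" using cell_subset[of t "Suc t" "2 * a" a] by auto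
          then have "x \<in> cell n j" using cell_subset[OF t(4) a_j] by blast
          have x0: "0 \<le> x" and idx: "idx (Suc t) x = 2 * a" "idx t x = a" "idx n x = j"
            using x x_cell \<open>x \<in> cell n j\<close> by (simp_all add: mem_cell_iff)
          then have "x \<in> marked_set n j S"
            using S(2) t(4) dense_S by (auto simp: marked_set_iff intro!: exI[of _ t])
          then have "marked n j S (idx S x)" by (simp add: marked_set_def)
          moreover have "x \<in> open_cell (prod_encode (S, idx S x))"
            using idx_bounds(3,4)[OF x0, of S] elim[rule_format, of "idx S x" S] by (simp add: open_cell_def less_le)
          ultimately have "x \<in> V"
            using cell_j[OF \<open>x \<in> cell n j\<close>] unfolding V_def
            by (intro IntI UN_I[of "prod_encode (S, idx S x)"]) auto
          with x_cell show "x \<in> V \<inter> cell t a" by blast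
        qed
      qed
    qed simp
    then have "1 / 2 ^ Suc t \<le> measure lborel (V \<inter> cell t a)"
      by (simp add: measure_cell emeasure_eq_measure2[OF fmeasurable_cell] ennreal_le_iff)
    with t(2) show False by (simp add: a_def)
  qed
  with ml show ?thesis by (simp add: density_random_def)
qed

theorem theorem15p5:
  fixes z :: real
  assumes "z \<in> {0..1}"
  shows "(density_random z \<longleftrightarrow> (\<forall>f. integral_test f \<longrightarrow> dyadic_lebesgue_point f z))
       \<and> ((\<forall>f. integral_test f \<longrightarrow> dyadic_lebesgue_point f z)
            \<longleftrightarrow> (\<forall>f. integral_test f \<longrightarrow> lebesgue_point f z))"
  using dyadic_lebesgue_points_imp_density_random[OF assms] density_random_imp_lebesgue_point
    lebesgue_point_imp_dyadic_lebesgue_point by blast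

end
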